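(* Let $A,B$ be (finite dimensional) associative central simple algebras over a field $F$. Suppose there are skew matrix algebras $M_n(F;c)$ and $M_{n'}(F;c')$, for reduced skew sets $c,c'$ over $F$, such that $A\otimes_F M_n(F;c)\cong B\otimes_F M_{n'}(F;c')$ as $F$-algebras. Then $A$ and $B$ are Brauer equivalent in the classical sense, i.e. $A\otimes_F M_{m'}(F)\cong B\otimes_F M_m(F)$ for some $m,m'\ge1$.
   Context: A reduced skew set of degree $n$ over $F$ is a family $c=(c_{ijk})_{1\le i,j,k\le n}$ of scalars in $F$ (zeros allowed) with $c_{iij}=c_{ijj}=1$ for all $i,j$. The skew matrix algebra $M_n(F;c)$ is the (in general nonassociative) $F$-algebra with basis $\{e_{ij}\}_{1\le i,j\le n}$ and multiplication $e_{ij}e_{k\ell}=\delta_{jk}c_{ij\ell}e_{i\ell}$. *)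

theory Defs
  imports "HOL-Algebra.Module" "HOL-Algebra.QuotRing"
begin

section \<open>Central simple algebras\<close>

text \<open>
  The locale \<^locale>\<open>algebra\<close> of HOL-Algebra requires the algebra to be commutative, hence the
  following variant for associative unital algebras.
\<close>

locale assoc_algebra = module F A + ring A for F (structure) and A (structure) +
  assumes smult_mult_left:
      "\<lbrakk>r \<in> carrier F; x \<in> carrier A; y \<in> carrier A\<rbrakk> \<Longrightarrow>
        (r \<odot>\<^bsub>A\<^esub> x) \<otimes>\<^bsub>A\<^esub> y = r \<odot>\<^bsub>A\<^esub> (x \<otimes>\<^bsub>A\<^esub> y)"
    and smult_mult_right:
      "\<lbrakk>r \<in> carrier F; x \<in> carrier A; y \<in> carrier A\<rbrakk> \<Longrightarrow>
        x \<otimes>\<^bsub>A\<^esub> (r \<odot>\<^bsub>A\<^esub> y) = r \<odot>\<^bsub>A\<^esub> (x \<otimes>\<^bsub>A\<^esub> y)"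

definition finite_dimensional :: "('f, 'k) ring_scheme \<Rightarrow> ('f, 'a, 'm) module_scheme \<Rightarrow> bool" where
  "finite_dimensional F A \<longleftrightarrow>
    (\<exists>S. finite S \<and> S \<subseteq> carrier A \<and>
      (\<forall>x\<in>carrier A. \<exists>u\<in>S \<rightarrow> carrier F. x = (\<Oplus>\<^bsub>A\<^esub>s\<in>S. u s \<odot>\<^bsub>A\<^esub> s)))"

definition center :: "('a, 'm) ring_scheme \<Rightarrow> 'a set" where
  "center A = {z \<in> carrier A. \<forall>x\<in>carrier A. z \<otimes>\<^bsub>A\<^esub> x = x \<otimes>\<^bsub>A\<^esub> z}"

locale central_simple_algebra = field F + assoc_algebra F A for F (structure) and A (structure) +
  assumes finite_dim: "finite_dimensional F A"
    and nontrivial: "carrier A \<noteq> {\<zero>\<^bsub>A\<^esub>}"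
    and simple: "ideal I A \<Longrightarrow> I = {\<zero>\<^bsub>A\<^esub>} \<or> I = carrier A"
    and central: "center A = {r \<odot>\<^bsub>A\<^esub> \<one>\<^bsub>A\<^esub> | r. r \<in> carrier F}"


section \<open>Isomorphism of algebras that need not be associative\<close>

text \<open>
  Such an algebra is an element of the record type \<^type>\<open>module_scheme\<close>. The set \<^const>\<open>ring_iso\<close>
  is defined for arbitrary records. Its elements preserve \<open>\<one>\<close>, which is automatic for bijective
  multiplicative maps between unital algebras.
\<close>

definition algebra_isomorphic ::
  "('f, 'k) ring_scheme \<Rightarrow> ('f, 'a, 'm) module_scheme \<Rightarrow> ('f, 'b, 'n) module_scheme \<Rightarrow> bool" where
  "algebra_isomorphic F A B \<longleftrightarrow>
    (\<exists>h\<in>ring_iso A B. \<forall>r\<in>carrier F. \<forall>x\<in>carrier A. h (r \<odot>\<^bsub>A\<^esub> x) = r \<odot>\<^bsub>B\<^esub> h x)"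


section \<open>Tensor product of two algebras\<close>

text \<open>
  The tensor product is the free module on the set \<open>carrier A \<times> carrier B\<close>, divided by the bilinear
  relations. The free module carries the product extending
  \<open>(a, b) * (a', b') = (a a', b b')\<close> bilinearly, and for algebras \<open>A\<close>, \<open>B\<close> the span of the
  relations is an ideal. No associativity is involved. Elements of the free module are the finitely
  supported coefficient functions.
\<close>

definition free_single ::
  "('f, 'k) ring_scheme \<Rightarrow> ('f, 'a, 'm) module_scheme \<Rightarrow> ('f, 'b, 'n) module_scheme \<Rightarrow>
    'a \<times> 'b \<Rightarrow> 'a \<times> 'b \<Rightarrow> 'f" where
  "free_single F A B p = (\<lambda>q\<in>carrier A \<times> carrier B. if q = p then \<one>\<^bsub>F\<^esub> else \<zero>\<^bsub>F\<^esub>)"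

definition free_supp ::
  "('f, 'k) ring_scheme \<Rightarrow> ('f, 'a, 'm) module_scheme \<Rightarrow> ('f, 'b, 'n) module_scheme \<Rightarrow>
    ('a \<times> 'b \<Rightarrow> 'f) \<Rightarrow> ('a \<times> 'b) set" where
  "free_supp F A B f = {p \<in> carrier A \<times> carrier B. f p \<noteq> \<zero>\<^bsub>F\<^esub>}"

definition free_algebra ::
  "('f, 'k) ring_scheme \<Rightarrow> ('f, 'a, 'm) module_scheme \<Rightarrow> ('f, 'b, 'n) module_scheme \<Rightarrow>
    ('f, 'a \<times> 'b \<Rightarrow> 'f) module" where
  "free_algebra F A B =
    \<lparr>carrier = {f \<in> carrier A \<times> carrier B \<rightarrow>\<^sub>E carrier F. finite (free_supp F A B f)},
     mult = (\<lambda>f g. \<lambda>p\<in>carrier A \<times> carrier B.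
       \<Oplus>\<^bsub>F\<^esub>s\<in>{(q, r). q \<in> free_supp F A B f \<and> r \<in> free_supp F A B g \<and>
                  (fst q \<otimes>\<^bsub>A\<^esub> fst r, snd q \<otimes>\<^bsub>B\<^esub> snd r) = p}. f (fst s) \<otimes>\<^bsub>F\<^esub> g (snd s)),
     one = free_single F A B (\<one>\<^bsub>A\<^esub>, \<one>\<^bsub>B\<^esub>),
     zero = (\<lambda>p\<in>carrier A \<times> carrier B. \<zero>\<^bsub>F\<^esub>),
     add = (\<lambda>f g. \<lambda>p\<in>carrier A \<times> carrier B. f p \<oplus>\<^bsub>F\<^esub> g p),
     smult = (\<lambda>r f. \<lambda>p\<in>carrier A \<times> carrier B. r \<otimes>\<^bsub>F\<^esub> f p)\<rparr>"

definition tensor_relations ::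
  "('f, 'k) ring_scheme \<Rightarrow> ('f, 'a, 'm) module_scheme \<Rightarrow> ('f, 'b, 'n) module_scheme \<Rightarrow>
    ('a \<times> 'b \<Rightarrow> 'f) set" where
  "tensor_relations F A B = (let P = free_algebra F A B; d = free_single F A B in
     {d (a \<oplus>\<^bsub>A\<^esub> a', b) \<ominus>\<^bsub>P\<^esub> (d (a, b) \<oplus>\<^bsub>P\<^esub> d (a', b)) | a a' b.
        a \<in> carrier A \<and> a' \<in> carrier A \<and> b \<in> carrier B} \<union>
     {d (a, b \<oplus>\<^bsub>B\<^esub> b') \<ominus>\<^bsub>P\<^esub> (d (a, b) \<oplus>\<^bsub>P\<^esub> d (a, b')) | a b b'.
        a \<in> carrier A \<and> b \<in> carrier B \<and> b' \<in> carrier B} \<union>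
     {d (r \<odot>\<^bsub>A\<^esub> a, b) \<ominus>\<^bsub>P\<^esub> r \<odot>\<^bsub>P\<^esub> d (a, b) | r a b.
        r \<in> carrier F \<and> a \<in> carrier A \<and> b \<in> carrier B} \<union>
     {d (a, r \<odot>\<^bsub>B\<^esub> b) \<ominus>\<^bsub>P\<^esub> r \<odot>\<^bsub>P\<^esub> d (a, b) | r a b.
        r \<in> carrier F \<and> a \<in> carrier A \<and> b \<in> carrier B})"

definition tensor_kernel ::
  "('f, 'k) ring_scheme \<Rightarrow> ('f, 'a, 'm) module_scheme \<Rightarrow> ('f, 'b, 'n) module_scheme \<Rightarrow>
    ('a \<times> 'b \<Rightarrow> 'f) set" where
  "tensor_kernel F A B =
    \<Inter>{H. submodule H F (free_algebra F A B) \<and> tensor_relations F A B \<subseteq> H}"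

text \<open>The ring operations below are those of \<^const>\<open>FactRing\<close>.\<close>

definition tensor_algebra ::
  "('f, 'k) ring_scheme \<Rightarrow> ('f, 'a, 'm) module_scheme \<Rightarrow> ('f, 'b, 'n) module_scheme \<Rightarrow>
    ('f, ('a \<times> 'b \<Rightarrow> 'f) set) module" where
  "tensor_algebra F A B = (let P = free_algebra F A B; K = tensor_kernel F A B in
    \<lparr>carrier = a_rcosets\<^bsub>P\<^esub> K, mult = rcoset_mult P K,
     one = K +>\<^bsub>P\<^esub> \<one>\<^bsub>P\<^esub>, zero = K, add = set_add P,
     smult = (\<lambda>r X. \<Union>x\<in>X. K +>\<^bsub>P\<^esub> (r \<odot>\<^bsub>P\<^esub> x))\<rparr>)"


section \<open>Skew matrix algebras\<close>

definition reduced_skew_set ::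
  "('f, 'k) ring_scheme \<Rightarrow> nat \<Rightarrow> (nat \<Rightarrow> nat \<Rightarrow> nat \<Rightarrow> 'f) \<Rightarrow> bool" where
  "reduced_skew_set F n c \<longleftrightarrow>
    (\<forall>i\<in>{1..n}. \<forall>j\<in>{1..n}. \<forall>k\<in>{1..n}. c i j k \<in> carrier F) \<and>
    (\<forall>i\<in>{1..n}. \<forall>j\<in>{1..n}. c i i j = \<one>\<^bsub>F\<^esub> \<and> c i j j = \<one>\<^bsub>F\<^esub>)"

text \<open>
  The element \<open>\<Sum> x\<^sub>i\<^sub>j e\<^sub>i\<^sub>j\<close> is represented by its family of coordinates. The product is the bilinear
  extension of the rule for the \<open>e\<^sub>i\<^sub>j\<close>, see \<open>skew_matrix_unit_mult\<close> below. The identity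
  element is \<open>\<Sum> e\<^sub>i\<^sub>i\<close>, which is neutral when \<open>c\<close> is reduced.
\<close>

definition skew_matrix_algebra ::
  "('f, 'k) ring_scheme \<Rightarrow> nat \<Rightarrow> (nat \<Rightarrow> nat \<Rightarrow> nat \<Rightarrow> 'f) \<Rightarrow> ('f, nat \<times> nat \<Rightarrow> 'f) module" where
  "skew_matrix_algebra F n c =
    \<lparr>carrier = {1..n} \<times> {1..n} \<rightarrow>\<^sub>E carrier F,
     mult = (\<lambda>x y. \<lambda>(i, l)\<in>{1..n} \<times> {1..n}.
       \<Oplus>\<^bsub>F\<^esub>j\<in>{1..n}. c i j l \<otimes>\<^bsub>F\<^esub> (x (i, j) \<otimes>\<^bsub>F\<^esub> y (j, l))),
     one = (\<lambda>(i, j)\<in>{1..n} \<times> {1..n}. if i = j then \<one>\<^bsub>F\<^esub> else \<zero>\<^bsub>F\<^esub>),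
     zero = (\<lambda>p\<in>{1..n} \<times> {1..n}. \<zero>\<^bsub>F\<^esub>),
     add = (\<lambda>x y. \<lambda>p\<in>{1..n} \<times> {1..n}. x p \<oplus>\<^bsub>F\<^esub> y p),
     smult = (\<lambda>r x. \<lambda>p\<in>{1..n} \<times> {1..n}. r \<otimes>\<^bsub>F\<^esub> x p)\<rparr>"

definition skew_matrix_unit :: "('f, 'k) ring_scheme \<Rightarrow> nat \<Rightarrow> nat \<Rightarrow> nat \<Rightarrow> nat \<times> nat \<Rightarrow> 'f" where
  "skew_matrix_unit F n i j = (\<lambda>p\<in>{1..n} \<times> {1..n}. if p = (i, j) then \<one>\<^bsub>F\<^esub> else \<zero>\<^bsub>F\<^esub>)"

lemma skew_matrix_unit_mult:
  fixes F (structure) and n :: nat and c :: "nat \<Rightarrow> nat \<Rightarrow> nat \<Rightarrow> _"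
  defines "M \<equiv> skew_matrix_algebra F n c" and "e \<equiv> skew_matrix_unit F n"
  assumes "field F" and c: "reduced_skew_set F n c"
    and ix: "i \<in> {1..n}" "j \<in> {1..n}" "k \<in> {1..n}" "l \<in> {1..n}"
  shows "e i j \<otimes>\<^bsub>M\<^esub> e k l = (if j = k then c i j l \<odot>\<^bsub>M\<^esub> e i l else \<zero>\<^bsub>M\<^esub>)"
proof
  interpret field F by fact
  have cc: "c a b d \<in> carrier F" if "a \<in> {1..n}" "b \<in> {1..n}" "d \<in> {1..n}" for a b d
    using c that unfolding reduced_skew_set_def by blast
  fix p :: "nat \<times> nat"
  obtain a b where p: "p = (a, b)" by (cases p)
  show "(e i j \<otimes>\<^bsub>M\<^esub> e k l) p = (if j = k then c i j l \<odot>\<^bsub>M\<^esub> e i l else \<zero>\<^bsub>M\<^esub>) p"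
  proof (cases "a \<in> {1..n} \<and> b \<in> {1..n}")
    case False
    then show ?thesis
      by (auto simp: p M_def skew_matrix_algebra_def)
  next
    case True
    then have ab: "a \<in> {1..n}" "b \<in> {1..n}" by auto
    have "(e i j \<otimes>\<^bsub>M\<^esub> e k l) p =
        (\<Oplus>d\<in>{1..n}. c a d b \<otimes> (e i j (a, d) \<otimes> e k l (d, b)))"
      using ab by (simp add: p M_def skew_matrix_algebra_def)
    also have "\<dots> = (\<Oplus>d\<in>{1..n}. if j = d then (if a = i \<and> b = l \<and> j = k then c i j l else \<zero>) else \<zero>)"
      by (rule add.finprod_cong') (use ab ix cc in \<open>auto simp: e_def skew_matrix_unit_def\<close>)
    also have "\<dots> = (if a = i \<and> b = l \<and> j = k then c i j l else \<zero>)"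
      by (rule add.finprod_singleton) (use ix cc in auto)
    also have "\<dots> = (if j = k then c i j l \<odot>\<^bsub>M\<^esub> e i l else \<zero>\<^bsub>M\<^esub>) p"
      using ab ix cc by (auto simp: p M_def e_def skew_matrix_algebra_def skew_matrix_unit_def)
    finally show ?thesis .
  qed
qed

definition matrix_algebra :: "('f, 'k) ring_scheme \<Rightarrow> nat \<Rightarrow> ('f, nat \<times> nat \<Rightarrow> 'f) module" where
  "matrix_algebra F n = skew_matrix_algebra F n (\<lambda>i j k. \<one>\<^bsub>F\<^esub>)"

lemma matrix_algebra_mult:
  fixes F (structure)
  assumes "field F" and "x \<in> carrier (matrix_algebra F n)" "y \<in> carrier (matrix_algebra F n)"
    and "i \<in> {1..n}" "l \<in> {1..n}"
  shows "(x \<otimes>\<^bsub>matrix_algebra F n\<^esub> y) (i, l) = (\<Oplus>j\<in>{1..n}. x (i, j) \<otimes> y (j, l))"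
proof -
  interpret field F by fact
  have "x \<in> {1..n} \<times> {1..n} \<rightarrow> carrier F" "y \<in> {1..n} \<times> {1..n} \<rightarrow> carrier F"
    using assms by (auto simp: matrix_algebra_def skew_matrix_algebra_def)
  then have xy: "x (i, j) \<otimes> y (j, l) \<in> carrier F" if "j \<in> {1..n}" for j
    using assms that by (blast intro: m_closed)
  have "(x \<otimes>\<^bsub>matrix_algebra F n\<^esub> y) (i, l) = (\<Oplus>j\<in>{1..n}. \<one> \<otimes> (x (i, j) \<otimes> y (j, l)))"
    using assms(4,5) by (simp add: matrix_algebra_def skew_matrix_algebra_def)
  also have "\<dots> = (\<Oplus>j\<in>{1..n}. x (i, j) \<otimes> y (j, l))"
    by (rule add.finprod_cong') (use xy in auto)
  finally show ?thesis .
qed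


section \<open>Brauer equivalence\<close>

definition brauer_equivalent ::
  "('f, 'k) ring_scheme \<Rightarrow> ('f, 'a, 'm) module_scheme \<Rightarrow> ('f, 'b, 'n) module_scheme \<Rightarrow> bool" where
  "brauer_equivalent F A B \<longleftrightarrow>
    (\<exists>m m'. m \<ge> 1 \<and> m' \<ge> 1 \<and>
      algebra_isomorphic F (tensor_algebra F A (matrix_algebra F m'))
        (tensor_algebra F B (matrix_algebra F m)))"

end

theory Submission
  imports Defs
begin

text \<open>
  Let \<open>S = M\<^sub>n(A; c)\<close> be \<open>A \<otimes> M\<^sub>n(F; c)\<close>, written as twisted matrices over \<open>A\<close>. Its nucleus \<open>R\<close> is an
  associative algebra, invariant under isomorphisms of \<open>S\<close>, that contains the diagonal matrices. For
  \<open>e = e\<^sub>q\<^sub>q\<close> the corner \<open>eRe\<close> is isomorphic to \<open>A\<close>, and \<open>J(e) = {x. eRxRe = 0}\<close> is the largest ideal of \<open>R\<close>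
  that avoids \<open>e\<close>, because \<open>A\<close> is simple. If \<open>e\<^sub>i\<^sub>i \<notin> J(e)\<close>, then \<open>e\<^sub>i\<^sub>i = u v\<close> and \<open>e = v u\<close> for some \<open>u\<close>, \<open>v\<close> in
  \<open>R\<close>, so \<open>R / J(e)\<close> is the matrix algebra \<open>M\<^sub>m(A)\<close>, where \<open>m\<close> counts these \<open>i\<close>. An isomorphism with
  \<open>M(B; c')\<close> carries \<open>J(e)\<close> to the radical \<open>J(e'\<^sub>j\<^sub>j)\<close> of any \<open>e'\<^sub>j\<^sub>j\<close> outside its image, and
  such a \<open>j\<close> exists since the \<open>e'\<^sub>j\<^sub>j\<close> sum to one. Hence \<open>M\<^sub>m(A)\<close> and a matrix algebra over \<open>B\<close> are isomorphic.
\<close>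

section \<open>Modules of functions\<close>

text \<open>Coefficients of \<open>c\<close> may vanish, so neither S nor its nucleus need be
  simple, and A cannot be read off from R directly. For n = 2 and c_121 = c_212 = 0 the algebra S is
  associative, so R is all of S; its off-diagonal matrices form an ideal of square zero with
  quotient A x A. This is why one quotient R / J(e) has to be singled out. Its kernel must also
  survive an isomorphism that does not match the diagonal idempotents of the two sides, and J(e)
  does: it is determined by the ring and by e alone. The elements u and v are e_iq and a scalar
  multiple of e_qi. Zero coefficients could spoil both their membership in R and their products; the
  simplicity of A secures the former, associativity inside the nucleus the latter. A further
  obstacle is that tensor products are given by generators and relations, where neither entries nor
  corners are visible. They are therefore exchanged for twisted matrices at both ends of the
  argument, for the given sets \<open>c\<close>, \<open>c'\<close> and again for the constant set
  one.\<close>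

text \<open>The carrier is only required to be a closed part of the function space, so one argument
  covers twisted matrices over \<open>A\<close> and the finitely supported coefficient functions of
  the free module.\<close>

lemma pointwise_module:
  fixes F (structure) and M (structure) and L (structure)
  assumes "module F M"
    and carrier: "carrier L \<subseteq> I \<rightarrow>\<^sub>E carrier M"
    and add: "\<And>x y. x \<oplus>\<^bsub>L\<^esub> y = (\<lambda>p\<in>I. x p \<oplus>\<^bsub>M\<^esub> y p)"
    and zero: "\<zero>\<^bsub>L\<^esub> = (\<lambda>p\<in>I. \<zero>\<^bsub>M\<^esub>)"
    and smult: "\<And>r x. r \<odot>\<^bsub>L\<^esub> x = (\<lambda>p\<in>I. r \<odot>\<^bsub>M\<^esub> x p)"
    and add_closed: "\<And>x y. x \<in> carrier L \<Longrightarrow> y \<in> carrier L \<Longrightarrow> x \<oplus>\<^bsub>L\<^esub> y \<in> carrier L"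
    and zero_closed: "\<zero>\<^bsub>L\<^esub> \<in> carrier L"
    and smult_closed: "\<And>r x. r \<in> carrier F \<Longrightarrow> x \<in> carrier L \<Longrightarrow> r \<odot>\<^bsub>L\<^esub> x \<in> carrier L"
  shows "module F L"
proof -
  interpret M: module F M by fact
  have val: "x p \<in> carrier M" if "x \<in> carrier L" "p \<in> I" for x p
    using that carrier by blast
  have ext: "x = y" if "x \<in> carrier L" "y \<in> carrier L" "\<And>p. p \<in> I \<Longrightarrow> x p = y p" for x y
    by (rule PiE_ext[of _ I "\<lambda>_. carrier M"]) (use that carrier in auto)
  have ap: "(x \<oplus>\<^bsub>L\<^esub> y) p = x p \<oplus>\<^bsub>M\<^esub> y p" "\<zero>\<^bsub>L\<^esub> p = \<zero>\<^bsub>M\<^esub>" "(r \<odot>\<^bsub>L\<^esub> x) p = r \<odot>\<^bsub>M\<^esub> x p"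
    if "p \<in> I" for p x y r
    using that by (simp_all add: add zero smult)
  note closed = add_closed zero_closed smult_closed
  show ?thesis
  proof (rule moduleI)
    show "cring F" ..
    show "abelian_group L"
    proof (rule abelian_groupI)
      fix x assume x: "x \<in> carrier L"
      \<comment> \<open>Negatives are multiples by \<open>\<ominus> \<one>\<close>, so their
        membership follows from closure under scalars.\<close>
      show "\<exists>y\<in>carrier L. y \<oplus>\<^bsub>L\<^esub> x = \<zero>\<^bsub>L\<^esub>"
      proof (rule bexI)
        show c: "\<ominus> \<one> \<odot>\<^bsub>L\<^esub> x \<in> carrier L" using x by (intro smult_closed) auto
        show "(\<ominus> \<one> \<odot>\<^bsub>L\<^esub> x) \<oplus>\<^bsub>L\<^esub> x = \<zero>\<^bsub>L\<^esub>"
          by (rule ext) (use x c closed in \<open>auto simp: ap val M.smult_l_minus M.M.l_neg\<close>)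
      qed
    next
      fix x y z assume xyz: "x \<in> carrier L" "y \<in> carrier L" "z \<in> carrier L"
      show "x \<oplus>\<^bsub>L\<^esub> y \<oplus>\<^bsub>L\<^esub> z = x \<oplus>\<^bsub>L\<^esub> (y \<oplus>\<^bsub>L\<^esub> z)"
        by (rule ext) (use xyz closed in \<open>auto simp: ap val M.M.a_assoc\<close>)
    next
      fix x y assume xyz: "x \<in> carrier L" "y \<in> carrier L"
      show "x \<oplus>\<^bsub>L\<^esub> y = y \<oplus>\<^bsub>L\<^esub> x"
        by (rule ext) (use xyz closed in \<open>auto simp: ap val M.M.a_comm\<close>)
    next
      fix x assume xyz: "x \<in> carrier L"
      show "\<zero>\<^bsub>L\<^esub> \<oplus>\<^bsub>L\<^esub> x = x"
        by (rule ext) (use xyz closed in \<open>auto simp: ap val\<close>)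
    qed (use closed in auto)
  next
    fix a b x assume *: "a \<in> carrier F" "b \<in> carrier F" "x \<in> carrier L"
    show "(a \<oplus> b) \<odot>\<^bsub>L\<^esub> x = a \<odot>\<^bsub>L\<^esub> x \<oplus>\<^bsub>L\<^esub> b \<odot>\<^bsub>L\<^esub> x"
      by (rule ext) (use * closed in \<open>auto simp: ap val M.smult_l_distr\<close>)
    show "(a \<otimes> b) \<odot>\<^bsub>L\<^esub> x = a \<odot>\<^bsub>L\<^esub> (b \<odot>\<^bsub>L\<^esub> x)"
      by (rule ext) (use * closed in \<open>auto simp: ap val M.smult_assoc1\<close>)
  next
    fix a x y assume *: "a \<in> carrier F" "x \<in> carrier L" "y \<in> carrier L"
    show "a \<odot>\<^bsub>L\<^esub> (x \<oplus>\<^bsub>L\<^esub> y) = a \<odot>\<^bsub>L\<^esub> x \<oplus>\<^bsub>L\<^esub> a \<odot>\<^bsub>L\<^esub> y"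
      by (rule ext) (use * closed in \<open>auto simp: ap val M.smult_r_distr\<close>)
  next
    fix x assume x: "x \<in> carrier L"
    show "\<one> \<odot>\<^bsub>L\<^esub> x = x"
      by (rule ext) (use x closed in \<open>auto simp: ap val\<close>)
  qed (use closed in auto)
qed

text \<open>Only addition and zero enter, so the statement applies to matrices, to the free module
  and to the nucleus, whose sums are formed relative to a smaller carrier.\<close>

lemma pointwise_finsum:
  assumes "abelian_group L" "abelian_group M"
    and carrier: "carrier L \<subseteq> I \<rightarrow>\<^sub>E carrier M"
    and add: "\<And>x y. x \<oplus>\<^bsub>L\<^esub> y = (\<lambda>p\<in>I. x p \<oplus>\<^bsub>M\<^esub> y p)"
    and zero: "\<zero>\<^bsub>L\<^esub> = (\<lambda>p\<in>I. \<zero>\<^bsub>M\<^esub>)"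
    and "finite J" "f \<in> J \<rightarrow> carrier L" "p \<in> I"
  shows "(\<Oplus>\<^bsub>L\<^esub>j\<in>J. f j) p = (\<Oplus>\<^bsub>M\<^esub>j\<in>J. f j p)"
proof -
  interpret L: abelian_group L by fact
  interpret M: abelian_group M by fact
  have val: "x p \<in> carrier M" if "x \<in> carrier L" for x
    using that carrier \<open>p \<in> I\<close> by blast
  show ?thesis
    using \<open>finite J\<close> \<open>f \<in> J \<rightarrow> carrier L\<close>
  proof (induction J)
    case empty
    then show ?case using \<open>p \<in> I\<close> by (simp add: zero)
  next
    case (insert j J)
    then have "f j \<in> carrier L" "f \<in> J \<rightarrow> carrier L" by auto
    moreover from this have "(\<lambda>j. f j p) \<in> J \<rightarrow> carrier M" using val by auto
    ultimately show ?case
      using insert \<open>p \<in> I\<close> by (simp add: add val)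
  qed
qed

section \<open>Nuclei of nonassociative algebras\<close>

text \<open>Associativity is absent on purpose: twisted matrices satisfy these axioms for every
  reduced set, and the target of a map out of a tensor product has to satisfy no more than
  this.\<close>

locale unital_algebra = module F T for F (structure) and T (structure) +
  assumes mult_closed [simp, intro]:
      "\<lbrakk>x \<in> carrier T; y \<in> carrier T\<rbrakk> \<Longrightarrow> x \<otimes>\<^bsub>T\<^esub> y \<in> carrier T"
    and unit_closed [simp, intro]: "\<one>\<^bsub>T\<^esub> \<in> carrier T"
    and unit_left [simp]: "x \<in> carrier T \<Longrightarrow> \<one>\<^bsub>T\<^esub> \<otimes>\<^bsub>T\<^esub> x = x"
    and unit_right [simp]: "x \<in> carrier T \<Longrightarrow> x \<otimes>\<^bsub>T\<^esub> \<one>\<^bsub>T\<^esub> = x"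
    and distr_left: "\<lbrakk>x \<in> carrier T; y \<in> carrier T; z \<in> carrier T\<rbrakk> \<Longrightarrow>
        (x \<oplus>\<^bsub>T\<^esub> y) \<otimes>\<^bsub>T\<^esub> z = x \<otimes>\<^bsub>T\<^esub> z \<oplus>\<^bsub>T\<^esub> y \<otimes>\<^bsub>T\<^esub> z"
    and distr_right: "\<lbrakk>x \<in> carrier T; y \<in> carrier T; z \<in> carrier T\<rbrakk> \<Longrightarrow>
        z \<otimes>\<^bsub>T\<^esub> (x \<oplus>\<^bsub>T\<^esub> y) = z \<otimes>\<^bsub>T\<^esub> x \<oplus>\<^bsub>T\<^esub> z \<otimes>\<^bsub>T\<^esub> y"
    and smult_left: "\<lbrakk>r \<in> carrier F; x \<in> carrier T; y \<in> carrier T\<rbrakk> \<Longrightarrow>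
        (r \<odot>\<^bsub>T\<^esub> x) \<otimes>\<^bsub>T\<^esub> y = r \<odot>\<^bsub>T\<^esub> (x \<otimes>\<^bsub>T\<^esub> y)"
    and smult_right: "\<lbrakk>r \<in> carrier F; x \<in> carrier T; y \<in> carrier T\<rbrakk> \<Longrightarrow>
        x \<otimes>\<^bsub>T\<^esub> (r \<odot>\<^bsub>T\<^esub> y) = r \<odot>\<^bsub>T\<^esub> (x \<otimes>\<^bsub>T\<^esub> y)"

definition nucleus :: "('a, 'm) monoid_scheme \<Rightarrow> 'a set" where
  "nucleus T = {x \<in> carrier T. \<forall>y\<in>carrier T. \<forall>z\<in>carrier T.
     (x \<otimes>\<^bsub>T\<^esub> y) \<otimes>\<^bsub>T\<^esub> z = x \<otimes>\<^bsub>T\<^esub> (y \<otimes>\<^bsub>T\<^esub> z) \<and>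
     (y \<otimes>\<^bsub>T\<^esub> x) \<otimes>\<^bsub>T\<^esub> z = y \<otimes>\<^bsub>T\<^esub> (x \<otimes>\<^bsub>T\<^esub> z) \<and>
     (y \<otimes>\<^bsub>T\<^esub> z) \<otimes>\<^bsub>T\<^esub> x = y \<otimes>\<^bsub>T\<^esub> (z \<otimes>\<^bsub>T\<^esub> x)}"

lemma nucleusD:
  assumes "x \<in> nucleus T" "y \<in> carrier T" "z \<in> carrier T"
  shows "(x \<otimes>\<^bsub>T\<^esub> y) \<otimes>\<^bsub>T\<^esub> z = x \<otimes>\<^bsub>T\<^esub> (y \<otimes>\<^bsub>T\<^esub> z)"
    and "(y \<otimes>\<^bsub>T\<^esub> x) \<otimes>\<^bsub>T\<^esub> z = y \<otimes>\<^bsub>T\<^esub> (x \<otimes>\<^bsub>T\<^esub> z)"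
    and "(y \<otimes>\<^bsub>T\<^esub> z) \<otimes>\<^bsub>T\<^esub> x = y \<otimes>\<^bsub>T\<^esub> (z \<otimes>\<^bsub>T\<^esub> x)"
  using assms unfolding nucleus_def by auto

lemma nucleus_subset: "nucleus T \<subseteq> carrier T"
  by (auto simp: nucleus_def)

lemmas nucleus_carrier = subsetD[OF nucleus_subset]

context unital_algebra
begin

text \<open>Each law for the product reduces to laws of \<open>x\<close> and \<open>y\<close> in
  which a product serves as one of the two other elements. The middle law uses the middle laws of
  both and, to regroup at the end, the left law of \<open>x\<close>.\<close>

lemma nucleus_mult:
  assumes x: "x \<in> nucleus T" and y: "y \<in> nucleus T"
  shows "x \<otimes>\<^bsub>T\<^esub> y \<in> nucleus T"
proof -
  have [simp]: "x \<in> carrier T" "y \<in> carrier T" using x y by (auto simp: nucleus_def)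
  have "(x \<otimes>\<^bsub>T\<^esub> y \<otimes>\<^bsub>T\<^esub> z) \<otimes>\<^bsub>T\<^esub> w = x \<otimes>\<^bsub>T\<^esub> y \<otimes>\<^bsub>T\<^esub> (z \<otimes>\<^bsub>T\<^esub> w)"
    "(z \<otimes>\<^bsub>T\<^esub> (x \<otimes>\<^bsub>T\<^esub> y)) \<otimes>\<^bsub>T\<^esub> w = z \<otimes>\<^bsub>T\<^esub> (x \<otimes>\<^bsub>T\<^esub> y \<otimes>\<^bsub>T\<^esub> w)"
    "(z \<otimes>\<^bsub>T\<^esub> w) \<otimes>\<^bsub>T\<^esub> (x \<otimes>\<^bsub>T\<^esub> y) = z \<otimes>\<^bsub>T\<^esub> (w \<otimes>\<^bsub>T\<^esub> (x \<otimes>\<^bsub>T\<^esub> y))"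
    if [simp]: "z \<in> carrier T" "w \<in> carrier T" for z w
  proof -
    show "(x \<otimes>\<^bsub>T\<^esub> y \<otimes>\<^bsub>T\<^esub> z) \<otimes>\<^bsub>T\<^esub> w = x \<otimes>\<^bsub>T\<^esub> y \<otimes>\<^bsub>T\<^esub> (z \<otimes>\<^bsub>T\<^esub> w)"
      by (simp add: nucleusD(1)[OF x] nucleusD(1)[OF y])
    show "(z \<otimes>\<^bsub>T\<^esub> (x \<otimes>\<^bsub>T\<^esub> y)) \<otimes>\<^bsub>T\<^esub> w = z \<otimes>\<^bsub>T\<^esub> (x \<otimes>\<^bsub>T\<^esub> y \<otimes>\<^bsub>T\<^esub> w)"
    proof -
      have "(z \<otimes>\<^bsub>T\<^esub> (x \<otimes>\<^bsub>T\<^esub> y)) \<otimes>\<^bsub>T\<^esub> w = ((z \<otimes>\<^bsub>T\<^esub> x) \<otimes>\<^bsub>T\<^esub> y) \<otimes>\<^bsub>T\<^esub> w"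
        by (simp add: nucleusD(2)[OF x])
      also have "\<dots> = (z \<otimes>\<^bsub>T\<^esub> x) \<otimes>\<^bsub>T\<^esub> (y \<otimes>\<^bsub>T\<^esub> w)"
        by (rule nucleusD(2)[OF y]) auto
      also have "\<dots> = z \<otimes>\<^bsub>T\<^esub> (x \<otimes>\<^bsub>T\<^esub> y \<otimes>\<^bsub>T\<^esub> w)"
        by (simp add: nucleusD(1,2)[OF x])
      finally show ?thesis .
    qed
    show "(z \<otimes>\<^bsub>T\<^esub> w) \<otimes>\<^bsub>T\<^esub> (x \<otimes>\<^bsub>T\<^esub> y) = z \<otimes>\<^bsub>T\<^esub> (w \<otimes>\<^bsub>T\<^esub> (x \<otimes>\<^bsub>T\<^esub> y))"
      by (simp add: nucleusD(3)[OF y, symmetric] nucleusD(3)[OF x])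
  qed
  then show ?thesis by (simp add: nucleus_def)
qed

lemma nucleus_add:
  assumes x: "x \<in> nucleus T" and y: "y \<in> nucleus T"
  shows "x \<oplus>\<^bsub>T\<^esub> y \<in> nucleus T"
proof -
  have [simp]: "x \<in> carrier T" "y \<in> carrier T" using x y by (auto simp: nucleus_def)
  show ?thesis
    unfolding nucleus_def
    by (auto simp: nucleusD[OF x] nucleusD[OF y] distr_left distr_right)
qed

lemma nucleus_smult:
  assumes x: "x \<in> nucleus T" and "r \<in> carrier F"
  shows "r \<odot>\<^bsub>T\<^esub> x \<in> nucleus T"
proof -
  have [simp]: "x \<in> carrier T" using x by (auto simp: nucleus_def)
  show ?thesis
    unfolding nucleus_def using \<open>r \<in> carrier F\<close>
    by (auto simp: nucleusD[OF x] smult_left smult_right)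
qed

lemma unit_nucleus: "\<one>\<^bsub>T\<^esub> \<in> nucleus T"
  by (auto simp: nucleus_def)

lemma nucleus_minus:
  assumes x: "x \<in> nucleus T"
  shows "\<ominus>\<^bsub>T\<^esub> x \<in> nucleus T"
  using nucleus_smult[OF x, of "\<ominus> \<one>"] smult_l_minus[of "\<one>" x] x
  by (simp add: nucleus_carrier)

lemma nucleus_zero: "\<zero>\<^bsub>T\<^esub> \<in> nucleus T"
  using nucleus_smult[OF unit_nucleus, of "\<zero>"] by simp

text \<open>Replacing the carrier alone keeps all operations, so every law other than associativity
  is inherited from \<open>T\<close>. Associativity is the left nucleus law, whose other two
  elements may be arbitrary in \<open>T\<close>.\<close>

lemma nucleus_algebra: "assoc_algebra F (T\<lparr>carrier := nucleus T\<rparr>)"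
proof -
  have "submodule (nucleus T) F T"
    using nucleus_add nucleus_smult nucleus_minus nucleus_zero
    by (intro submoduleI) (auto intro: nucleus_carrier)
  then interpret N: module F "T\<lparr>carrier := nucleus T\<rparr>"
    by (rule submodule.submodule_is_module) (rule module_axioms)
  have "monoid (T\<lparr>carrier := nucleus T\<rparr>)"
    by (rule monoidI) (auto simp: nucleus_mult unit_nucleus nucleusD(1) nucleus_carrier)
  then have "ring (T\<lparr>carrier := nucleus T\<rparr>)"
    by (intro ringI N.abelian_group_axioms) (auto simp: distr_left distr_right nucleus_carrier)
  then show ?thesis
    by (intro assoc_algebra.intro N.module_axioms assoc_algebra_axioms.intro)
       (auto simp: smult_left smult_right nucleus_carrier)
qed

end

text \<open>Every element of \<open>T\<close> is an image under \<open>h\<close>, so each instance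
  of the three laws at \<open>h x\<close> is the image of an instance at \<open>x\<close>.\<close>

lemma nucleus_iso:
  assumes h: "h \<in> ring_iso S T" and x: "x \<in> nucleus S"
    and closed: "\<And>x y. x \<in> carrier S \<Longrightarrow> y \<in> carrier S \<Longrightarrow> x \<otimes>\<^bsub>S\<^esub> y \<in> carrier S"
  shows "h x \<in> nucleus T"
proof -
  have bij: "bij_betw h (carrier S) (carrier T)"
    and mult: "\<And>x y. x \<in> carrier S \<Longrightarrow> y \<in> carrier S \<Longrightarrow> h (x \<otimes>\<^bsub>S\<^esub> y) = h x \<otimes>\<^bsub>T\<^esub> h y"
    using h by (auto simp: ring_iso_def ring_hom_def)
  have img: "carrier T = h ` carrier S" using bij by (simp add: bij_betw_def)
  have [simp]: "x \<in> carrier S" using x by (rule nucleus_carrier)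
  show ?thesis
    unfolding nucleus_def img
    by (auto simp: mult[symmetric] closed nucleusD[OF x])
qed

section \<open>Twisted matrices over an associative algebra\<close>

lemma (in abelian_monoid) finsum_single:
  assumes "finite J" "i \<in> J" "f i \<in> carrier G" "\<And>j. j \<in> J \<Longrightarrow> j \<noteq> i \<Longrightarrow> f j = \<zero>"
  shows "(\<Oplus>j\<in>J. f j) = f i"
proof -
  have "(\<Oplus>j\<in>J. f j) = (\<Oplus>j\<in>J. if i = j then f j else \<zero>)"
    by (rule add.finprod_cong') (use assms in auto)
  also have "\<dots> = (\<Oplus>j\<in>J. if i = j then f i else \<zero>)"
    by (rule add.finprod_cong') (use assms in auto)
  also have "\<dots> = f i"
    by (rule add.finprod_singleton) (use assms in auto)
  finally show ?thesis .
qed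

text \<open>The coefficients act on products of entries through the scalar multiplication of
  \<open>A\<close>. With all coefficients one this is the ordinary matrix ring over
  \<open>A\<close>, the form in which the quotients of the nucleus appear.\<close>

definition skew_matrices ::
  "('f, 'a, 'm) module_scheme \<Rightarrow> nat \<Rightarrow> (nat \<Rightarrow> nat \<Rightarrow> nat \<Rightarrow> 'f) \<Rightarrow> ('f, nat \<times> nat \<Rightarrow> 'a) module" where
  "skew_matrices A n c =
    \<lparr>carrier = {1..n} \<times> {1..n} \<rightarrow>\<^sub>E carrier A,
     mult = (\<lambda>x y. \<lambda>(i, l)\<in>{1..n} \<times> {1..n}.
       \<Oplus>\<^bsub>A\<^esub>j\<in>{1..n}. c i j l \<odot>\<^bsub>A\<^esub> (x (i, j) \<otimes>\<^bsub>A\<^esub> y (j, l))),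
     one = (\<lambda>(i, j)\<in>{1..n} \<times> {1..n}. if i = j then \<one>\<^bsub>A\<^esub> else \<zero>\<^bsub>A\<^esub>),
     zero = (\<lambda>p\<in>{1..n} \<times> {1..n}. \<zero>\<^bsub>A\<^esub>),
     add = (\<lambda>x y. \<lambda>p\<in>{1..n} \<times> {1..n}. x p \<oplus>\<^bsub>A\<^esub> y p),
     smult = (\<lambda>r x. \<lambda>p\<in>{1..n} \<times> {1..n}. r \<odot>\<^bsub>A\<^esub> x p)\<rparr>"

text \<open>The matrix a e_ij. For a position outside the index square it is the zero matrix, so
  membership in the carrier holds without conditions on i and j.\<close>

definition single_entry :: "('a, 'm) ring_scheme \<Rightarrow> nat \<Rightarrow> nat \<Rightarrow> nat \<Rightarrow> 'a \<Rightarrow> nat \<times> nat \<Rightarrow> 'a" where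
  "single_entry A n i j a = (\<lambda>p\<in>{1..n} \<times> {1..n}. if p = (i, j) then a else \<zero>\<^bsub>A\<^esub>)"

locale skew_matrix_ring = assoc_algebra F A for F (structure) and A (structure) +
  fixes n :: nat and c :: "nat \<Rightarrow> nat \<Rightarrow> nat \<Rightarrow> _"
  assumes reduced: "reduced_skew_set F n c"
begin

abbreviation S where "S \<equiv> skew_matrices A n c"
abbreviation E where "E \<equiv> single_entry A n"

lemma c_closed [simp, intro]:
  "i \<in> {1..n} \<Longrightarrow> j \<in> {1..n} \<Longrightarrow> k \<in> {1..n} \<Longrightarrow> c i j k \<in> carrier F"
  using reduced unfolding reduced_skew_set_def by blast

lemma c_unit [simp]:
  "i \<in> {1..n} \<Longrightarrow> j \<in> {1..n} \<Longrightarrow> c i i j = \<one>" "i \<in> {1..n} \<Longrightarrow> j \<in> {1..n} \<Longrightarrow> c i j j = \<one>"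
  using reduced unfolding reduced_skew_set_def by blast+

lemma S_carrier: "carrier S = {1..n} \<times> {1..n} \<rightarrow>\<^sub>E carrier A"
  by (simp add: skew_matrices_def)

lemma S_zero: "\<zero>\<^bsub>S\<^esub> = (\<lambda>p\<in>{1..n} \<times> {1..n}. \<zero>\<^bsub>A\<^esub>)"
  and S_add: "x \<oplus>\<^bsub>S\<^esub> y = (\<lambda>p\<in>{1..n} \<times> {1..n}. x p \<oplus>\<^bsub>A\<^esub> y p)"
  and S_smult: "r \<odot>\<^bsub>S\<^esub> x = (\<lambda>p\<in>{1..n} \<times> {1..n}. r \<odot>\<^bsub>A\<^esub> x p)"
  by (simp_all add: skew_matrices_def)

lemma S_val [simp, intro]:
  "x \<in> carrier S \<Longrightarrow> i \<in> {1..n} \<Longrightarrow> j \<in> {1..n} \<Longrightarrow> x (i, j) \<in> carrier A"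
  by (auto simp: S_carrier)

lemma S_ext:
  "x \<in> carrier S \<Longrightarrow> y \<in> carrier S \<Longrightarrow>
    (\<And>i j. i \<in> {1..n} \<Longrightarrow> j \<in> {1..n} \<Longrightarrow> x (i, j) = y (i, j)) \<Longrightarrow> x = y"
  unfolding S_carrier by (rule PiE_ext) auto

lemma S_mult_entry:
  "i \<in> {1..n} \<Longrightarrow> l \<in> {1..n} \<Longrightarrow>
    (x \<otimes>\<^bsub>S\<^esub> y) (i, l) = (\<Oplus>\<^bsub>A\<^esub>j\<in>{1..n}. c i j l \<odot>\<^bsub>A\<^esub> (x (i, j) \<otimes>\<^bsub>A\<^esub> y (j, l)))"
  by (simp add: skew_matrices_def)

lemma S_one_entry:
  "i \<in> {1..n} \<Longrightarrow> j \<in> {1..n} \<Longrightarrow> \<one>\<^bsub>S\<^esub> (i, j) = (if i = j then \<one>\<^bsub>A\<^esub> else \<zero>\<^bsub>A\<^esub>)"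
  by (simp add: skew_matrices_def)

lemma S_add_entry:
  "i \<in> {1..n} \<Longrightarrow> j \<in> {1..n} \<Longrightarrow> (x \<oplus>\<^bsub>S\<^esub> y) (i, j) = x (i, j) \<oplus>\<^bsub>A\<^esub> y (i, j)"
  by (simp add: skew_matrices_def)

lemma S_zero_entry: "i \<in> {1..n} \<Longrightarrow> j \<in> {1..n} \<Longrightarrow> \<zero>\<^bsub>S\<^esub> (i, j) = \<zero>\<^bsub>A\<^esub>"
  by (simp add: skew_matrices_def)

lemma S_smult_entry:
  "i \<in> {1..n} \<Longrightarrow> j \<in> {1..n} \<Longrightarrow> (r \<odot>\<^bsub>S\<^esub> x) (i, j) = r \<odot>\<^bsub>A\<^esub> x (i, j)"
  by (simp add: skew_matrices_def)

lemma S_mult_term: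
  assumes "x \<in> carrier S" "y \<in> carrier S" "i \<in> {1..n}" "j \<in> {1..n}" "l \<in> {1..n}"
  shows "c i j l \<odot>\<^bsub>A\<^esub> (x (i, j) \<otimes>\<^bsub>A\<^esub> y (j, l)) \<in> carrier A"
  by (rule smult_closed) (use assms in auto)

lemma S_mult_closed: "x \<in> carrier S \<Longrightarrow> y \<in> carrier S \<Longrightarrow> x \<otimes>\<^bsub>S\<^esub> y \<in> carrier S"
  unfolding skew_matrices_def
  by (auto simp: S_carrier intro!: M.finsum_closed smult_closed)

lemma S_one_closed: "\<one>\<^bsub>S\<^esub> \<in> carrier S"
  by (auto simp: skew_matrices_def)

lemma S_add_closed: "x \<in> carrier S \<Longrightarrow> y \<in> carrier S \<Longrightarrow> x \<oplus>\<^bsub>S\<^esub> y \<in> carrier S"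
  by (auto simp: S_carrier S_add intro!: M.a_closed)

lemma S_smult_closed: "r \<in> carrier F \<Longrightarrow> x \<in> carrier S \<Longrightarrow> r \<odot>\<^bsub>S\<^esub> x \<in> carrier S"
  by (auto simp: S_carrier S_smult intro!: smult_closed)

lemma E_closed [simp, intro]: "a \<in> carrier A \<Longrightarrow> E i j a \<in> carrier S"
  by (auto simp: single_entry_def S_carrier)

lemma E_entry:
  "k \<in> {1..n} \<Longrightarrow> l \<in> {1..n} \<Longrightarrow> E i j a (k, l) = (if k = i \<and> l = j then a else \<zero>\<^bsub>A\<^esub>)"
  by (simp add: single_entry_def)

text \<open>In the defining sum only the index \<open>j\<close> contributes: left multiplication by
  a e_ij puts row j of \<open>y\<close>, multiplied by a, into row i with the weights
  \<open>c i j l\<close>. The mirror image for columns is \<open>mult_E_entry\<close>.\<close>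

lemma E_mult_entry:
  assumes "y \<in> carrier S" "a \<in> carrier A"
    and "i \<in> {1..n}" "j \<in> {1..n}" "k \<in> {1..n}" "l \<in> {1..n}"
  shows "(E i j a \<otimes>\<^bsub>S\<^esub> y) (k, l) = (if k = i then c i j l \<odot>\<^bsub>A\<^esub> (a \<otimes>\<^bsub>A\<^esub> y (j, l)) else \<zero>\<^bsub>A\<^esub>)"
proof -
  have "(\<Oplus>\<^bsub>A\<^esub>d\<in>{1..n}. c k d l \<odot>\<^bsub>A\<^esub> (E i j a (k, d) \<otimes>\<^bsub>A\<^esub> y (d, l))) =
      c k j l \<odot>\<^bsub>A\<^esub> (E i j a (k, j) \<otimes>\<^bsub>A\<^esub> y (j, l))"
    by (rule M.finsum_single) (use assms in \<open>auto simp: E_entry intro!: smult_closed\<close>)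
  then show ?thesis
    using assms by (simp add: S_mult_entry E_entry)
qed

lemma mult_E_entry:
  assumes "x \<in> carrier S" "a \<in> carrier A"
    and "i \<in> {1..n}" "j \<in> {1..n}" "k \<in> {1..n}" "l \<in> {1..n}"
  shows "(x \<otimes>\<^bsub>S\<^esub> E i j a) (k, l) = (if l = j then c k i j \<odot>\<^bsub>A\<^esub> (x (k, i) \<otimes>\<^bsub>A\<^esub> a) else \<zero>\<^bsub>A\<^esub>)"
proof -
  have "(\<Oplus>\<^bsub>A\<^esub>d\<in>{1..n}. c k d l \<odot>\<^bsub>A\<^esub> (x (k, d) \<otimes>\<^bsub>A\<^esub> E i j a (d, l))) =
      c k i l \<odot>\<^bsub>A\<^esub> (x (k, i) \<otimes>\<^bsub>A\<^esub> E i j a (i, l))"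
    by (rule M.finsum_single) (use assms in \<open>auto simp: E_entry intro!: smult_closed\<close>)
  then show ?thesis
    using assms by (simp add: S_mult_entry E_entry)
qed

lemma E_mult_E:
  assumes "a \<in> carrier A" "b \<in> carrier A"
    and "i \<in> {1..n}" "j \<in> {1..n}" "k \<in> {1..n}" "l \<in> {1..n}"
  shows "E i j a \<otimes>\<^bsub>S\<^esub> E k l b = (if j = k then E i l (c i j l \<odot>\<^bsub>A\<^esub> (a \<otimes>\<^bsub>A\<^esub> b)) else \<zero>\<^bsub>S\<^esub>)"
  by (rule S_ext)
     (use assms in \<open>auto simp: E_mult_entry E_entry S_zero_entry
        intro!: S_mult_closed E_closed smult_closed, auto simp: S_zero S_carrier\<close>)

lemma E_add: "a \<in> carrier A \<Longrightarrow> b \<in> carrier A \<Longrightarrow> E i j (a \<oplus>\<^bsub>A\<^esub> b) = E i j a \<oplus>\<^bsub>S\<^esub> E i j b"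
  by (rule S_ext) (auto simp: E_entry S_add_entry intro!: S_add_closed)

lemma E_smult: "r \<in> carrier F \<Longrightarrow> a \<in> carrier A \<Longrightarrow> E i j (r \<odot>\<^bsub>A\<^esub> a) = r \<odot>\<^bsub>S\<^esub> E i j a"
  by (rule S_ext) (auto simp: E_entry S_smult_entry intro!: S_smult_closed)

lemma E_zero: "E i j \<zero>\<^bsub>A\<^esub> = \<zero>\<^bsub>S\<^esub>"
  by (auto simp: single_entry_def S_zero)

lemma E_eq_iff:
  "i \<in> {1..n} \<Longrightarrow> j \<in> {1..n} \<Longrightarrow> E i j a = E i j b \<longleftrightarrow> a = b"
  by (metis E_entry)

lemma S_module: "module F S"
proof (rule pointwise_module[OF module_axioms _ S_add S_zero S_smult S_add_closed _ S_smult_closed])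
  show "carrier S \<subseteq> {1..n} \<times> {1..n} \<rightarrow>\<^sub>E carrier A" by (simp add: S_carrier)
  show "\<zero>\<^bsub>S\<^esub> \<in> carrier S" by (auto simp: S_carrier S_zero)
qed

text \<open>The two normalisations of a reduced set make the identity matrix neutral:
  \<open>c i i l\<close> is the coefficient that occurs on the left, \<open>c i l l\<close> the one
  on the right. Bilinearity holds summand by summand because the coefficients are scalars from a
  commutative ring.\<close>

lemma S_algebra: "unital_algebra F S"
proof -
  interpret S: module F S by (rule S_module)
  have "ring A" ..
  note distr = ringE(3,4)[OF this]
  show ?thesis
  proof (intro unital_algebra.intro S_module unital_algebra_axioms.intro S_mult_closed S_one_closed)
    fix x assume x: "x \<in> carrier S"
    show "\<one>\<^bsub>S\<^esub> \<otimes>\<^bsub>S\<^esub> x = x"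
    proof (rule S_ext)
      fix i l assume il: "i \<in> {1..n}" "l \<in> {1..n}"
      have "(\<Oplus>\<^bsub>A\<^esub>j\<in>{1..n}. c i j l \<odot>\<^bsub>A\<^esub> (\<one>\<^bsub>S\<^esub> (i, j) \<otimes>\<^bsub>A\<^esub> x (j, l))) =
        c i i l \<odot>\<^bsub>A\<^esub> (\<one>\<^bsub>S\<^esub> (i, i) \<otimes>\<^bsub>A\<^esub> x (i, l))"
        by (rule M.finsum_single) (use x il in \<open>auto simp: S_one_entry\<close>)
      then show "(\<one>\<^bsub>S\<^esub> \<otimes>\<^bsub>S\<^esub> x) (i, l) = x (i, l)"
        using x il by (simp add: S_mult_entry S_one_entry)
    qed (use x in \<open>auto intro: S_mult_closed S_one_closed\<close>)
    show "x \<otimes>\<^bsub>S\<^esub> \<one>\<^bsub>S\<^esub> = x"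
    proof (rule S_ext)
      fix i l assume il: "i \<in> {1..n}" "l \<in> {1..n}"
      have "(\<Oplus>\<^bsub>A\<^esub>j\<in>{1..n}. c i j l \<odot>\<^bsub>A\<^esub> (x (i, j) \<otimes>\<^bsub>A\<^esub> \<one>\<^bsub>S\<^esub> (j, l))) =
        c i l l \<odot>\<^bsub>A\<^esub> (x (i, l) \<otimes>\<^bsub>A\<^esub> \<one>\<^bsub>S\<^esub> (l, l))"
        by (rule M.finsum_single) (use x il in \<open>auto simp: S_one_entry\<close>)
      then show "(x \<otimes>\<^bsub>S\<^esub> \<one>\<^bsub>S\<^esub>) (i, l) = x (i, l)"
        using x il by (simp add: S_mult_entry S_one_entry)
    qed (use x in \<open>auto intro: S_mult_closed S_one_closed\<close>)
  next
    fix x y z assume xyz: "x \<in> carrier S" "y \<in> carrier S" "z \<in> carrier S"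
    show "(x \<oplus>\<^bsub>S\<^esub> y) \<otimes>\<^bsub>S\<^esub> z = x \<otimes>\<^bsub>S\<^esub> z \<oplus>\<^bsub>S\<^esub> y \<otimes>\<^bsub>S\<^esub> z"
    proof (rule S_ext)
      fix i l assume il: "i \<in> {1..n}" "l \<in> {1..n}"
      have "(\<Oplus>\<^bsub>A\<^esub>j\<in>{1..n}. c i j l \<odot>\<^bsub>A\<^esub> ((x \<oplus>\<^bsub>S\<^esub> y) (i, j) \<otimes>\<^bsub>A\<^esub> z (j, l))) =
        (\<Oplus>\<^bsub>A\<^esub>j\<in>{1..n}. c i j l \<odot>\<^bsub>A\<^esub> (x (i, j) \<otimes>\<^bsub>A\<^esub> z (j, l)) \<oplus>\<^bsub>A\<^esub> c i j l \<odot>\<^bsub>A\<^esub> (y (i, j) \<otimes>\<^bsub>A\<^esub> z (j, l)))"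
        by (rule M.finsum_cong')
          (use xyz il S_val c_closed in \<open>auto simp: S_add_entry distr smult_r_distr simp del: atLeastAtMost_iff One_nat_def\<close>)
      also have "\<dots> = (x \<otimes>\<^bsub>S\<^esub> z) (i, l) \<oplus>\<^bsub>A\<^esub> (y \<otimes>\<^bsub>S\<^esub> z) (i, l)"
        using il xyz by (subst M.finsum_addf) (auto simp: S_mult_entry intro!: S_mult_term simp del: atLeastAtMost_iff One_nat_def)
      finally show "((x \<oplus>\<^bsub>S\<^esub> y) \<otimes>\<^bsub>S\<^esub> z) (i, l) = (x \<otimes>\<^bsub>S\<^esub> z \<oplus>\<^bsub>S\<^esub> y \<otimes>\<^bsub>S\<^esub> z) (i, l)"
        using il by (simp add: S_mult_entry S_add_entry)
    qed (use xyz in \<open>auto intro!: S_mult_closed S_add_closed\<close>)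
    show "z \<otimes>\<^bsub>S\<^esub> (x \<oplus>\<^bsub>S\<^esub> y) = z \<otimes>\<^bsub>S\<^esub> x \<oplus>\<^bsub>S\<^esub> z \<otimes>\<^bsub>S\<^esub> y"
    proof (rule S_ext)
      fix i l assume il: "i \<in> {1..n}" "l \<in> {1..n}"
      have "(\<Oplus>\<^bsub>A\<^esub>j\<in>{1..n}. c i j l \<odot>\<^bsub>A\<^esub> (z (i, j) \<otimes>\<^bsub>A\<^esub> (x \<oplus>\<^bsub>S\<^esub> y) (j, l))) =
        (\<Oplus>\<^bsub>A\<^esub>j\<in>{1..n}. c i j l \<odot>\<^bsub>A\<^esub> (z (i, j) \<otimes>\<^bsub>A\<^esub> x (j, l)) \<oplus>\<^bsub>A\<^esub> c i j l \<odot>\<^bsub>A\<^esub> (z (i, j) \<otimes>\<^bsub>A\<^esub> y (j, l)))"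
        by (rule M.finsum_cong')
          (use xyz il S_val c_closed in \<open>auto simp: S_add_entry distr smult_r_distr simp del: atLeastAtMost_iff One_nat_def\<close>)
      also have "\<dots> = (z \<otimes>\<^bsub>S\<^esub> x) (i, l) \<oplus>\<^bsub>A\<^esub> (z \<otimes>\<^bsub>S\<^esub> y) (i, l)"
        using il xyz by (subst M.finsum_addf) (auto simp: S_mult_entry intro!: S_mult_term simp del: atLeastAtMost_iff One_nat_def)
      finally show "(z \<otimes>\<^bsub>S\<^esub> (x \<oplus>\<^bsub>S\<^esub> y)) (i, l) = (z \<otimes>\<^bsub>S\<^esub> x \<oplus>\<^bsub>S\<^esub> z \<otimes>\<^bsub>S\<^esub> y) (i, l)"
        using il by (simp add: S_mult_entry S_add_entry)
    qed (use xyz in \<open>auto intro!: S_mult_closed S_add_closed\<close>)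
  next
    fix r x y assume *: "r \<in> carrier F" "x \<in> carrier S" "y \<in> carrier S"
    have swap: "s \<odot>\<^bsub>A\<^esub> (r \<odot>\<^bsub>A\<^esub> a) = r \<odot>\<^bsub>A\<^esub> (s \<odot>\<^bsub>A\<^esub> a)" if "s \<in> carrier F" "a \<in> carrier A" for s a
      using that * by (metis R.m_comm smult_assoc1)
    have sum: "r \<odot>\<^bsub>A\<^esub> (x \<otimes>\<^bsub>S\<^esub> y) (i, l) =
        (\<Oplus>\<^bsub>A\<^esub>j\<in>{1..n}. r \<odot>\<^bsub>A\<^esub> (c i j l \<odot>\<^bsub>A\<^esub> (x (i, j) \<otimes>\<^bsub>A\<^esub> y (j, l))))"
      if "i \<in> {1..n}" "l \<in> {1..n}" for i l
      using that * by (subst finsum_smult_ldistr[symmetric]) (auto simp: S_mult_entry intro!: S_mult_term simp del: atLeastAtMost_iff One_nat_def)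
    show "(r \<odot>\<^bsub>S\<^esub> x) \<otimes>\<^bsub>S\<^esub> y = r \<odot>\<^bsub>S\<^esub> (x \<otimes>\<^bsub>S\<^esub> y)"
    proof (rule S_ext)
      fix i l assume il: "i \<in> {1..n}" "l \<in> {1..n}"
      show "((r \<odot>\<^bsub>S\<^esub> x) \<otimes>\<^bsub>S\<^esub> y) (i, l) = (r \<odot>\<^bsub>S\<^esub> (x \<otimes>\<^bsub>S\<^esub> y)) (i, l)"
        unfolding S_smult_entry[OF il] sum[OF il] unfolding S_mult_entry[OF il]
        by (rule M.finsum_cong')
          (use * il S_val c_closed in \<open>auto simp: S_smult_entry smult_mult_left swap simp del: atLeastAtMost_iff One_nat_def\<close>)
    qed (use * in \<open>auto intro!: S_mult_closed S_smult_closed\<close>)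
    show "x \<otimes>\<^bsub>S\<^esub> (r \<odot>\<^bsub>S\<^esub> y) = r \<odot>\<^bsub>S\<^esub> (x \<otimes>\<^bsub>S\<^esub> y)"
    proof (rule S_ext)
      fix i l assume il: "i \<in> {1..n}" "l \<in> {1..n}"
      show "(x \<otimes>\<^bsub>S\<^esub> (r \<odot>\<^bsub>S\<^esub> y)) (i, l) = (r \<odot>\<^bsub>S\<^esub> (x \<otimes>\<^bsub>S\<^esub> y)) (i, l)"
        unfolding S_smult_entry[OF il] sum[OF il] unfolding S_mult_entry[OF il]
        by (rule M.finsum_cong')
          (use * il S_val c_closed in \<open>auto simp: S_smult_entry smult_mult_right swap simp del: atLeastAtMost_iff One_nat_def\<close>)
    qed (use * in \<open>auto intro!: S_mult_closed S_smult_closed\<close>)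
  qed
qed

text \<open>Reducedness makes the coefficients \<open>c i i l\<close> and \<open>c k i i\<close>
  equal to one, so multiplication by a e_ii merely isolates row i or column i and multiplies it by
  a. The remaining coefficients are scalars, which move past a, and associativity of
  \<open>A\<close> does the rest. In the middle position both bracketings keep only the summand with
  index i.\<close>

lemma E_nucleus:
  assumes i: "i \<in> {1..n}" and a: "a \<in> carrier A"
  shows "E i i a \<in> nucleus S"
proof -
  interpret S: unital_algebra F S by (rule S_algebra)
  have "semiring A" ..
  note ldistr = semiring.finsum_ldistr[OF this] and rdistr = semiring.finsum_rdistr[OF this]
  note [simp del] = atLeastAtMost_iff One_nat_def
  have "(E i i a \<otimes>\<^bsub>S\<^esub> y) \<otimes>\<^bsub>S\<^esub> z = E i i a \<otimes>\<^bsub>S\<^esub> (y \<otimes>\<^bsub>S\<^esub> z)"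
    "(y \<otimes>\<^bsub>S\<^esub> E i i a) \<otimes>\<^bsub>S\<^esub> z = y \<otimes>\<^bsub>S\<^esub> (E i i a \<otimes>\<^bsub>S\<^esub> z)"
    "(y \<otimes>\<^bsub>S\<^esub> z) \<otimes>\<^bsub>S\<^esub> E i i a = y \<otimes>\<^bsub>S\<^esub> (z \<otimes>\<^bsub>S\<^esub> E i i a)"
    if y: "y \<in> carrier S" and z: "z \<in> carrier S" for y z
  proof -
    show "(E i i a \<otimes>\<^bsub>S\<^esub> y) \<otimes>\<^bsub>S\<^esub> z = E i i a \<otimes>\<^bsub>S\<^esub> (y \<otimes>\<^bsub>S\<^esub> z)"
    proof (rule S_ext)
      fix k l assume kl: "k \<in> {1..n}" "l \<in> {1..n}"
      have "(\<Oplus>\<^bsub>A\<^esub>d\<in>{1..n}. c k d l \<odot>\<^bsub>A\<^esub> ((E i i a \<otimes>\<^bsub>S\<^esub> y) (k, d) \<otimes>\<^bsub>A\<^esub> z (d, l))) =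
        (\<Oplus>\<^bsub>A\<^esub>d\<in>{1..n}. if k = i then a \<otimes>\<^bsub>A\<^esub> (c k d l \<odot>\<^bsub>A\<^esub> (y (k, d) \<otimes>\<^bsub>A\<^esub> z (d, l))) else \<zero>\<^bsub>A\<^esub>)"
        by (rule M.finsum_cong')
          (use y z kl i a in \<open>auto simp: E_mult_entry smult_mult_right m_assoc\<close>)
      also have "\<dots> = (if k = i then a \<otimes>\<^bsub>A\<^esub> (y \<otimes>\<^bsub>S\<^esub> z) (k, l) else \<zero>\<^bsub>A\<^esub>)"
        using y z kl i a by (auto simp: rdistr S_mult_entry S_mult_term)
      also have "\<dots> = (E i i a \<otimes>\<^bsub>S\<^esub> (y \<otimes>\<^bsub>S\<^esub> z)) (k, l)"
        using y z kl i a by (auto simp: E_mult_entry)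
      finally show "((E i i a \<otimes>\<^bsub>S\<^esub> y) \<otimes>\<^bsub>S\<^esub> z) (k, l) = (E i i a \<otimes>\<^bsub>S\<^esub> (y \<otimes>\<^bsub>S\<^esub> z)) (k, l)"
        using kl by (simp only: S_mult_entry)
    qed (use y z a in auto)
    show "(y \<otimes>\<^bsub>S\<^esub> z) \<otimes>\<^bsub>S\<^esub> E i i a = y \<otimes>\<^bsub>S\<^esub> (z \<otimes>\<^bsub>S\<^esub> E i i a)"
    proof (rule S_ext)
      fix k l assume kl: "k \<in> {1..n}" "l \<in> {1..n}"
      have "(\<Oplus>\<^bsub>A\<^esub>d\<in>{1..n}. c k d l \<odot>\<^bsub>A\<^esub> (y (k, d) \<otimes>\<^bsub>A\<^esub> (z \<otimes>\<^bsub>S\<^esub> E i i a) (d, l))) =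
        (\<Oplus>\<^bsub>A\<^esub>d\<in>{1..n}. if l = i then (c k d l \<odot>\<^bsub>A\<^esub> (y (k, d) \<otimes>\<^bsub>A\<^esub> z (d, l))) \<otimes>\<^bsub>A\<^esub> a else \<zero>\<^bsub>A\<^esub>)"
        by (rule M.finsum_cong')
          (use y z kl i a in \<open>auto simp: mult_E_entry smult_mult_left m_assoc\<close>)
      also have "\<dots> = (if l = i then (y \<otimes>\<^bsub>S\<^esub> z) (k, l) \<otimes>\<^bsub>A\<^esub> a else \<zero>\<^bsub>A\<^esub>)"
        using y z kl i a by (auto simp: ldistr S_mult_entry S_mult_term)
      also have "\<dots> = ((y \<otimes>\<^bsub>S\<^esub> z) \<otimes>\<^bsub>S\<^esub> E i i a) (k, l)"
        using y z kl i a by (auto simp: mult_E_entry)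
      finally show "((y \<otimes>\<^bsub>S\<^esub> z) \<otimes>\<^bsub>S\<^esub> E i i a) (k, l) = (y \<otimes>\<^bsub>S\<^esub> (z \<otimes>\<^bsub>S\<^esub> E i i a)) (k, l)"
        using kl by (simp only: S_mult_entry)
    qed (use y z a in auto)
    show "(y \<otimes>\<^bsub>S\<^esub> E i i a) \<otimes>\<^bsub>S\<^esub> z = y \<otimes>\<^bsub>S\<^esub> (E i i a \<otimes>\<^bsub>S\<^esub> z)"
    proof (rule S_ext)
      fix k l assume kl: "k \<in> {1..n}" "l \<in> {1..n}"
      show "((y \<otimes>\<^bsub>S\<^esub> E i i a) \<otimes>\<^bsub>S\<^esub> z) (k, l) = (y \<otimes>\<^bsub>S\<^esub> (E i i a \<otimes>\<^bsub>S\<^esub> z)) (k, l)"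
        unfolding S_mult_entry[OF kl]
        by (rule M.finsum_cong')
          (use y z kl i a in \<open>auto simp: mult_E_entry E_mult_entry m_assoc\<close>)
    qed (use y z a in auto)
  qed
  then show ?thesis
    using a by (simp add: nucleus_def E_closed)
qed

end

section \<open>Simple corners and their radicals\<close>

text \<open>Negatives are products with \<open>\<ominus> \<one>\<close>, so closure under sums and
  under multiplication by ring elements gives an additive subgroup.\<close>

lemma (in ring) two_sided_idealI:
  assumes sub: "I \<subseteq> carrier R" and ne: "\<zero> \<in> I"
    and add: "\<And>x y. x \<in> I \<Longrightarrow> y \<in> I \<Longrightarrow> x \<oplus> y \<in> I"
    and left: "\<And>x y. x \<in> I \<Longrightarrow> y \<in> carrier R \<Longrightarrow> y \<otimes> x \<in> I"
    and right: "\<And>x y. x \<in> I \<Longrightarrow> y \<in> carrier R \<Longrightarrow> x \<otimes> y \<in> I"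
  shows "ideal I R"
proof (rule idealI)
  show "subgroup I (add_monoid R)"
  proof (rule add.subgroupI)
    fix x assume x: "x \<in> I"
    then have "\<ominus> \<one> \<otimes> x \<in> I" by (rule left) simp
    then show "\<ominus> x \<in> I" using x sub by (simp add: l_minus subsetD)
  qed (use assms in auto)
qed (use assms ring_axioms in auto)

lemma (in ideal) ideal_finsum:
  assumes "finite J" "f \<in> J \<rightarrow> I"
  shows "(\<Oplus>j\<in>J. f j) \<in> I"
  using assms
proof (induction J)
  case (insert j J)
  then have "f j \<in> I" "f \<in> J \<rightarrow> I" "f \<in> J \<rightarrow> carrier R" using a_subset by auto
  then show ?case using insert a_subset by auto
qed auto

text \<open>The ideal generated by x consists of sums of products y x z, so the condition says that
  compression by e annihilates this ideal. Only products and zero occur in it, hence ring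
  isomorphisms transport it.\<close>

definition corner_radical :: "('a, 'm) ring_scheme \<Rightarrow> 'a \<Rightarrow> 'a set" where
  "corner_radical R e = {x \<in> carrier R.
     \<forall>y\<in>carrier R. \<forall>z\<in>carrier R. e \<otimes>\<^bsub>R\<^esub> (y \<otimes>\<^bsub>R\<^esub> x \<otimes>\<^bsub>R\<^esub> z) \<otimes>\<^bsub>R\<^esub> e = \<zero>\<^bsub>R\<^esub>}"

lemma (in ring) corner_radical_ideal:
  assumes e: "e \<in> carrier R"
  shows "ideal (corner_radical R e) R"
proof (rule two_sided_idealI)
  fix x y assume x: "x \<in> corner_radical R e" and y: "y \<in> carrier R"
  have x': "x \<in> carrier R" using x by (simp add: corner_radical_def)
  have xD: "e \<otimes> (z \<otimes> x \<otimes> w) \<otimes> e = \<zero>" if "z \<in> carrier R" "w \<in> carrier R" for z w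
    using x that by (simp add: corner_radical_def)
  have "e \<otimes> (z \<otimes> (y \<otimes> x) \<otimes> w) \<otimes> e = \<zero>" if "z \<in> carrier R" "w \<in> carrier R" for z w
    using xD[of "z \<otimes> y" w] that y x' by (simp add: m_assoc)
  then show "y \<otimes> x \<in> corner_radical R e" using x' y by (simp add: corner_radical_def)
  have "e \<otimes> (z \<otimes> (x \<otimes> y) \<otimes> w) \<otimes> e = \<zero>" if "z \<in> carrier R" "w \<in> carrier R" for z w
    using xD[of z "y \<otimes> w"] that y x' by (simp add: m_assoc)
  then show "x \<otimes> y \<in> corner_radical R e" using x' y by (simp add: corner_radical_def)
qed (use e in \<open>auto simp: corner_radical_def l_distr r_distr\<close>)

text \<open>The map \<open>\<iota>\<close> identifies \<open>A\<close> with the corner eRe, where e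
  is the image of one: \<open>emb_corner\<close> gives one inclusion, and \<open>idem_emb\<close>
  the other. Keeping \<open>A\<close> apart from \<open>R\<close> lets corners that come from
  different algebras be compared inside a single ring.\<close>

locale simple_corner = R: ring R + A: ring A for R (structure) and A +
  fixes \<iota>
  assumes closed [simp, intro]: "a \<in> carrier A \<Longrightarrow> \<iota> a \<in> carrier R"
    and emb_add: "a \<in> carrier A \<Longrightarrow> b \<in> carrier A \<Longrightarrow> \<iota> (a \<oplus>\<^bsub>A\<^esub> b) = \<iota> a \<oplus> \<iota> b"
    and emb_mult: "a \<in> carrier A \<Longrightarrow> b \<in> carrier A \<Longrightarrow> \<iota> (a \<otimes>\<^bsub>A\<^esub> b) = \<iota> a \<otimes> \<iota> b"
    and emb_inj: "inj_on \<iota> (carrier A)"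
    and emb_corner: "x \<in> carrier R \<Longrightarrow> \<iota> \<one>\<^bsub>A\<^esub> \<otimes> x \<otimes> \<iota> \<one>\<^bsub>A\<^esub> \<in> \<iota> ` carrier A"
    and simple: "ideal I A \<Longrightarrow> I = {\<zero>\<^bsub>A\<^esub>} \<or> I = carrier A"
    and nontrivial: "\<one>\<^bsub>A\<^esub> \<noteq> \<zero>\<^bsub>A\<^esub>"
begin

abbreviation idem where "idem \<equiv> \<iota> \<one>\<^bsub>A\<^esub>"

lemma emb_zero: "\<iota> \<zero>\<^bsub>A\<^esub> = \<zero>"
  using emb_add[of "\<zero>\<^bsub>A\<^esub>" "\<zero>\<^bsub>A\<^esub>"] by simp

lemma emb_eq_iff: "a \<in> carrier A \<Longrightarrow> b \<in> carrier A \<Longrightarrow> \<iota> a = \<iota> b \<longleftrightarrow> a = b"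
  using emb_inj by (auto dest: inj_onD)

lemma emb_eq_zero_iff: "a \<in> carrier A \<Longrightarrow> \<iota> a = \<zero> \<longleftrightarrow> a = \<zero>\<^bsub>A\<^esub>"
  using emb_eq_iff[of a "\<zero>\<^bsub>A\<^esub>"] by (simp add: emb_zero)

lemma idem_emb: "a \<in> carrier A \<Longrightarrow> idem \<otimes> \<iota> a = \<iota> a" "a \<in> carrier A \<Longrightarrow> \<iota> a \<otimes> idem = \<iota> a"
  by (simp_all flip: emb_mult)

lemma idem_idem: "idem \<otimes> idem = idem"
  by (simp add: idem_emb)

lemma idem_nonzero: "idem \<noteq> \<zero>"
  using nontrivial by (simp add: emb_eq_zero_iff)

lemma emb_finsum:
  assumes "finite J" "f \<in> J \<rightarrow> carrier A"
  shows "\<iota> (\<Oplus>\<^bsub>A\<^esub>j\<in>J. f j) = (\<Oplus>j\<in>J. \<iota> (f j))"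
  using assms
proof (induction J)
  case empty
  then show ?case by (simp add: emb_zero)
next
  case (insert j J)
  then have "f j \<in> carrier A" "f \<in> J \<rightarrow> carrier A" by auto
  moreover from this have "(\<lambda>j. \<iota> (f j)) \<in> J \<rightarrow> carrier R" by auto
  ultimately show ?case using insert by (simp add: emb_add)
qed

text \<open>The elements x with x A a = 0 form a two-sided ideal. If a A a were zero, this ideal
  would contain the nonzero element a, hence one by simplicity, and that forces a = 0.\<close>

lemma A_semiprime:
  assumes a: "a \<in> carrier A" "a \<noteq> \<zero>\<^bsub>A\<^esub>"
  obtains s where "s \<in> carrier A" "a \<otimes>\<^bsub>A\<^esub> s \<otimes>\<^bsub>A\<^esub> a \<noteq> \<zero>\<^bsub>A\<^esub>"
proof (rule ccontr)
  assume "\<not> thesis"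
  with that have zero: "a \<otimes>\<^bsub>A\<^esub> s \<otimes>\<^bsub>A\<^esub> a = \<zero>\<^bsub>A\<^esub>" if "s \<in> carrier A" for s
    using that by blast
  define I where "I = {x \<in> carrier A. \<forall>s\<in>carrier A. x \<otimes>\<^bsub>A\<^esub> s \<otimes>\<^bsub>A\<^esub> a = \<zero>\<^bsub>A\<^esub>}"
  have "ideal I A"
  proof (rule A.two_sided_idealI)
    fix x y assume xI: "x \<in> I" and y: "y \<in> carrier A"
    have x: "x \<in> carrier A" using xI by (simp add: I_def)
    have xs: "x \<otimes>\<^bsub>A\<^esub> s \<otimes>\<^bsub>A\<^esub> a = \<zero>\<^bsub>A\<^esub>" if "s \<in> carrier A" for s
      using that xI by (simp add: I_def)
    have "x \<otimes>\<^bsub>A\<^esub> y \<otimes>\<^bsub>A\<^esub> s \<otimes>\<^bsub>A\<^esub> a = \<zero>\<^bsub>A\<^esub>" if "s \<in> carrier A" for s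
      using xs[of "y \<otimes>\<^bsub>A\<^esub> s"] x y that by (simp add: A.m_assoc)
    then show "x \<otimes>\<^bsub>A\<^esub> y \<in> I" using x y by (simp add: I_def)
    have "y \<otimes>\<^bsub>A\<^esub> x \<otimes>\<^bsub>A\<^esub> s \<otimes>\<^bsub>A\<^esub> a = \<zero>\<^bsub>A\<^esub>" if "s \<in> carrier A" for s
      using xs[of s] x y that a(1) by (simp add: A.m_assoc)
    then show "y \<otimes>\<^bsub>A\<^esub> x \<in> I" using x y by (simp add: I_def)
  qed (use a in \<open>auto simp: I_def A.l_distr\<close>)
  moreover have "a \<in> I" using a zero by (simp add: I_def)
  ultimately have "\<one>\<^bsub>A\<^esub> \<in> I" using simple a(2) by blast
  then have "\<one>\<^bsub>A\<^esub> \<otimes>\<^bsub>A\<^esub> \<one>\<^bsub>A\<^esub> \<otimes>\<^bsub>A\<^esub> a = \<zero>\<^bsub>A\<^esub>" unfolding I_def by blast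
  then show False using a by simp
qed

lemma radical_ideal: "ideal (corner_radical R idem) R"
  by (simp add: R.corner_radical_ideal)

lemma one_notin_radical: "\<one> \<notin> corner_radical R idem"
proof
  assume "\<one> \<in> corner_radical R idem"
  then have "idem \<otimes> (\<one> \<otimes> \<one> \<otimes> \<one>) \<otimes> idem = \<zero>" unfolding corner_radical_def by blast
  then show False using idem_nonzero by (simp add: idem_idem)
qed

text \<open>Simplicity is applied to the preimage of \<open>K\<close> in \<open>A\<close>: it is an
  ideal without one, hence zero, so \<open>K\<close> meets the corner only in zero. Compressing y x
  z with x in \<open>K\<close> gives an element of both.\<close>

lemma ideal_subset_radical:
  assumes K: "ideal K R" and idem: "idem \<notin> K"
  shows "K \<subseteq> corner_radical R idem"
proof
  interpret K: ideal K R by fact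
  fix x assume x: "x \<in> K"
  then have [simp]: "x \<in> carrier R" using K.a_subset by auto
  have "ideal {a \<in> carrier A. \<iota> a \<in> K} A"
    by (rule A.two_sided_idealI) (auto simp: emb_zero emb_add emb_mult K.I_l_closed K.I_r_closed)
  with simple idem have trivial: "{a \<in> carrier A. \<iota> a \<in> K} = {\<zero>\<^bsub>A\<^esub>}"
    by (metis (no_types, lifting) A.one_closed mem_Collect_eq)
  have "idem \<otimes> (y \<otimes> x \<otimes> z) \<otimes> idem = \<zero>" if [simp]: "y \<in> carrier R" "z \<in> carrier R" for y z
  proof -
    have "idem \<otimes> (y \<otimes> x \<otimes> z) \<otimes> idem \<in> K"
      using x by (intro K.I_l_closed K.I_r_closed) auto
    moreover obtain a where a: "a \<in> carrier A" "idem \<otimes> (y \<otimes> x \<otimes> z) \<otimes> idem = \<iota> a"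
      using emb_corner[of "y \<otimes> x \<otimes> z"] by auto
    ultimately have "a = \<zero>\<^bsub>A\<^esub>" using trivial by auto
    then show ?thesis using a by (simp add: emb_zero)
  qed
  then show "x \<in> corner_radical R idem" by (simp add: corner_radical_def)
qed

text \<open>This makes the relation of lying outside a radical symmetric. There is a nonzero corner
  element a = e y f z e, and semiprimeness gives s with a s a nonzero. Between the two occurrences
  of f in a s a stands an e, so e cannot lie in the radical of f.\<close>

lemma radical_link:
  assumes f: "f \<in> carrier R" "f \<otimes> f = f" "f \<notin> corner_radical R idem"
  shows "idem \<notin> corner_radical R f"
proof
  assume e: "idem \<in> corner_radical R f"
  from f obtain y z where yz [simp]: "y \<in> carrier R" "z \<in> carrier R"
    and ne: "idem \<otimes> (y \<otimes> f \<otimes> z) \<otimes> idem \<noteq> \<zero>"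
    by (auto simp: corner_radical_def)
  obtain a where a [simp]: "a \<in> carrier A" and eq: "idem \<otimes> (y \<otimes> f \<otimes> z) \<otimes> idem = \<iota> a"
    using emb_corner[of "y \<otimes> f \<otimes> z"] f(1) by auto
  obtain s where s [simp]: "s \<in> carrier A" and sa: "a \<otimes>\<^bsub>A\<^esub> s \<otimes>\<^bsub>A\<^esub> a \<noteq> \<zero>\<^bsub>A\<^esub>"
    using A_semiprime[of a] ne a by (metis emb_zero eq)
  note [simp] = f(1)
  \<comment> \<open>The factors around \<open>idem\<close> are the stretch of a s a between its two
    occurrences of f: z on the left, s e y on the right.\<close>
  have "f \<otimes> (z \<otimes> idem \<otimes> (\<iota> s \<otimes> idem \<otimes> y)) \<otimes> f = \<zero>"
    using e by (auto simp: corner_radical_def)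
  then have "idem \<otimes> y \<otimes> (f \<otimes> (z \<otimes> idem \<otimes> (\<iota> s \<otimes> idem \<otimes> y)) \<otimes> f) \<otimes> z \<otimes> idem = \<zero>"
    by simp
  moreover have "\<iota> (a \<otimes>\<^bsub>A\<^esub> s \<otimes>\<^bsub>A\<^esub> a) =
      idem \<otimes> y \<otimes> (f \<otimes> (z \<otimes> idem \<otimes> (\<iota> s \<otimes> idem \<otimes> y)) \<otimes> f) \<otimes> z \<otimes> idem"
    by (simp add: emb_mult flip: eq) (simp add: R.m_assoc)
  ultimately show False
    using sa by (simp add: emb_eq_zero_iff)
qed

end

text \<open>The radical of a simple corner is the largest ideal that avoids its idempotent, so two
  simple corners have the same radical as soon as one idempotent lies outside the other radical.\<close>

lemma corner_radical_eq:
  assumes "simple_corner R A \<iota>" "simple_corner R B \<kappa>"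
    and link: "\<kappa> \<one>\<^bsub>B\<^esub> \<notin> corner_radical R (\<iota> \<one>\<^bsub>A\<^esub>)"
  shows "corner_radical R (\<iota> \<one>\<^bsub>A\<^esub>) = corner_radical R (\<kappa> \<one>\<^bsub>B\<^esub>)"
proof -
  interpret A: simple_corner R A \<iota> by fact
  interpret B: simple_corner R B \<kappa> by fact
  show ?thesis
  proof
    show "corner_radical R (\<iota> \<one>\<^bsub>A\<^esub>) \<subseteq> corner_radical R (\<kappa> \<one>\<^bsub>B\<^esub>)"
      by (rule B.ideal_subset_radical[OF A.radical_ideal link])
    have "\<iota> \<one>\<^bsub>A\<^esub> \<notin> corner_radical R (\<kappa> \<one>\<^bsub>B\<^esub>)"
      by (rule A.radical_link) (use link in \<open>auto simp: B.idem_idem\<close>)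
    then show "corner_radical R (\<kappa> \<one>\<^bsub>B\<^esub>) \<subseteq> corner_radical R (\<iota> \<one>\<^bsub>A\<^esub>)"
      by (rule A.ideal_subset_radical[OF B.radical_ideal])
  qed
qed

section \<open>Quotients by the radical of a corner as matrix algebras\<close>

definition algebra_epi ::
  "('f, 'k) ring_scheme \<Rightarrow> ('f, 'a, 'm) module_scheme \<Rightarrow> ('f, 'b, 'n) module_scheme \<Rightarrow> ('a \<Rightarrow> 'b) \<Rightarrow> bool" where
  "algebra_epi F R Q \<pi> \<longleftrightarrow> \<pi> \<in> ring_hom R Q \<and> \<pi> ` carrier R = carrier Q \<and>
    (\<forall>r\<in>carrier F. \<forall>x\<in>carrier R. \<pi> (r \<odot>\<^bsub>R\<^esub> x) = r \<odot>\<^bsub>Q\<^esub> \<pi> x)"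

text \<open>A first isomorphism theorem without a quotient ring: equality of kernels is expressed by
  equality of fibres, so \<open>\<rho>\<close> takes the same value on every preimage of a point
  under \<open>\<pi>\<close>. The operations of \<open>P\<close> and \<open>Q\<close> are computed
  on preimages in \<open>R\<close>.\<close>

lemma algebra_epi_same_kernel:
  assumes \<pi>: "algebra_epi F R P \<pi>" and \<rho>: "algebra_epi F R Q \<rho>"
    and R: "assoc_algebra F R"
    and ker: "\<And>x y. x \<in> carrier R \<Longrightarrow> y \<in> carrier R \<Longrightarrow> \<pi> x = \<pi> y \<longleftrightarrow> \<rho> x = \<rho> y"
  shows "algebra_isomorphic F P Q"
proof -
  interpret R: assoc_algebra F R by fact
  define g where "g = inv_into (carrier R) \<pi>"
  have g: "g p \<in> carrier R" "\<pi> (g p) = p" if "p \<in> carrier P" for p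
    using that \<pi> unfolding g_def algebra_epi_def by (auto intro: inv_into_into f_inv_into_f)
  define h where "h = \<rho> \<circ> g"
  have h: "h (\<pi> x) = \<rho> x" if "x \<in> carrier R" for x
  proof -
    have "\<pi> x \<in> carrier P" using that \<pi> by (auto simp: algebra_epi_def)
    then show ?thesis using ker[of "g (\<pi> x)" x] g[of "\<pi> x"] that by (simp add: h_def)
  qed
  have P: "carrier P = \<pi> ` carrier R" and Q: "carrier Q = \<rho> ` carrier R"
    using \<pi> \<rho> by (auto simp: algebra_epi_def)
  note hom = \<pi>[unfolded algebra_epi_def ring_hom_def] \<rho>[unfolded algebra_epi_def ring_hom_def]
  have "h \<in> ring_iso P Q"
  proof (rule ring_iso_memI)
    fix x y assume "x \<in> carrier P" "y \<in> carrier P"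
    then obtain a b where [simp]: "a \<in> carrier R" "b \<in> carrier R" and xy: "x = \<pi> a" "y = \<pi> b"
      unfolding P by auto
    have "x \<otimes>\<^bsub>P\<^esub> y = \<pi> (a \<otimes>\<^bsub>R\<^esub> b)" "x \<oplus>\<^bsub>P\<^esub> y = \<pi> (a \<oplus>\<^bsub>R\<^esub> b)"
      "\<rho> a \<otimes>\<^bsub>Q\<^esub> \<rho> b = \<rho> (a \<otimes>\<^bsub>R\<^esub> b)" "\<rho> a \<oplus>\<^bsub>Q\<^esub> \<rho> b = \<rho> (a \<oplus>\<^bsub>R\<^esub> b)"
      using hom by (simp_all add: xy)
    then show "h (x \<otimes>\<^bsub>P\<^esub> y) = h x \<otimes>\<^bsub>Q\<^esub> h y" "h (x \<oplus>\<^bsub>P\<^esub> y) = h x \<oplus>\<^bsub>Q\<^esub> h y"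
      by (simp_all add: xy h)
  next
    have "\<one>\<^bsub>P\<^esub> = \<pi> \<one>\<^bsub>R\<^esub>" "\<one>\<^bsub>Q\<^esub> = \<rho> \<one>\<^bsub>R\<^esub>" using hom by auto
    then show "h \<one>\<^bsub>P\<^esub> = \<one>\<^bsub>Q\<^esub>" by (simp add: h)
  next
    show "bij_betw h (carrier P) (carrier Q)"
      unfolding bij_betw_def inj_on_def P Q by (auto simp: h ker image_iff)
  qed (auto simp: h P Q)
  moreover have "h (r \<odot>\<^bsub>P\<^esub> p) = r \<odot>\<^bsub>Q\<^esub> h p" if r: "r \<in> carrier F" and p: "p \<in> carrier P" for r p
  proof -
    obtain a where [simp]: "a \<in> carrier R" and pa: "p = \<pi> a" using p P by auto
    have "r \<odot>\<^bsub>P\<^esub> p = \<pi> (r \<odot>\<^bsub>R\<^esub> a)" "r \<odot>\<^bsub>Q\<^esub> \<rho> a = \<rho> (r \<odot>\<^bsub>R\<^esub> a)"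
      using hom r by (simp_all add: pa)
    then show ?thesis using r by (simp add: h pa)
  qed
  ultimately show ?thesis unfolding algebra_isomorphic_def by blast
qed

lemma (in abelian_group) minus_eq_zero_iff:
  assumes "x \<in> carrier G" "y \<in> carrier G"
  shows "x \<ominus> y = \<zero> \<longleftrightarrow> x = y"
  using assms by (metis a_minus_def a_inv_closed minus_equality minus_minus r_neg)

lemma unit_skew_set:
  assumes "cring F"
  shows "reduced_skew_set F n (\<lambda>_ _ _. \<one>\<^bsub>F\<^esub>)"
proof -
  interpret cring F by fact
  show ?thesis by (auto simp: reduced_skew_set_def)
qed

text \<open>Write e for \<open>idem\<close>. The map sends x to the matrix of the elements v_i x
  u_j, which lie in eRe and are therefore elements of \<open>A\<close>. Indices whose e_i is radical
  drop out because e x e_i y e = 0; inserting the remaining e_k = u_k v_k between two factors is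
  matrix multiplication. The hypothesis \<open>link\<close> isolates the input that depends on the
  coefficients of the twisted algebra.\<close>

lemma corner_matrix_quotient:
  fixes F :: "('f, 'k) ring_scheme" and R :: "('f, 'r, 'l) module_scheme"
    and A :: "('f, 'a, 'm) module_scheme"
  assumes R_alg: "assoc_algebra F R" and A_alg: "assoc_algebra F A" and corner: "simple_corner R A \<iota>"
    and emb_smult: "\<And>r a. r \<in> carrier F \<Longrightarrow> a \<in> carrier A \<Longrightarrow> \<iota> (r \<odot>\<^bsub>A\<^esub> a) = r \<odot>\<^bsub>R\<^esub> \<iota> a"
    and I: "finite I" and e_closed: "e \<in> I \<rightarrow> carrier R" and e_sum: "(\<Oplus>\<^bsub>R\<^esub>i\<in>I. e i) = \<one>\<^bsub>R\<^esub>"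
    and e_idem: "\<And>i. i \<in> I \<Longrightarrow> e i \<otimes>\<^bsub>R\<^esub> e i = e i"
    and e_orth: "\<And>i j. i \<in> I \<Longrightarrow> j \<in> I \<Longrightarrow> i \<noteq> j \<Longrightarrow> e i \<otimes>\<^bsub>R\<^esub> e j = \<zero>\<^bsub>R\<^esub>"
    and link: "\<And>i. i \<in> I \<Longrightarrow> e i \<notin> corner_radical R (\<iota> \<one>\<^bsub>A\<^esub>) \<Longrightarrow>
      \<exists>u\<in>carrier R. \<exists>v\<in>carrier R. v \<otimes>\<^bsub>R\<^esub> u = \<iota> \<one>\<^bsub>A\<^esub> \<and> u \<otimes>\<^bsub>R\<^esub> v = e i"
  shows "\<exists>m\<ge>1. \<exists>\<pi>. algebra_epi F R (skew_matrices A m (\<lambda>_ _ _. \<one>\<^bsub>F\<^esub>)) \<pi> \<and>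
    (\<forall>x\<in>carrier R. \<forall>y\<in>carrier R. \<pi> x = \<pi> y \<longleftrightarrow> x \<ominus>\<^bsub>R\<^esub> y \<in> corner_radical R (\<iota> \<one>\<^bsub>A\<^esub>))"
proof -
  interpret simple_corner R A \<iota> by fact
  interpret RA: assoc_algebra F R by fact
  interpret AA: assoc_algebra F A by fact
  interpret rad: ideal "corner_radical R idem" R by (rule radical_ideal)
  note [simp del] = One_nat_def atLeastAtMost_iff
  have e [simp]: "e i \<in> carrier R" if "i \<in> I" for i using that e_closed by auto
  define C where "C = {i \<in> I. e i \<notin> corner_radical R idem}"
  have C: "finite C" "C \<subseteq> I" using I by (auto simp: C_def)
  \<comment> \<open>A radical that contains all the e_i would contain their sum, which is one. This
    makes the matrix size positive.\<close>
  have "C \<noteq> {}"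
  proof
    assume "C = {}"
    then have "(\<Oplus>\<^bsub>R\<^esub>i\<in>I. e i) \<in> corner_radical R idem"
      using I by (intro rad.ideal_finsum) (auto simp: C_def)
    then show False using one_notin_radical e_sum by simp
  qed
  \<comment> \<open>Besides the two products, u is to lie in e_i R e and v in e R e_i. Then v_i x
    u_j falls into the corner, and v_i u_j vanishes for distinct indices by orthogonality of the
    e_i.\<close>
  define linked where "linked i u v \<longleftrightarrow> u \<in> carrier R \<and> v \<in> carrier R \<and>
      v \<otimes>\<^bsub>R\<^esub> u = idem \<and> u \<otimes>\<^bsub>R\<^esub> v = e i \<and>
      idem \<otimes>\<^bsub>R\<^esub> v = v \<and> v \<otimes>\<^bsub>R\<^esub> e i = v \<and> u \<otimes>\<^bsub>R\<^esub> idem = u \<and> e i \<otimes>\<^bsub>R\<^esub> u = u" for i u v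
  have "\<exists>u v. linked i u v"
    if i: "i \<in> C" for i
  proof -
    have iI: "i \<in> I" using i C by auto
    obtain u v where uv [simp]: "u \<in> carrier R" "v \<in> carrier R"
      and vu: "v \<otimes>\<^bsub>R\<^esub> u = idem" and uv': "u \<otimes>\<^bsub>R\<^esub> v = e i"
      using link[of i] i by (auto simp: C_def)
    \<comment> \<open>Both sides equal u v u, respectively v u v. Compressing u and v by e on one
      side thus compresses them by e_i on the other side as well.\<close>
    have eu: "e i \<otimes>\<^bsub>R\<^esub> u = u \<otimes>\<^bsub>R\<^esub> idem" and ve: "v \<otimes>\<^bsub>R\<^esub> e i = idem \<otimes>\<^bsub>R\<^esub> v"
      by (simp_all add: R.m_assoc flip: uv' vu)
    define u' v' where "u' = u \<otimes>\<^bsub>R\<^esub> idem" and "v' = idem \<otimes>\<^bsub>R\<^esub> v"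
    have ui: "u' \<otimes>\<^bsub>R\<^esub> idem = u'" and iv: "idem \<otimes>\<^bsub>R\<^esub> v' = v'"
      by (simp_all add: u'_def v'_def R.m_assoc idem_idem) (simp add: idem_idem flip: R.m_assoc)
    have eu': "e i \<otimes>\<^bsub>R\<^esub> u' = u'" and ve': "v' \<otimes>\<^bsub>R\<^esub> e i = v'"
    proof -
      have "e i \<otimes>\<^bsub>R\<^esub> u' = e i \<otimes>\<^bsub>R\<^esub> e i \<otimes>\<^bsub>R\<^esub> u" using iI by (simp add: u'_def R.m_assoc flip: eu)
      then show "e i \<otimes>\<^bsub>R\<^esub> u' = u'" using iI by (simp add: e_idem eu u'_def)
      have "v' \<otimes>\<^bsub>R\<^esub> e i = v \<otimes>\<^bsub>R\<^esub> (e i \<otimes>\<^bsub>R\<^esub> e i)" using iI by (simp add: v'_def R.m_assoc flip: ve)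
      then show "v' \<otimes>\<^bsub>R\<^esub> e i = v'" using iI by (simp add: e_idem ve v'_def)
    qed
    have "v' \<otimes>\<^bsub>R\<^esub> u' = idem \<otimes>\<^bsub>R\<^esub> (v \<otimes>\<^bsub>R\<^esub> u) \<otimes>\<^bsub>R\<^esub> idem"
      unfolding u'_def v'_def by (simp add: R.m_assoc del: vu)
    then have vu': "v' \<otimes>\<^bsub>R\<^esub> u' = idem" by (simp add: vu idem_idem)
    have "u' \<otimes>\<^bsub>R\<^esub> v' = u \<otimes>\<^bsub>R\<^esub> (idem \<otimes>\<^bsub>R\<^esub> idem) \<otimes>\<^bsub>R\<^esub> v"
      unfolding u'_def v'_def by (simp add: R.m_assoc)
    also have "\<dots> = u \<otimes>\<^bsub>R\<^esub> idem \<otimes>\<^bsub>R\<^esub> v" by (simp add: idem_idem)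
    also have "\<dots> = e i \<otimes>\<^bsub>R\<^esub> e i" using iI by (simp add: R.m_assoc flip: eu) (simp add: uv')
    finally have uv'': "u' \<otimes>\<^bsub>R\<^esub> v' = e i" using iI by (simp add: e_idem)
    have "u' \<in> carrier R" "v' \<in> carrier R" by (simp_all add: u'_def v'_def)
    then show ?thesis using ui iv eu' ve' vu' uv'' unfolding linked_def by blast
  qed
  then obtain u v where linked: "\<And>i. i \<in> C \<Longrightarrow> linked i (u i) (v i)"
    by metis
  then have uv [simp]: "i \<in> C \<Longrightarrow> u i \<in> carrier R" "i \<in> C \<Longrightarrow> v i \<in> carrier R"
    and vu: "i \<in> C \<Longrightarrow> v i \<otimes>\<^bsub>R\<^esub> u i = idem" and uve: "i \<in> C \<Longrightarrow> u i \<otimes>\<^bsub>R\<^esub> v i = e i"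
    and iv: "i \<in> C \<Longrightarrow> idem \<otimes>\<^bsub>R\<^esub> v i = v i" and ve: "i \<in> C \<Longrightarrow> v i \<otimes>\<^bsub>R\<^esub> e i = v i"
    and ui: "i \<in> C \<Longrightarrow> u i \<otimes>\<^bsub>R\<^esub> idem = u i" and eu: "i \<in> C \<Longrightarrow> e i \<otimes>\<^bsub>R\<^esub> u i = u i" for i
    unfolding linked_def by blast+
  have vu_orth: "v i \<otimes>\<^bsub>R\<^esub> u j = \<zero>\<^bsub>R\<^esub>" if "i \<in> C" "j \<in> C" "i \<noteq> j" for i j
  proof -
    have ij: "i \<in> I" "j \<in> I" using that C by auto
    have "v i \<otimes>\<^bsub>R\<^esub> u j = (v i \<otimes>\<^bsub>R\<^esub> e i) \<otimes>\<^bsub>R\<^esub> (e j \<otimes>\<^bsub>R\<^esub> u j)" using that by (simp add: ve eu)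
    also have "\<dots> = v i \<otimes>\<^bsub>R\<^esub> (e i \<otimes>\<^bsub>R\<^esub> e j) \<otimes>\<^bsub>R\<^esub> u j" using that ij by (simp add: R.m_assoc)
    also have "\<dots> = \<zero>\<^bsub>R\<^esub>" using that ij by (simp add: e_orth)
    finally show ?thesis .
  qed
  have radD: "idem \<otimes>\<^bsub>R\<^esub> (y \<otimes>\<^bsub>R\<^esub> x \<otimes>\<^bsub>R\<^esub> z) \<otimes>\<^bsub>R\<^esub> idem = \<zero>\<^bsub>R\<^esub>"
    if "x \<in> corner_radical R idem" "y \<in> carrier R" "z \<in> carrier R" for x y z
    using that unfolding corner_radical_def by blast

  have split: "x \<otimes>\<^bsub>R\<^esub> y = (\<Oplus>\<^bsub>R\<^esub>i\<in>I. x \<otimes>\<^bsub>R\<^esub> e i \<otimes>\<^bsub>R\<^esub> y)" if x: "x \<in> carrier R" and y: "y \<in> carrier R" for x y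
  proof -
    have "x \<otimes>\<^bsub>R\<^esub> y = x \<otimes>\<^bsub>R\<^esub> (\<Oplus>\<^bsub>R\<^esub>i\<in>I. e i) \<otimes>\<^bsub>R\<^esub> y" using that by (simp add: e_sum)
    also have "\<dots> = (\<Oplus>\<^bsub>R\<^esub>i\<in>I. x \<otimes>\<^bsub>R\<^esub> e i) \<otimes>\<^bsub>R\<^esub> y"
      using x I e_closed by (simp add: R.finsum_rdistr)
    also have "\<dots> = (\<Oplus>\<^bsub>R\<^esub>i\<in>I. x \<otimes>\<^bsub>R\<^esub> e i \<otimes>\<^bsub>R\<^esub> y)"
      using x y I by (intro R.finsum_ldistr) auto
    finally show ?thesis .
  qed
  \<comment> \<open>Compression by e on both sides kills the summands with e_i in the radical, so
    reducing the sum to \<open>C\<close> is an equality in \<open>R\<close> and not only modulo the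
    radical.\<close>
  have split_C: "idem \<otimes>\<^bsub>R\<^esub> x \<otimes>\<^bsub>R\<^esub> (y \<otimes>\<^bsub>R\<^esub> idem) = (\<Oplus>\<^bsub>R\<^esub>i\<in>C. idem \<otimes>\<^bsub>R\<^esub> x \<otimes>\<^bsub>R\<^esub> e i \<otimes>\<^bsub>R\<^esub> (y \<otimes>\<^bsub>R\<^esub> idem))"
    if [simp]: "x \<in> carrier R" "y \<in> carrier R" for x y
  proof -
    have "(\<Oplus>\<^bsub>R\<^esub>i\<in>C. idem \<otimes>\<^bsub>R\<^esub> x \<otimes>\<^bsub>R\<^esub> e i \<otimes>\<^bsub>R\<^esub> (y \<otimes>\<^bsub>R\<^esub> idem)) =
        (\<Oplus>\<^bsub>R\<^esub>i\<in>I. idem \<otimes>\<^bsub>R\<^esub> x \<otimes>\<^bsub>R\<^esub> e i \<otimes>\<^bsub>R\<^esub> (y \<otimes>\<^bsub>R\<^esub> idem))"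
    proof (rule R.add.finprod_mono_neutral_cong_left[OF I C(2)])
      fix i assume i: "i \<in> I - C"
      then have "e i \<in> corner_radical R idem" by (auto simp: C_def)
      from radD[OF this, of x y] show "idem \<otimes>\<^bsub>R\<^esub> x \<otimes>\<^bsub>R\<^esub> e i \<otimes>\<^bsub>R\<^esub> (y \<otimes>\<^bsub>R\<^esub> idem) = \<zero>\<^bsub>R\<^esub>"
        using i by (simp add: R.m_assoc)
    qed auto
    then show ?thesis by (simp add: split[of "idem \<otimes>\<^bsub>R\<^esub> x"])
  qed

  \<comment> \<open>The (i, j) entry is v_i x u_j read as an element of \<open>A\<close>, which is
    meaningful for i and j in \<open>C\<close>.\<close>
  define g where "g i j x = inv_into (carrier A) \<iota> (v i \<otimes>\<^bsub>R\<^esub> x \<otimes>\<^bsub>R\<^esub> u j)" for i j x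
  have g: "g i j x \<in> carrier A" "\<iota> (g i j x) = v i \<otimes>\<^bsub>R\<^esub> x \<otimes>\<^bsub>R\<^esub> u j"
    if "i \<in> C" "j \<in> C" "x \<in> carrier R" for i j x
  proof -
    have "v i \<otimes>\<^bsub>R\<^esub> x \<otimes>\<^bsub>R\<^esub> u j = (idem \<otimes>\<^bsub>R\<^esub> v i) \<otimes>\<^bsub>R\<^esub> x \<otimes>\<^bsub>R\<^esub> (u j \<otimes>\<^bsub>R\<^esub> idem)"
      using that by (simp add: iv ui)
    also have "\<dots> = idem \<otimes>\<^bsub>R\<^esub> (v i \<otimes>\<^bsub>R\<^esub> x \<otimes>\<^bsub>R\<^esub> u j) \<otimes>\<^bsub>R\<^esub> idem"
      using that by (simp add: R.m_assoc)
    finally have "v i \<otimes>\<^bsub>R\<^esub> x \<otimes>\<^bsub>R\<^esub> u j \<in> \<iota> ` carrier A"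
      using emb_corner[of "v i \<otimes>\<^bsub>R\<^esub> x \<otimes>\<^bsub>R\<^esub> u j"] that by simp
    then show "g i j x \<in> carrier A" "\<iota> (g i j x) = v i \<otimes>\<^bsub>R\<^esub> x \<otimes>\<^bsub>R\<^esub> u j"
      unfolding g_def by (auto intro: inv_into_into f_inv_into_f)
  qed
  have g_eqI: "g i j x = a" if "v i \<otimes>\<^bsub>R\<^esub> x \<otimes>\<^bsub>R\<^esub> u j = \<iota> a" "i \<in> C" "j \<in> C" "x \<in> carrier R" "a \<in> carrier A"
    for i j x a
    using that g[of i j x] emb_eq_iff by metis
  \<comment> \<open>\<open>split_C\<close> inserts the sum of the e_k between x and y, and e_k = u_k
    v_k turns each summand into a product of two entries.\<close>
  have g_mult: "g i j (x \<otimes>\<^bsub>R\<^esub> y) = (\<Oplus>\<^bsub>A\<^esub>k\<in>C. g i k x \<otimes>\<^bsub>A\<^esub> g k j y)"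
    if ij: "i \<in> C" "j \<in> C" and [simp]: "x \<in> carrier R" "y \<in> carrier R" for i j x y
  proof (rule g_eqI)
    have [simp]: "v i \<in> carrier R" "u j \<in> carrier R" using ij by auto
    have "v i \<otimes>\<^bsub>R\<^esub> (x \<otimes>\<^bsub>R\<^esub> y) \<otimes>\<^bsub>R\<^esub> u j = idem \<otimes>\<^bsub>R\<^esub> v i \<otimes>\<^bsub>R\<^esub> (x \<otimes>\<^bsub>R\<^esub> y) \<otimes>\<^bsub>R\<^esub> (u j \<otimes>\<^bsub>R\<^esub> idem)"
      using ij by (simp add: iv ui)
    also have "\<dots> = idem \<otimes>\<^bsub>R\<^esub> (v i \<otimes>\<^bsub>R\<^esub> x) \<otimes>\<^bsub>R\<^esub> (y \<otimes>\<^bsub>R\<^esub> u j \<otimes>\<^bsub>R\<^esub> idem)"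
      by (simp add: R.m_assoc)
    also have "\<dots> = (\<Oplus>\<^bsub>R\<^esub>k\<in>C. idem \<otimes>\<^bsub>R\<^esub> (v i \<otimes>\<^bsub>R\<^esub> x) \<otimes>\<^bsub>R\<^esub> e k \<otimes>\<^bsub>R\<^esub> (y \<otimes>\<^bsub>R\<^esub> u j \<otimes>\<^bsub>R\<^esub> idem))"
      by (rule split_C) auto
    also have "\<dots> = (\<Oplus>\<^bsub>R\<^esub>k\<in>C. \<iota> (g i k x \<otimes>\<^bsub>A\<^esub> g k j y))"
    proof (rule R.add.finprod_cong'[OF refl])
      fix k assume k: "k \<in> C"
      have "idem \<otimes>\<^bsub>R\<^esub> (v i \<otimes>\<^bsub>R\<^esub> x) \<otimes>\<^bsub>R\<^esub> e k \<otimes>\<^bsub>R\<^esub> (y \<otimes>\<^bsub>R\<^esub> u j \<otimes>\<^bsub>R\<^esub> idem) =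
          (idem \<otimes>\<^bsub>R\<^esub> v i) \<otimes>\<^bsub>R\<^esub> x \<otimes>\<^bsub>R\<^esub> (u k \<otimes>\<^bsub>R\<^esub> v k) \<otimes>\<^bsub>R\<^esub> (y \<otimes>\<^bsub>R\<^esub> (u j \<otimes>\<^bsub>R\<^esub> idem))"
        using k by (simp add: R.m_assoc uve subsetD[OF C(2)])
      also have "\<dots> = \<iota> (g i k x) \<otimes>\<^bsub>R\<^esub> \<iota> (g k j y)"
        unfolding iv[OF ij(1)] ui[OF ij(2)] using k ij by (simp add: g R.m_assoc)
      finally show "idem \<otimes>\<^bsub>R\<^esub> (v i \<otimes>\<^bsub>R\<^esub> x) \<otimes>\<^bsub>R\<^esub> e k \<otimes>\<^bsub>R\<^esub> (y \<otimes>\<^bsub>R\<^esub> u j \<otimes>\<^bsub>R\<^esub> idem) = \<iota> (g i k x \<otimes>\<^bsub>A\<^esub> g k j y)"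
        using k ij by (simp add: g(1) emb_mult)
    qed (use ij g(1) in auto)
    also have "\<dots> = \<iota> (\<Oplus>\<^bsub>A\<^esub>k\<in>C. g i k x \<otimes>\<^bsub>A\<^esub> g k j y)"
      by (rule emb_finsum[symmetric]) (use C ij g(1) in auto)
    finally show "v i \<otimes>\<^bsub>R\<^esub> (x \<otimes>\<^bsub>R\<^esub> y) \<otimes>\<^bsub>R\<^esub> u j = \<iota> (\<Oplus>\<^bsub>A\<^esub>k\<in>C. g i k x \<otimes>\<^bsub>A\<^esub> g k j y)" .
  qed (use ij g(1) in \<open>auto intro!: A.finsum_closed\<close>)
  have g_add: "g i j (x \<oplus>\<^bsub>R\<^esub> y) = g i j x \<oplus>\<^bsub>A\<^esub> g i j y"
    if "i \<in> C" "j \<in> C" "x \<in> carrier R" "y \<in> carrier R" for i j x y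
    by (rule g_eqI) (use that in \<open>auto simp: emb_add g R.l_distr R.r_distr\<close>)
  have g_smult: "g i j (r \<odot>\<^bsub>R\<^esub> x) = r \<odot>\<^bsub>A\<^esub> g i j x"
    if "i \<in> C" "j \<in> C" "x \<in> carrier R" "r \<in> carrier F" for i j x r
    by (rule g_eqI) (use that in \<open>auto simp: emb_smult g RA.smult_mult_left RA.smult_mult_right\<close>)
  have g_one: "g i j \<one>\<^bsub>R\<^esub> = (if i = j then \<one>\<^bsub>A\<^esub> else \<zero>\<^bsub>A\<^esub>)" if "i \<in> C" "j \<in> C" for i j
    by (rule g_eqI) (use that in \<open>auto simp: vu vu_orth emb_zero\<close>)
  have g_zero_iff: "x \<in> corner_radical R idem \<longleftrightarrow> (\<forall>i\<in>C. \<forall>j\<in>C. v i \<otimes>\<^bsub>R\<^esub> x \<otimes>\<^bsub>R\<^esub> u j = \<zero>\<^bsub>R\<^esub>)"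
    if [simp]: "x \<in> carrier R" for x
  proof
    assume x: "x \<in> corner_radical R idem"
    show "\<forall>i\<in>C. \<forall>j\<in>C. v i \<otimes>\<^bsub>R\<^esub> x \<otimes>\<^bsub>R\<^esub> u j = \<zero>\<^bsub>R\<^esub>"
    proof (intro ballI)
      fix i j assume ij: "i \<in> C" "j \<in> C"
      have "v i \<otimes>\<^bsub>R\<^esub> x \<otimes>\<^bsub>R\<^esub> u j = (idem \<otimes>\<^bsub>R\<^esub> v i) \<otimes>\<^bsub>R\<^esub> x \<otimes>\<^bsub>R\<^esub> (u j \<otimes>\<^bsub>R\<^esub> idem)"
        using ij by (simp add: iv ui)
      also have "\<dots> = idem \<otimes>\<^bsub>R\<^esub> (v i \<otimes>\<^bsub>R\<^esub> x \<otimes>\<^bsub>R\<^esub> u j) \<otimes>\<^bsub>R\<^esub> idem" using ij by (simp add: R.m_assoc)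
      also have "\<dots> = \<zero>\<^bsub>R\<^esub>" using ij by (intro radD x) auto
      finally show "v i \<otimes>\<^bsub>R\<^esub> x \<otimes>\<^bsub>R\<^esub> u j = \<zero>\<^bsub>R\<^esub>" .
    qed
  next
    assume *: "\<forall>i\<in>C. \<forall>j\<in>C. v i \<otimes>\<^bsub>R\<^esub> x \<otimes>\<^bsub>R\<^esub> u j = \<zero>\<^bsub>R\<^esub>"
    have "idem \<otimes>\<^bsub>R\<^esub> (y \<otimes>\<^bsub>R\<^esub> x \<otimes>\<^bsub>R\<^esub> z) \<otimes>\<^bsub>R\<^esub> idem = \<zero>\<^bsub>R\<^esub>" if [simp]: "y \<in> carrier R" "z \<in> carrier R" for y z
    proof -
      \<comment> \<open>Expanding e y x z e by \<open>split_C\<close> on both sides of x gives terms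
        e y e_i x e_j z e, and each of them contains the factor v_i x u_j.\<close>
      have zero: "idem \<otimes>\<^bsub>R\<^esub> y \<otimes>\<^bsub>R\<^esub> e i \<otimes>\<^bsub>R\<^esub> x \<otimes>\<^bsub>R\<^esub> e j \<otimes>\<^bsub>R\<^esub> (z \<otimes>\<^bsub>R\<^esub> idem) = \<zero>\<^bsub>R\<^esub>"
        if ij: "i \<in> C" "j \<in> C" for i j
      proof -
        have "idem \<otimes>\<^bsub>R\<^esub> y \<otimes>\<^bsub>R\<^esub> e i \<otimes>\<^bsub>R\<^esub> x \<otimes>\<^bsub>R\<^esub> e j \<otimes>\<^bsub>R\<^esub> (z \<otimes>\<^bsub>R\<^esub> idem) =
            idem \<otimes>\<^bsub>R\<^esub> y \<otimes>\<^bsub>R\<^esub> u i \<otimes>\<^bsub>R\<^esub> (v i \<otimes>\<^bsub>R\<^esub> x \<otimes>\<^bsub>R\<^esub> u j) \<otimes>\<^bsub>R\<^esub> v j \<otimes>\<^bsub>R\<^esub> (z \<otimes>\<^bsub>R\<^esub> idem)"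
          using ij by (simp add: R.m_assoc flip: uve)
        then show ?thesis using ij * by simp
      qed
      have inner: "idem \<otimes>\<^bsub>R\<^esub> y \<otimes>\<^bsub>R\<^esub> e i \<otimes>\<^bsub>R\<^esub> (x \<otimes>\<^bsub>R\<^esub> z \<otimes>\<^bsub>R\<^esub> idem) = \<zero>\<^bsub>R\<^esub>" if i: "i \<in> C" for i
      proof -
        have [simp]: "e i \<in> carrier R" using i C by auto
        have "idem \<otimes>\<^bsub>R\<^esub> y \<otimes>\<^bsub>R\<^esub> e i \<otimes>\<^bsub>R\<^esub> (x \<otimes>\<^bsub>R\<^esub> z \<otimes>\<^bsub>R\<^esub> idem) =
            idem \<otimes>\<^bsub>R\<^esub> (y \<otimes>\<^bsub>R\<^esub> e i \<otimes>\<^bsub>R\<^esub> x) \<otimes>\<^bsub>R\<^esub> (z \<otimes>\<^bsub>R\<^esub> idem)" by (simp add: R.m_assoc)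
        also have "\<dots> = (\<Oplus>\<^bsub>R\<^esub>j\<in>C. idem \<otimes>\<^bsub>R\<^esub> (y \<otimes>\<^bsub>R\<^esub> e i \<otimes>\<^bsub>R\<^esub> x) \<otimes>\<^bsub>R\<^esub> e j \<otimes>\<^bsub>R\<^esub> (z \<otimes>\<^bsub>R\<^esub> idem))"
          by (rule split_C) auto
        also have "\<dots> = \<zero>\<^bsub>R\<^esub>"
          by (rule R.add.finprod_one_eqI) (use zero[OF i] subsetD[OF C(2)] in \<open>simp add: R.m_assoc\<close>)
        finally show ?thesis .
      qed
      have "idem \<otimes>\<^bsub>R\<^esub> (y \<otimes>\<^bsub>R\<^esub> x \<otimes>\<^bsub>R\<^esub> z) \<otimes>\<^bsub>R\<^esub> idem = idem \<otimes>\<^bsub>R\<^esub> y \<otimes>\<^bsub>R\<^esub> (x \<otimes>\<^bsub>R\<^esub> z \<otimes>\<^bsub>R\<^esub> idem)"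
        by (simp add: R.m_assoc)
      also have "\<dots> = (\<Oplus>\<^bsub>R\<^esub>i\<in>C. idem \<otimes>\<^bsub>R\<^esub> y \<otimes>\<^bsub>R\<^esub> e i \<otimes>\<^bsub>R\<^esub> (x \<otimes>\<^bsub>R\<^esub> z \<otimes>\<^bsub>R\<^esub> idem))"
        by (rule split_C) auto
      also have "\<dots> = \<zero>\<^bsub>R\<^esub>"
        by (rule R.add.finprod_one_eqI) (rule inner)
      finally show ?thesis .
    qed
    then show "x \<in> corner_radical R idem" unfolding corner_radical_def using that by blast
  qed

  define m where "m = card C"
  have m: "m \<ge> 1" using C \<open>C \<noteq> {}\<close> by (simp add: m_def Suc_leI card_gt_0_iff One_nat_def)
  \<comment> \<open>The indices in \<open>C\<close> are renumbered from 1 to \<open>m\<close>, the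
    index range of \<open>skew_matrices\<close>.\<close>
  obtain b where b: "bij_betw b {1..m} C"
    using ex_bij_betw_nat_finite_1[OF C(1)] unfolding m_def by blast
  have bC [simp]: "b i \<in> C" if "i \<in> {1..m}" for i using that b by (auto simp: bij_betw_def)
  have b_eq: "b i = b j \<longleftrightarrow> i = j" if "i \<in> {1..m}" "j \<in> {1..m}" for i j
    using that b by (auto simp: bij_betw_def inj_on_def)
  interpret Q: skew_matrix_ring F A m "\<lambda>_ _ _. \<one>\<^bsub>F\<^esub>"
    using module.axioms(1)[OF assoc_algebra.axioms(1)[OF A_alg]]
    by (intro skew_matrix_ring.intro A_alg skew_matrix_ring_axioms.intro unit_skew_set)
  note [simp del] = Q.c_unit Q.c_closed
  note [rule del] = Q.c_closed
  define \<pi> where "\<pi> x = (\<lambda>(i, j)\<in>{1..m} \<times> {1..m}. g (b i) (b j) x)" for x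
  have \<pi>_closed: "\<pi> x \<in> carrier Q.S" if "x \<in> carrier R" for x
    using that by (auto simp: \<pi>_def Q.S_carrier g(1))
  have \<pi>_entry: "\<pi> x (i, j) = g (b i) (b j) x" if "i \<in> {1..m}" "j \<in> {1..m}" for x i j
    using that by (simp add: \<pi>_def)
  have "\<pi> \<in> ring_hom R Q.S"
  proof (rule ring_hom_memI)
    fix x y assume xy [simp]: "x \<in> carrier R" "y \<in> carrier R"
    show "\<pi> (x \<otimes>\<^bsub>R\<^esub> y) = \<pi> x \<otimes>\<^bsub>Q.S\<^esub> \<pi> y"
    proof (rule Q.S_ext)
      fix i j assume ij: "i \<in> {1..m}" "j \<in> {1..m}"
      have "\<pi> (x \<otimes>\<^bsub>R\<^esub> y) (i, j) = (\<Oplus>\<^bsub>A\<^esub>k\<in>b ` {1..m}. g (b i) k x \<otimes>\<^bsub>A\<^esub> g k (b j) y)"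
        using ij b by (simp add: \<pi>_entry g_mult bij_betw_def)
      also have "\<dots> = (\<Oplus>\<^bsub>A\<^esub>k\<in>{1..m}. g (b i) (b k) x \<otimes>\<^bsub>A\<^esub> g (b k) (b j) y)"
        by (rule A.add.finprod_reindex) (use ij b g(1) in \<open>auto simp: bij_betw_def\<close>)
      also have "\<dots> = (\<Oplus>\<^bsub>A\<^esub>k\<in>{1..m}. \<one>\<^bsub>F\<^esub> \<odot>\<^bsub>A\<^esub> (\<pi> x (i, k) \<otimes>\<^bsub>A\<^esub> \<pi> y (k, j)))"
      proof (rule A.add.finprod_cong'[OF refl])
        have closed: "g (b i) (b k) x \<otimes>\<^bsub>A\<^esub> g (b k) (b j) y \<in> carrier A" if "k \<in> {1..m}" for k
          using that ij by (intro A.m_closed g(1) bC xy)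
        show eq: "g (b i) (b k) x \<otimes>\<^bsub>A\<^esub> g (b k) (b j) y = \<one>\<^bsub>F\<^esub> \<odot>\<^bsub>A\<^esub> (\<pi> x (i, k) \<otimes>\<^bsub>A\<^esub> \<pi> y (k, j))"
          if "k \<in> {1..m}" for k
          using that ij by (simp only: \<pi>_entry AA.smult_one closed)
        show "(\<lambda>k. \<one>\<^bsub>F\<^esub> \<odot>\<^bsub>A\<^esub> (\<pi> x (i, k) \<otimes>\<^bsub>A\<^esub> \<pi> y (k, j))) \<in> {1..m} \<rightarrow> carrier A"
          using closed eq by (simp only: Pi_iff) metis
      qed
      finally show "\<pi> (x \<otimes>\<^bsub>R\<^esub> y) (i, j) = (\<pi> x \<otimes>\<^bsub>Q.S\<^esub> \<pi> y) (i, j)"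
        using ij by (simp add: Q.S_mult_entry)
    qed (auto intro!: \<pi>_closed Q.S_mult_closed)
    show "\<pi> (x \<oplus>\<^bsub>R\<^esub> y) = \<pi> x \<oplus>\<^bsub>Q.S\<^esub> \<pi> y"
      by (rule Q.S_ext) (auto intro!: \<pi>_closed Q.S_add_closed simp: \<pi>_entry Q.S_add_entry g_add)
  next
    show "\<pi> \<one>\<^bsub>R\<^esub> = \<one>\<^bsub>Q.S\<^esub>"
      by (rule Q.S_ext) (auto intro!: \<pi>_closed Q.S_one_closed simp: \<pi>_entry Q.S_one_entry g_one b_eq)
  qed (rule \<pi>_closed)
  moreover have "\<pi> (r \<odot>\<^bsub>R\<^esub> x) = r \<odot>\<^bsub>Q.S\<^esub> \<pi> x" if "r \<in> carrier F" "x \<in> carrier R" for r x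
    by (rule Q.S_ext) (use that in \<open>auto intro!: \<pi>_closed Q.S_smult_closed simp: \<pi>_entry Q.S_smult_entry g_smult\<close>)
  moreover have "q \<in> \<pi> ` carrier R" if q: "q \<in> carrier Q.S" for q
  proof
    \<comment> \<open>A matrix q is hit by the sum of all u_i q_ij v_j. Enclosing this sum by v_i
      and u_j leaves one summand, because v_i u_k is zero for k different from i and is the unit of
      the corner for k = i.\<close>
    define t where "t = (\<lambda>(i, j). u (b i) \<otimes>\<^bsub>R\<^esub> \<iota> (q (i, j)) \<otimes>\<^bsub>R\<^esub> v (b j))"
    have t: "t \<in> {1..m} \<times> {1..m} \<rightarrow> carrier R" using q by (auto simp: t_def)
    show x: "(\<Oplus>\<^bsub>R\<^esub>p\<in>{1..m} \<times> {1..m}. t p) \<in> carrier R" using t by (rule R.finsum_closed)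
    show "q = \<pi> (\<Oplus>\<^bsub>R\<^esub>p\<in>{1..m} \<times> {1..m}. t p)"
    proof (rule Q.S_ext[OF q \<pi>_closed[OF x]])
      fix i j assume ij: "i \<in> {1..m}" "j \<in> {1..m}"
      have [simp]: "v (b i) \<in> carrier R" "u (b j) \<in> carrier R" "q (i, j) \<in> carrier A" using ij q by auto
      have "v (b i) \<otimes>\<^bsub>R\<^esub> (\<Oplus>\<^bsub>R\<^esub>p\<in>{1..m} \<times> {1..m}. t p) \<otimes>\<^bsub>R\<^esub> u (b j) =
          (\<Oplus>\<^bsub>R\<^esub>p\<in>{1..m} \<times> {1..m}. v (b i) \<otimes>\<^bsub>R\<^esub> t p) \<otimes>\<^bsub>R\<^esub> u (b j)"
        using t by (simp add: R.finsum_rdistr)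
      also have "\<dots> = (\<Oplus>\<^bsub>R\<^esub>p\<in>{1..m} \<times> {1..m}. v (b i) \<otimes>\<^bsub>R\<^esub> t p \<otimes>\<^bsub>R\<^esub> u (b j))"
        using t by (intro R.finsum_ldistr) auto
      also have "\<dots> = v (b i) \<otimes>\<^bsub>R\<^esub> t (i, j) \<otimes>\<^bsub>R\<^esub> u (b j)"
      proof (rule R.finsum_single)
        fix p assume p: "p \<in> {1..m} \<times> {1..m}" "p \<noteq> (i, j)"
        obtain k l where kl: "p = (k, l)" "k \<in> {1..m}" "l \<in> {1..m}" using p by auto
        have [simp]: "q (k, l) \<in> carrier A" using q kl by auto
        have "v (b i) \<otimes>\<^bsub>R\<^esub> t p \<otimes>\<^bsub>R\<^esub> u (b j) =
            (v (b i) \<otimes>\<^bsub>R\<^esub> u (b k)) \<otimes>\<^bsub>R\<^esub> \<iota> (q (k, l)) \<otimes>\<^bsub>R\<^esub> (v (b l) \<otimes>\<^bsub>R\<^esub> u (b j))"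
          using kl by (simp add: t_def R.m_assoc)
        also have "\<dots> = \<zero>\<^bsub>R\<^esub>"
        proof (cases "k = i")
          case True
          then have "l \<noteq> j" using p kl by auto
          then have "v (b l) \<otimes>\<^bsub>R\<^esub> u (b j) = \<zero>\<^bsub>R\<^esub>" using kl ij by (intro vu_orth) (auto simp: b_eq)
          then show ?thesis using kl by simp
        next
          case False
          then have "v (b i) \<otimes>\<^bsub>R\<^esub> u (b k) = \<zero>\<^bsub>R\<^esub>" using kl ij by (intro vu_orth) (auto simp: b_eq)
          then show ?thesis using kl by simp
        qed
        finally show "v (b i) \<otimes>\<^bsub>R\<^esub> t p \<otimes>\<^bsub>R\<^esub> u (b j) = \<zero>\<^bsub>R\<^esub>" .
      qed (use ij funcset_mem[OF t, of "(i, j)"] in auto)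
      also have "\<dots> = (v (b i) \<otimes>\<^bsub>R\<^esub> u (b i)) \<otimes>\<^bsub>R\<^esub> \<iota> (q (i, j)) \<otimes>\<^bsub>R\<^esub> (v (b j) \<otimes>\<^bsub>R\<^esub> u (b j))"
        using ij by (simp add: t_def R.m_assoc)
      also have "\<dots> = \<iota> (q (i, j))" using ij by (simp add: vu idem_emb)
      finally show "q (i, j) = \<pi> (\<Oplus>\<^bsub>R\<^esub>p\<in>{1..m} \<times> {1..m}. t p) (i, j)"
        using ij x by (simp add: \<pi>_entry g_eqI)
    qed
  qed
  moreover have "\<pi> x = \<pi> y \<longleftrightarrow> x \<ominus>\<^bsub>R\<^esub> y \<in> corner_radical R idem"
    if [simp]: "x \<in> carrier R" "y \<in> carrier R" for x y
  proof -
    have "\<pi> x = \<pi> y \<longleftrightarrow> (\<forall>i\<in>{1..m}. \<forall>j\<in>{1..m}. \<pi> x (i, j) = \<pi> y (i, j))"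
      using Q.S_ext[of "\<pi> x" "\<pi> y"] \<pi>_closed by auto
    also have "\<dots> \<longleftrightarrow> (\<forall>i\<in>{1..m}. \<forall>j\<in>{1..m}. g (b i) (b j) x = g (b i) (b j) y)"
      by (simp add: \<pi>_entry)
    also have "\<dots> \<longleftrightarrow> (\<forall>i\<in>C. \<forall>j\<in>C. g i j x = g i j y)"
    proof -
      have "C = b ` {1..m}" using b by (simp add: bij_betw_def)
      then show ?thesis by simp
    qed
    also have "\<dots> \<longleftrightarrow> (\<forall>i\<in>C. \<forall>j\<in>C. v i \<otimes>\<^bsub>R\<^esub> (x \<ominus>\<^bsub>R\<^esub> y) \<otimes>\<^bsub>R\<^esub> u j = \<zero>\<^bsub>R\<^esub>)"
    proof (intro ball_cong refl)
      fix i j assume ij [simp]: "i \<in> C" "j \<in> C"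
      have "v i \<otimes>\<^bsub>R\<^esub> (x \<ominus>\<^bsub>R\<^esub> y) \<otimes>\<^bsub>R\<^esub> u j = v i \<otimes>\<^bsub>R\<^esub> x \<otimes>\<^bsub>R\<^esub> u j \<ominus>\<^bsub>R\<^esub> v i \<otimes>\<^bsub>R\<^esub> y \<otimes>\<^bsub>R\<^esub> u j"
        by (simp add: R.minus_eq R.r_distr R.l_distr R.l_minus R.r_minus)
      then have "v i \<otimes>\<^bsub>R\<^esub> (x \<ominus>\<^bsub>R\<^esub> y) \<otimes>\<^bsub>R\<^esub> u j = \<zero>\<^bsub>R\<^esub> \<longleftrightarrow> v i \<otimes>\<^bsub>R\<^esub> x \<otimes>\<^bsub>R\<^esub> u j = v i \<otimes>\<^bsub>R\<^esub> y \<otimes>\<^bsub>R\<^esub> u j"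
        by (simp add: R.minus_eq_zero_iff)
      then show "g i j x = g i j y \<longleftrightarrow> v i \<otimes>\<^bsub>R\<^esub> (x \<ominus>\<^bsub>R\<^esub> y) \<otimes>\<^bsub>R\<^esub> u j = \<zero>\<^bsub>R\<^esub>"
        using emb_eq_iff[of "g i j x" "g i j y"] by (simp add: g)
    qed
    also have "\<dots> \<longleftrightarrow> x \<ominus>\<^bsub>R\<^esub> y \<in> corner_radical R idem"
      by (simp add: g_zero_iff)
    finally show ?thesis .
  qed
  ultimately have "algebra_epi F R Q.S \<pi> \<and>
    (\<forall>x\<in>carrier R. \<forall>y\<in>carrier R. \<pi> x = \<pi> y \<longleftrightarrow> x \<ominus>\<^bsub>R\<^esub> y \<in> corner_radical R idem)"
    unfolding algebra_epi_def using \<pi>_closed by blast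
  with m show ?thesis by blast
qed

section \<open>The tensor product as a quotient\<close>

text \<open>Multiplication in the free algebra collects all pairs of basis elements with the same
  product into one coefficient. This regrouping merges such coefficients back into a single sum over
  pairs.\<close>

lemma (in abelian_monoid) finsum_fibres:
  assumes "finite T" "w \<in> T \<rightarrow> carrier G"
  shows "(\<Oplus>s\<in>T. w s) = (\<Oplus>p\<in>\<mu> ` T. \<Oplus>s\<in>{s \<in> T. \<mu> s = p}. w s)"
proof -
  have "(\<Oplus>s\<in>\<Union>((\<lambda>p. {s \<in> T. \<mu> s = p}) ` \<mu> ` T). w s) = (\<Oplus>p\<in>\<mu> ` T. \<Oplus>s\<in>{s \<in> T. \<mu> s = p}. w s)"
    by (rule add.finprod_UN_disjoint) (use assms in \<open>auto simp: pairwise_def disjnt_def\<close>)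
  moreover have "\<Union>((\<lambda>p. {s \<in> T. \<mu> s = p}) ` \<mu> ` T) = T" by auto
  ultimately show ?thesis by simp
qed

lemma (in abelian_monoid) finsum_Times:
  assumes "finite I" "finite J" "w \<in> I \<times> J \<rightarrow> carrier G"
  shows "(\<Oplus>s\<in>I \<times> J. w s) = (\<Oplus>i\<in>I. \<Oplus>j\<in>J. w (i, j))"
  using assms(1,3)
proof (induction I)
  case (insert i I)
  have "(\<Oplus>s\<in>Pair i ` J \<union> I \<times> J. w s) = (\<Oplus>s\<in>Pair i ` J. w s) \<oplus> (\<Oplus>s\<in>I \<times> J. w s)"
    by (rule add.finprod_Un_disjoint) (use insert assms(2) in auto)
  also have "(\<Oplus>s\<in>Pair i ` J. w s) = (\<Oplus>j\<in>J. w (i, j))"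
    by (rule add.finprod_reindex) (use insert in \<open>auto simp: inj_on_def\<close>)
  also have "Pair i ` J \<union> I \<times> J = insert i I \<times> J" by auto
  moreover have "(\<Oplus>k\<in>insert i I. \<Oplus>j\<in>J. w (k, j)) = (\<Oplus>j\<in>J. w (i, j)) \<oplus> (\<Oplus>k\<in>I. \<Oplus>j\<in>J. w (k, j))"
    using insert by (intro add.finprod_insert) (auto intro!: add.finprod_closed)
  moreover have "(\<Oplus>s\<in>I \<times> J. w s) = (\<Oplus>k\<in>I. \<Oplus>j\<in>J. w (k, j))"
    using insert by auto
  ultimately show ?case by simp
qed simp

lemma (in module) finsum_smult_rdistr:
  assumes "finite I" "f \<in> I \<rightarrow> carrier R" "x \<in> carrier M"
  shows "(\<Oplus>i\<in>I. f i) \<odot>\<^bsub>M\<^esub> x = (\<Oplus>\<^bsub>M\<^esub>i\<in>I. f i \<odot>\<^bsub>M\<^esub> x)"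
  using assms(1,2)
proof (induction I)
  case (insert i I)
  then have "f i \<in> carrier R" "f \<in> I \<rightarrow> carrier R" by auto
  moreover from this have "(\<lambda>i. f i \<odot>\<^bsub>M\<^esub> x) \<in> I \<rightarrow> carrier M" using assms(3) by auto
  ultimately show ?case using insert assms(3) by (simp add: smult_l_distr)
qed (use assms in simp)

context unital_algebra
begin

lemma mult_zero_left [simp]: "x \<in> carrier T \<Longrightarrow> \<zero>\<^bsub>T\<^esub> \<otimes>\<^bsub>T\<^esub> x = \<zero>\<^bsub>T\<^esub>"
  using smult_left[of "\<zero>" "\<zero>\<^bsub>T\<^esub>" x] by simp

lemma mult_zero_right [simp]: "x \<in> carrier T \<Longrightarrow> x \<otimes>\<^bsub>T\<^esub> \<zero>\<^bsub>T\<^esub> = \<zero>\<^bsub>T\<^esub>"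
  using smult_right[of "\<zero>" x "\<zero>\<^bsub>T\<^esub>"] by simp

lemma finsum_mult_left:
  assumes "finite I" "f \<in> I \<rightarrow> carrier T" "x \<in> carrier T"
  shows "(\<Oplus>\<^bsub>T\<^esub>i\<in>I. f i) \<otimes>\<^bsub>T\<^esub> x = (\<Oplus>\<^bsub>T\<^esub>i\<in>I. f i \<otimes>\<^bsub>T\<^esub> x)"
  using assms(1,2)
proof (induction I)
  case (insert i I)
  then have "f i \<in> carrier T" "f \<in> I \<rightarrow> carrier T" by auto
  moreover from this have "(\<lambda>i. f i \<otimes>\<^bsub>T\<^esub> x) \<in> I \<rightarrow> carrier T" using assms(3) by auto
  ultimately show ?case using insert assms(3) by (simp add: distr_left)
qed (use assms in simp)

lemma finsum_mult_right:
  assumes "finite I" "f \<in> I \<rightarrow> carrier T" "x \<in> carrier T"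
  shows "x \<otimes>\<^bsub>T\<^esub> (\<Oplus>\<^bsub>T\<^esub>i\<in>I. f i) = (\<Oplus>\<^bsub>T\<^esub>i\<in>I. x \<otimes>\<^bsub>T\<^esub> f i)"
  using assms(1,2)
proof (induction I)
  case (insert i I)
  then have "f i \<in> carrier T" "f \<in> I \<rightarrow> carrier T" by auto
  moreover from this have "(\<lambda>i. x \<otimes>\<^bsub>T\<^esub> f i) \<in> I \<rightarrow> carrier T" using assms(3) by auto
  ultimately show ?case using insert assms(3) by (simp add: distr_right)
qed (use assms in simp)

end

text \<open>Presents F as a module over itself, so that \<open>pointwise_module\<close> applies to
  functions with scalar values.\<close>

definition self_module :: "('f, 'k) ring_scheme \<Rightarrow> ('f, 'f) module" where
  "self_module F = \<lparr>carrier = carrier F, mult = mult F, one = one F, zero = zero F, add = add F, smult = mult F\<rparr>"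

lemma (in cring) self_module: "module R (self_module R)"
proof (rule moduleI)
  show "abelian_group (self_module R)"
    by (rule abelian_groupI)
       (auto simp: self_module_def a_ac intro: exI[of _ "\<ominus> x" for x] bexI[of _ "\<ominus> x" for x] simp: l_neg)
qed (auto simp: self_module_def l_distr r_distr m_assoc intro: cring_axioms)

section \<open>Maps on tensor products induced by bilinear multiplicative maps\<close>

text \<open>\<open>A\<close> and \<open>B\<close> enter through the closure of their operations,
  while all identities are computed in \<open>S\<close>; this leaves room for a nonassociative
  second factor. The argument of \<open>\<phi>\<close> is a pair because pairs index the basis of
  the free algebra.\<close>

locale tensor_map = unital_algebra F S for F (structure) and S (structure) +
  fixes A :: "('f, 'a, 'm) module_scheme" and B :: "('f, 'b, 'n) module_scheme" and \<phi>
  assumes A_closed: "\<one>\<^bsub>A\<^esub> \<in> carrier A"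
      "\<And>a b. a \<in> carrier A \<Longrightarrow> b \<in> carrier A \<Longrightarrow> a \<otimes>\<^bsub>A\<^esub> b \<in> carrier A"
      "\<And>a b. a \<in> carrier A \<Longrightarrow> b \<in> carrier A \<Longrightarrow> a \<oplus>\<^bsub>A\<^esub> b \<in> carrier A"
      "\<And>r a. r \<in> carrier F \<Longrightarrow> a \<in> carrier A \<Longrightarrow> r \<odot>\<^bsub>A\<^esub> a \<in> carrier A"
    and B_closed: "\<one>\<^bsub>B\<^esub> \<in> carrier B"
      "\<And>a b. a \<in> carrier B \<Longrightarrow> b \<in> carrier B \<Longrightarrow> a \<otimes>\<^bsub>B\<^esub> b \<in> carrier B"
      "\<And>a b. a \<in> carrier B \<Longrightarrow> b \<in> carrier B \<Longrightarrow> a \<oplus>\<^bsub>B\<^esub> b \<in> carrier B"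
      "\<And>r a. r \<in> carrier F \<Longrightarrow> a \<in> carrier B \<Longrightarrow> r \<odot>\<^bsub>B\<^esub> a \<in> carrier B"
    and \<phi>_closed: "\<And>a b. a \<in> carrier A \<Longrightarrow> b \<in> carrier B \<Longrightarrow> \<phi> (a, b) \<in> carrier S"
    and \<phi>_one: "\<phi> (\<one>\<^bsub>A\<^esub>, \<one>\<^bsub>B\<^esub>) = \<one>\<^bsub>S\<^esub>"
    and \<phi>_mult: "\<And>a a' b b'. a \<in> carrier A \<Longrightarrow> a' \<in> carrier A \<Longrightarrow> b \<in> carrier B \<Longrightarrow> b' \<in> carrier B \<Longrightarrow>
        \<phi> (a \<otimes>\<^bsub>A\<^esub> a', b \<otimes>\<^bsub>B\<^esub> b') = \<phi> (a, b) \<otimes>\<^bsub>S\<^esub> \<phi> (a', b')"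
    and \<phi>_add_left: "\<And>a a' b. a \<in> carrier A \<Longrightarrow> a' \<in> carrier A \<Longrightarrow> b \<in> carrier B \<Longrightarrow>
        \<phi> (a \<oplus>\<^bsub>A\<^esub> a', b) = \<phi> (a, b) \<oplus>\<^bsub>S\<^esub> \<phi> (a', b)"
    and \<phi>_add_right: "\<And>a b b'. a \<in> carrier A \<Longrightarrow> b \<in> carrier B \<Longrightarrow> b' \<in> carrier B \<Longrightarrow>
        \<phi> (a, b \<oplus>\<^bsub>B\<^esub> b') = \<phi> (a, b) \<oplus>\<^bsub>S\<^esub> \<phi> (a, b')"
    and \<phi>_smult_left: "\<And>r a b. r \<in> carrier F \<Longrightarrow> a \<in> carrier A \<Longrightarrow> b \<in> carrier B \<Longrightarrow>
        \<phi> (r \<odot>\<^bsub>A\<^esub> a, b) = r \<odot>\<^bsub>S\<^esub> \<phi> (a, b)"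
    and \<phi>_smult_right: "\<And>r a b. r \<in> carrier F \<Longrightarrow> a \<in> carrier A \<Longrightarrow> b \<in> carrier B \<Longrightarrow>
        \<phi> (a, r \<odot>\<^bsub>B\<^esub> b) = r \<odot>\<^bsub>S\<^esub> \<phi> (a, b)"
begin

abbreviation P where "P \<equiv> free_algebra F A B"
abbreviation X where "X \<equiv> carrier A \<times> carrier B"
abbreviation supp where "supp \<equiv> free_supp F A B"
abbreviation d where "d \<equiv> free_single F A B"

lemma P_carrier: "f \<in> carrier P \<longleftrightarrow> f \<in> X \<rightarrow>\<^sub>E carrier F \<and> finite (supp f)"
  by (simp add: free_algebra_def)

lemma P_add: "f \<oplus>\<^bsub>P\<^esub> g = (\<lambda>p\<in>X. f p \<oplus> g p)"
  and P_zero: "\<zero>\<^bsub>P\<^esub> = (\<lambda>p\<in>X. \<zero>)"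
  and P_smult: "r \<odot>\<^bsub>P\<^esub> f = (\<lambda>p\<in>X. r \<otimes> f p)"
  by (simp_all add: free_algebra_def)

lemma P_val: "f \<in> carrier P \<Longrightarrow> p \<in> X \<Longrightarrow> f p \<in> carrier F"
  unfolding P_carrier by blast

lemma P_ext: "f \<in> carrier P \<Longrightarrow> g \<in> carrier P \<Longrightarrow> (\<And>p. p \<in> X \<Longrightarrow> f p = g p) \<Longrightarrow> f = g"
  unfolding P_carrier by (blast intro: PiE_ext)

lemma finite_supp: "f \<in> carrier P \<Longrightarrow> finite (supp f)"
  by (simp add: P_carrier)

lemma supp_subset: "supp f \<subseteq> X"
  by (auto simp: free_supp_def)

lemma supp_zero: "p \<in> X \<Longrightarrow> p \<notin> supp f \<Longrightarrow> f p = \<zero>"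
  by (simp add: free_supp_def)

lemma supp_X: "p \<in> supp f \<Longrightarrow> p \<in> X"
  using supp_subset by blast

lemma supp_val [simp, intro]: "f \<in> carrier P \<Longrightarrow> p \<in> supp g \<Longrightarrow> f p \<in> carrier F"
  by (rule P_val) (auto dest: supp_X)

lemma P_val_pair [simp, intro]: "f \<in> carrier P \<Longrightarrow> a \<in> carrier A \<Longrightarrow> b \<in> carrier B \<Longrightarrow> f (a, b) \<in> carrier F"
  by (rule P_val) auto

lemma \<phi>_X [simp, intro]: "p \<in> X \<Longrightarrow> \<phi> p \<in> carrier S"
  by (auto simp: \<phi>_closed)

lemma \<phi>_supp [simp, intro]: "p \<in> supp f \<Longrightarrow> \<phi> p \<in> carrier S"
  by (rule \<phi>_X) (rule supp_X)

lemma P_add_closed: "f \<in> carrier P \<Longrightarrow> g \<in> carrier P \<Longrightarrow> f \<oplus>\<^bsub>P\<^esub> g \<in> carrier P"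
proof -
  assume fg: "f \<in> carrier P" "g \<in> carrier P"
  have "supp (f \<oplus>\<^bsub>P\<^esub> g) \<subseteq> supp f \<union> supp g" by (auto simp: free_supp_def P_add)
  then have "finite (supp (f \<oplus>\<^bsub>P\<^esub> g))" using fg by (meson finite_UnI finite_subset finite_supp)
  then show ?thesis using fg unfolding P_carrier by (auto simp: P_add intro!: R.a_closed)
qed

lemma P_smult_closed: "r \<in> carrier F \<Longrightarrow> f \<in> carrier P \<Longrightarrow> r \<odot>\<^bsub>P\<^esub> f \<in> carrier P"
proof -
  assume *: "r \<in> carrier F" "f \<in> carrier P"
  have "supp (r \<odot>\<^bsub>P\<^esub> f) \<subseteq> supp f" using * by (auto simp: free_supp_def P_smult)
  then have "finite (supp (r \<odot>\<^bsub>P\<^esub> f))" using * by (meson finite_subset finite_supp)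
  then show ?thesis using * unfolding P_carrier by (auto simp: P_smult intro!: R.m_closed)
qed

lemma P_zero_closed: "\<zero>\<^bsub>P\<^esub> \<in> carrier P"
  by (auto simp: P_carrier P_zero free_supp_def)

lemma P_module: "module F P"
proof (rule pointwise_module[OF R.self_module, where I = X])
  show "carrier P \<subseteq> X \<rightarrow>\<^sub>E carrier (self_module F)"
    by (simp add: self_module_def P_carrier subset_iff)
qed (simp_all add: P_add_closed P_zero_closed P_smult_closed, simp_all add: self_module_def P_add P_zero P_smult)

sublocale P: module F P by (rule P_module)

lemma d_closed: "d p \<in> carrier P"
proof -
  have "supp (d p) \<subseteq> {p}" by (auto simp: free_supp_def free_single_def)
  then have "finite (supp (d p))" by (rule finite_subset) simp
  then show ?thesis by (auto simp: P_carrier free_single_def)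
qed

text \<open>Naming the multiplication of basis elements as one map on pairs of pairs exhibits each
  coefficient of a product in the free algebra as a sum over a fibre, the shape that
  \<open>finsum_fibres\<close> expects.\<close>

definition product :: "('a \<times> 'b) \<times> ('a \<times> 'b) \<Rightarrow> 'a \<times> 'b" where
  "product s = (fst (fst s) \<otimes>\<^bsub>A\<^esub> fst (snd s), snd (fst s) \<otimes>\<^bsub>B\<^esub> snd (snd s))"

lemma product_closed: "s \<in> X \<times> X \<Longrightarrow> product s \<in> X"
  by (auto simp: product_def A_closed B_closed)

lemma P_mult_val:
  assumes "p \<in> X"
  shows "(f \<otimes>\<^bsub>P\<^esub> g) p = (\<Oplus>s\<in>{s \<in> supp f \<times> supp g. product s = p}. f (fst s) \<otimes> g (snd s))"
proof -
  have "{s \<in> supp f \<times> supp g. product s = p} = {(q, r). q \<in> supp f \<and> r \<in> supp g \<and>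
      (fst q \<otimes>\<^bsub>A\<^esub> fst r, snd q \<otimes>\<^bsub>B\<^esub> snd r) = p}"
    by (auto simp: product_def)
  then show ?thesis using assms by (simp add: free_algebra_def)
qed

lemma P_mult_supp: "supp (f \<otimes>\<^bsub>P\<^esub> g) \<subseteq> product ` (supp f \<times> supp g)"
proof
  fix p assume p: "p \<in> supp (f \<otimes>\<^bsub>P\<^esub> g)"
  show "p \<in> product ` (supp f \<times> supp g)"
  proof (rule ccontr)
    assume "p \<notin> product ` (supp f \<times> supp g)"
    then have "{s \<in> supp f \<times> supp g. product s = p} = {}" by blast
    then have "(f \<otimes>\<^bsub>P\<^esub> g) p = \<zero>"
      using P_mult_val[OF supp_X[OF p], of f g] by (simp only: R.finsum_empty)
    then show False using p by (simp add: free_supp_def)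
  qed
qed

lemma P_mult_closed:
  assumes fg: "f \<in> carrier P" "g \<in> carrier P"
  shows "f \<otimes>\<^bsub>P\<^esub> g \<in> carrier P"
proof -
  have "finite (supp (f \<otimes>\<^bsub>P\<^esub> g))"
    using P_mult_supp by (rule finite_subset) (use fg finite_supp in auto)
  moreover have "(f \<otimes>\<^bsub>P\<^esub> g) p \<in> carrier F" if "p \<in> X" for p
    unfolding P_mult_val[OF that] using fg
    by (intro R.finsum_closed) auto
  moreover have "f \<otimes>\<^bsub>P\<^esub> g \<in> extensional X" by (simp add: free_algebra_def)
  ultimately show ?thesis by (auto simp: P_carrier PiE_def)
qed

lemma P_one: "\<one>\<^bsub>P\<^esub> = d (\<one>\<^bsub>A\<^esub>, \<one>\<^bsub>B\<^esub>)"
  by (simp add: free_algebra_def)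

definition extension where
  "extension f = (\<Oplus>\<^bsub>S\<^esub>p\<in>supp f. f p \<odot>\<^bsub>S\<^esub> \<phi> p)"

text \<open>The support of a sum, a multiple or a product is only bounded from above, so
  \<open>extension\<close> has to be computable over any finite set that contains the
  support.\<close>

lemma extension_superset:
  assumes f: "f \<in> carrier P" and U: "finite U" "supp f \<subseteq> U" "U \<subseteq> X"
  shows "extension f = (\<Oplus>\<^bsub>S\<^esub>p\<in>U. f p \<odot>\<^bsub>S\<^esub> \<phi> p)"
  unfolding extension_def
proof (rule M.add.finprod_mono_neutral_cong_left[OF U(1,2)])
  fix p assume "p \<in> U - supp f"
  then have "p \<in> X" "f p = \<zero>" using U supp_zero[of p f] by auto
  then show "f p \<odot>\<^bsub>S\<^esub> \<phi> p = \<zero>\<^bsub>S\<^esub>" by simp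
qed (use f U P_val in \<open>auto intro!: smult_closed\<close>)

lemma extension_closed: "f \<in> carrier P \<Longrightarrow> extension f \<in> carrier S"
  unfolding extension_def using P_val[of f] supp_subset[of f]
  by (intro M.finsum_closed) (auto intro!: smult_closed)

lemma extension_add:
  assumes fg: "f \<in> carrier P" "g \<in> carrier P"
  shows "extension (f \<oplus>\<^bsub>P\<^esub> g) = extension f \<oplus>\<^bsub>S\<^esub> extension g"
proof -
  define U where "U = supp f \<union> supp g"
  have U: "finite U" "U \<subseteq> X" using fg finite_supp supp_subset by (auto simp: U_def)
  have "extension (f \<oplus>\<^bsub>P\<^esub> g) = (\<Oplus>\<^bsub>S\<^esub>p\<in>U. (f \<oplus>\<^bsub>P\<^esub> g) p \<odot>\<^bsub>S\<^esub> \<phi> p)"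
    by (rule extension_superset) (use fg U in \<open>auto simp: U_def free_supp_def P_add_closed, auto simp: P_add\<close>)
  also have "\<dots> = (\<Oplus>\<^bsub>S\<^esub>p\<in>U. f p \<odot>\<^bsub>S\<^esub> \<phi> p \<oplus>\<^bsub>S\<^esub> g p \<odot>\<^bsub>S\<^esub> \<phi> p)"
  proof (rule M.add.finprod_cong'[OF refl])
    fix p assume "p \<in> U"
    then have "p \<in> X" using U by auto
    then show "(f \<oplus>\<^bsub>P\<^esub> g) p \<odot>\<^bsub>S\<^esub> \<phi> p = f p \<odot>\<^bsub>S\<^esub> \<phi> p \<oplus>\<^bsub>S\<^esub> g p \<odot>\<^bsub>S\<^esub> \<phi> p"
      using fg P_val \<phi>_X by (simp add: P_add smult_l_distr del: mem_Sigma_iff)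
  qed (use fg U P_val in \<open>auto intro!: smult_closed M.a_closed\<close>)
  also have "\<dots> = (\<Oplus>\<^bsub>S\<^esub>p\<in>U. f p \<odot>\<^bsub>S\<^esub> \<phi> p) \<oplus>\<^bsub>S\<^esub> (\<Oplus>\<^bsub>S\<^esub>p\<in>U. g p \<odot>\<^bsub>S\<^esub> \<phi> p)"
    by (rule M.finsum_addf) (use fg U P_val in \<open>auto intro!: smult_closed\<close>)
  also have "\<dots> = extension f \<oplus>\<^bsub>S\<^esub> extension g"
    using fg U extension_superset[of f U] extension_superset[of g U] by (simp add: U_def)
  finally show ?thesis .
qed

lemma extension_smult:
  assumes r: "r \<in> carrier F" and f: "f \<in> carrier P"
  shows "extension (r \<odot>\<^bsub>P\<^esub> f) = r \<odot>\<^bsub>S\<^esub> extension f"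
proof -
  have "extension (r \<odot>\<^bsub>P\<^esub> f) = (\<Oplus>\<^bsub>S\<^esub>p\<in>supp f. (r \<odot>\<^bsub>P\<^esub> f) p \<odot>\<^bsub>S\<^esub> \<phi> p)"
    by (rule extension_superset)
       (use r f finite_supp supp_subset in \<open>auto simp: free_supp_def P_smult_closed, auto simp: P_smult\<close>)
  also have "\<dots> = (\<Oplus>\<^bsub>S\<^esub>p\<in>supp f. r \<odot>\<^bsub>S\<^esub> (f p \<odot>\<^bsub>S\<^esub> \<phi> p))"
  proof (rule M.add.finprod_cong'[OF refl])
    fix p assume "p \<in> supp f"
    then have "p \<in> X" using supp_subset by auto
    then show "(r \<odot>\<^bsub>P\<^esub> f) p \<odot>\<^bsub>S\<^esub> \<phi> p = r \<odot>\<^bsub>S\<^esub> (f p \<odot>\<^bsub>S\<^esub> \<phi> p)"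
      using r f P_val \<phi>_X by (simp add: P_smult smult_assoc1 del: mem_Sigma_iff)
  qed (use r f in auto)
  also have "\<dots> = r \<odot>\<^bsub>S\<^esub> extension f"
    unfolding extension_def
    by (rule finsum_smult_ldistr[symmetric]) (use r f finite_supp in auto)
  finally show ?thesis .
qed

lemma extension_single: "p \<in> X \<Longrightarrow> extension (d p) = \<phi> p"
proof -
  assume p: "p \<in> X"
  have "extension (d p) = (\<Oplus>\<^bsub>S\<^esub>q\<in>{p}. d p q \<odot>\<^bsub>S\<^esub> \<phi> q)"
    by (rule extension_superset[OF d_closed])
       (use p in \<open>auto simp: free_supp_def free_single_def split: if_splits\<close>)
  also have "\<dots> = \<phi> p" using p \<phi>_X by (simp add: free_single_def del: mem_Sigma_iff)
  finally show ?thesis .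
qed

text \<open>Each coefficient of the product is a sum over a fibre of \<open>product\<close>.
  \<open>finsum_fibres\<close> merges these into one sum over pairs from the two supports; it splits
  into a double sum, and multiplicativity of \<open>\<phi>\<close> factors each term.\<close>

lemma extension_mult:
  assumes fg: "f \<in> carrier P" "g \<in> carrier P"
  shows "extension (f \<otimes>\<^bsub>P\<^esub> g) = extension f \<otimes>\<^bsub>S\<^esub> extension g"
proof -
  let ?T = "supp f \<times> supp g"
  define h where "h s = f (fst s) \<otimes> g (snd s)" for s
  have T: "finite ?T" "?T \<subseteq> X \<times> X" using fg finite_supp supp_subset by auto
  have h: "h s \<in> carrier F" "product s \<in> X" if "s \<in> ?T" for s
    using that fg by (auto simp: h_def dest!: supp_X intro!: product_closed)
  have "extension (f \<otimes>\<^bsub>P\<^esub> g) = (\<Oplus>\<^bsub>S\<^esub>p\<in>product ` ?T. (f \<otimes>\<^bsub>P\<^esub> g) p \<odot>\<^bsub>S\<^esub> \<phi> p)"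
    by (rule extension_superset[OF P_mult_closed[OF fg] _ P_mult_supp]) (use T h(2) in blast)+
  also have "\<dots> = (\<Oplus>\<^bsub>S\<^esub>p\<in>product ` ?T. \<Oplus>\<^bsub>S\<^esub>s\<in>{s \<in> ?T. product s = p}. h s \<odot>\<^bsub>S\<^esub> \<phi> (product s))"
  proof (rule M.add.finprod_cong'[OF refl])
    fix p assume "p \<in> product ` ?T"
    then have p: "p \<in> X" using h(2) by blast
    have "(f \<otimes>\<^bsub>P\<^esub> g) p \<odot>\<^bsub>S\<^esub> \<phi> p = (\<Oplus>s\<in>{s \<in> ?T. product s = p}. h s) \<odot>\<^bsub>S\<^esub> \<phi> p"
      by (simp add: P_mult_val[OF p] h_def)
    also have "\<dots> = (\<Oplus>\<^bsub>S\<^esub>s\<in>{s \<in> ?T. product s = p}. h s \<odot>\<^bsub>S\<^esub> \<phi> p)"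
      by (rule finsum_smult_rdistr) (use T(1) h(1) p in auto)
    also have "\<dots> = (\<Oplus>\<^bsub>S\<^esub>s\<in>{s \<in> ?T. product s = p}. h s \<odot>\<^bsub>S\<^esub> \<phi> (product s))"
      by (rule M.add.finprod_cong'[OF refl]) (use h \<phi>_X in \<open>auto intro!: smult_closed\<close>)
    finally show "(f \<otimes>\<^bsub>P\<^esub> g) p \<odot>\<^bsub>S\<^esub> \<phi> p = (\<Oplus>\<^bsub>S\<^esub>s\<in>{s \<in> ?T. product s = p}. h s \<odot>\<^bsub>S\<^esub> \<phi> (product s))" .
  qed (use h \<phi>_X in \<open>auto intro!: M.finsum_closed smult_closed\<close>)
  also have "\<dots> = (\<Oplus>\<^bsub>S\<^esub>s\<in>?T. h s \<odot>\<^bsub>S\<^esub> \<phi> (product s))"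
    by (rule M.finsum_fibres[symmetric]) (use T(1) h \<phi>_X in \<open>auto intro!: smult_closed\<close>)
  also have "\<dots> = (\<Oplus>\<^bsub>S\<^esub>q\<in>supp f. \<Oplus>\<^bsub>S\<^esub>r\<in>supp g. h (q, r) \<odot>\<^bsub>S\<^esub> \<phi> (product (q, r)))"
    by (rule M.finsum_Times) (use fg finite_supp h \<phi>_X in \<open>auto intro!: smult_closed\<close>)
  also have "\<dots> = (\<Oplus>\<^bsub>S\<^esub>q\<in>supp f. (f q \<odot>\<^bsub>S\<^esub> \<phi> q) \<otimes>\<^bsub>S\<^esub> extension g)"
  proof (rule M.add.finprod_cong'[OF refl])
    fix q assume "q \<in> supp f"
    then have q: "q \<in> X" "f q \<in> carrier F" "\<phi> q \<in> carrier S" using supp_subset P_val fg \<phi>_X by auto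
    have "(\<Oplus>\<^bsub>S\<^esub>r\<in>supp g. h (q, r) \<odot>\<^bsub>S\<^esub> \<phi> (product (q, r))) =
        (\<Oplus>\<^bsub>S\<^esub>r\<in>supp g. (f q \<odot>\<^bsub>S\<^esub> \<phi> q) \<otimes>\<^bsub>S\<^esub> (g r \<odot>\<^bsub>S\<^esub> \<phi> r))"
    proof (rule M.add.finprod_cong'[OF refl])
      fix r assume "r \<in> supp g"
      then have r: "r \<in> X" "g r \<in> carrier F" "\<phi> r \<in> carrier S" using supp_subset P_val fg \<phi>_X by auto
      have "\<phi> (product (q, r)) = \<phi> q \<otimes>\<^bsub>S\<^esub> \<phi> r"
        using q r by (auto simp: product_def \<phi>_mult)
      then show "h (q, r) \<odot>\<^bsub>S\<^esub> \<phi> (product (q, r)) = (f q \<odot>\<^bsub>S\<^esub> \<phi> q) \<otimes>\<^bsub>S\<^esub> (g r \<odot>\<^bsub>S\<^esub> \<phi> r)"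
        using q r by (simp add: h_def smult_left smult_right R.m_comm[of "f q" "g r"] smult_assoc1 del: mem_Sigma_iff)
    next
      show "(\<lambda>r. (f q \<odot>\<^bsub>S\<^esub> \<phi> q) \<otimes>\<^bsub>S\<^esub> (g r \<odot>\<^bsub>S\<^esub> \<phi> r)) \<in> supp g \<rightarrow> carrier S"
        using q P_val[OF fg(2)] supp_subset[of g] by (auto intro!: mult_closed smult_closed)
    qed
    also have "\<dots> = (f q \<odot>\<^bsub>S\<^esub> \<phi> q) \<otimes>\<^bsub>S\<^esub> extension g"
      unfolding extension_def
      by (rule finsum_mult_right[symmetric])
         (use q fg finite_supp P_val supp_subset in \<open>auto intro!: smult_closed\<close>)
    finally show "(\<Oplus>\<^bsub>S\<^esub>r\<in>supp g. h (q, r) \<odot>\<^bsub>S\<^esub> \<phi> (product (q, r))) = (f q \<odot>\<^bsub>S\<^esub> \<phi> q) \<otimes>\<^bsub>S\<^esub> extension g" .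
  next
    show "(\<lambda>q. (f q \<odot>\<^bsub>S\<^esub> \<phi> q) \<otimes>\<^bsub>S\<^esub> extension g) \<in> supp f \<rightarrow> carrier S"
      using fg extension_closed P_val[OF fg(1)] supp_subset[of f] by (auto intro!: mult_closed smult_closed)
  qed
  also have "\<dots> = extension f \<otimes>\<^bsub>S\<^esub> extension g"
    unfolding extension_def[of f]
    by (rule finsum_mult_left[symmetric])
       (use fg finite_supp extension_closed P_val supp_subset in \<open>auto intro!: smult_closed\<close>)
  finally show ?thesis .
qed

lemma extension_minus:
  assumes "f \<in> carrier P" "g \<in> carrier P"
  shows "extension (f \<ominus>\<^bsub>P\<^esub> g) = extension f \<ominus>\<^bsub>S\<^esub> extension g"
proof -
  have "extension (\<ominus>\<^bsub>P\<^esub> g) = \<ominus>\<^bsub>S\<^esub> extension g"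
    using assms extension_smult[of "\<ominus> \<one>" g] P.smult_l_minus[of \<one> g] smult_l_minus[of \<one> "extension g"]
      extension_closed by simp
  then show ?thesis using assms by (simp add: P.M.minus_eq M.minus_eq extension_add)
qed

lemma extension_one: "extension \<one>\<^bsub>P\<^esub> = \<one>\<^bsub>S\<^esub>"
  by (simp add: P_one extension_single A_closed B_closed \<phi>_one)

abbreviation K where "K \<equiv> tensor_kernel F A B"

lemma extension_kernel_submodule: "submodule {f \<in> carrier P. extension f = \<zero>\<^bsub>S\<^esub>} F P"
proof -
  have "extension \<zero>\<^bsub>P\<^esub> = \<zero>\<^bsub>S\<^esub>"
    using extension_smult[of "\<zero>" "\<zero>\<^bsub>P\<^esub>"] by (simp add: extension_closed)
  moreover from this have "extension (\<ominus>\<^bsub>P\<^esub> f) = \<ominus>\<^bsub>S\<^esub> extension f" if "f \<in> carrier P" for f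
    using extension_minus[of "\<zero>\<^bsub>P\<^esub>" f] that by (simp add: P.M.minus_eq M.minus_eq extension_closed)
  ultimately show ?thesis
    by (intro P.submoduleI) (auto simp: extension_add extension_smult)
qed

lemma tensor_relations_kernel: "tensor_relations F A B \<subseteq> {f \<in> carrier P. extension f = \<zero>\<^bsub>S\<^esub>}"
  unfolding tensor_relations_def Let_def
  by (auto simp: d_closed extension_minus extension_add extension_smult extension_single
      A_closed B_closed \<phi>_closed \<phi>_add_left \<phi>_add_right \<phi>_smult_left \<phi>_smult_right M.minus_eq_zero_iff)

text \<open>The kernel of \<open>extension\<close> is one of the submodules whose intersection is
  the tensor kernel.\<close>

lemma K_subset: "K \<subseteq> {f \<in> carrier P. extension f = \<zero>\<^bsub>S\<^esub>}"
  unfolding tensor_kernel_def using extension_kernel_submodule tensor_relations_kernel by blast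

text \<open>Under the hypotheses \<open>K\<close> is the whole kernel, so its cosets are the fibres
  of \<open>extension\<close>. Sending s to its fibre, from \<open>S\<close> to the tensor algebra,
  avoids any question of independence of representatives: the coset product and the scalar multiple
  are unions over representatives in which every member is the same fibre.\<close>

lemma tensor_isomorphic:
  assumes surj: "\<And>s. s \<in> carrier S \<Longrightarrow> \<exists>f\<in>carrier P. extension f = s"
    and ker: "\<And>f. f \<in> carrier P \<Longrightarrow> extension f = \<zero>\<^bsub>S\<^esub> \<Longrightarrow> f \<in> K"
  shows "algebra_isomorphic F S (tensor_algebra F A B)"
proof -
  define fibre where "fibre s = {f \<in> carrier P. extension f = s}" for s
  have K: "K = {f \<in> carrier P. extension f = \<zero>\<^bsub>S\<^esub>}" using K_subset ker by blast
  have coset: "K +>\<^bsub>P\<^esub> f = fibre (extension f)" if f: "f \<in> carrier P" for f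
  proof
    show "K +>\<^bsub>P\<^esub> f \<subseteq> fibre (extension f)"
      using f by (auto simp: a_r_coset_def' K fibre_def extension_add extension_closed)
    show "fibre (extension f) \<subseteq> K +>\<^bsub>P\<^esub> f"
    proof
      fix g assume g: "g \<in> fibre (extension f)"
      then have [simp]: "g \<in> carrier P" by (simp add: fibre_def)
      have "g = (g \<ominus>\<^bsub>P\<^esub> f) \<oplus>\<^bsub>P\<^esub> f" using f by (simp add: P.M.minus_eq P.M.a_assoc P.M.l_neg)
      moreover have "g \<ominus>\<^bsub>P\<^esub> f \<in> K"
        using f g by (simp add: K extension_minus fibre_def M.minus_eq_zero_iff extension_closed)
      ultimately show "g \<in> K +>\<^bsub>P\<^esub> f" unfolding a_r_coset_def' by blast
    qed
  qed
  have fibre_ne: "\<exists>f. f \<in> fibre s" if "s \<in> carrier S" for s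
    using surj[OF that] by (auto simp: fibre_def)
  have fibreD: "f \<in> carrier P" "extension f = s" if "f \<in> fibre s" for f s
    using that by (auto simp: fibre_def)
  let ?T = "tensor_algebra F A B"
  have carrier: "carrier ?T = fibre ` carrier S"
  proof -
    have "carrier ?T = (\<lambda>f. fibre (extension f)) ` carrier P"
      using coset by (auto simp: tensor_algebra_def Let_def A_RCOSETS_def')
    also have "\<dots> = fibre ` extension ` carrier P" by (simp add: image_image)
    also have "extension ` carrier P = carrier S" using surj extension_closed by blast
    finally show ?thesis .
  qed
  have "fibre \<in> ring_iso S ?T"
  proof (rule ring_iso_memI)
    fix s t assume s: "s \<in> carrier S" and t: "t \<in> carrier S"
    obtain f g where f: "f \<in> fibre s" and g: "g \<in> fibre t" using s t fibre_ne by blast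
    have "fibre s \<otimes>\<^bsub>?T\<^esub> fibre t = (\<Union>f\<in>fibre s. \<Union>g\<in>fibre t. K +>\<^bsub>P\<^esub> (f \<otimes>\<^bsub>P\<^esub> g))"
      by (simp add: tensor_algebra_def Let_def rcoset_mult_def)
    also have "\<dots> = (\<Union>f\<in>fibre s. \<Union>g\<in>fibre t. fibre (s \<otimes>\<^bsub>S\<^esub> t))"
      by (intro SUP_cong refl) (simp add: fibreD coset P_mult_closed extension_mult)
    also have "\<dots> = fibre (s \<otimes>\<^bsub>S\<^esub> t)" using f g by blast
    finally show "fibre (s \<otimes>\<^bsub>S\<^esub> t) = fibre s \<otimes>\<^bsub>?T\<^esub> fibre t" by simp
    have "fibre s \<oplus>\<^bsub>?T\<^esub> fibre t = (\<Union>f\<in>fibre s. \<Union>g\<in>fibre t. {f \<oplus>\<^bsub>P\<^esub> g})"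
      by (simp add: tensor_algebra_def Let_def set_add_def')
    also have "\<dots> = fibre (s \<oplus>\<^bsub>S\<^esub> t)"
    proof
      show "(\<Union>f\<in>fibre s. \<Union>g\<in>fibre t. {f \<oplus>\<^bsub>P\<^esub> g}) \<subseteq> fibre (s \<oplus>\<^bsub>S\<^esub> t)"
        by (auto simp: fibre_def extension_add)
      \<comment> \<open>With one f over s fixed, every element over the sum is f plus its difference
        from f, and that difference lies over t.\<close>
      show "fibre (s \<oplus>\<^bsub>S\<^esub> t) \<subseteq> (\<Union>f\<in>fibre s. \<Union>g\<in>fibre t. {f \<oplus>\<^bsub>P\<^esub> g})"
      proof
        fix h assume h: "h \<in> fibre (s \<oplus>\<^bsub>S\<^esub> t)"
        have [simp]: "f \<in> carrier P" "h \<in> carrier P" using fibreD f h by auto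
        have "h \<ominus>\<^bsub>P\<^esub> f \<in> fibre t"
          using s t fibreD(2)[OF f] fibreD(2)[OF h]
          by (simp add: fibre_def extension_minus M.minus_eq M.a_comm[of s t] M.a_assoc M.r_neg)
        moreover have "h = f \<oplus>\<^bsub>P\<^esub> (h \<ominus>\<^bsub>P\<^esub> f)"
          by (simp add: P.M.minus_eq P.M.a_lcomm[of f h] P.M.r_neg)
        ultimately show "h \<in> (\<Union>f\<in>fibre s. \<Union>g\<in>fibre t. {f \<oplus>\<^bsub>P\<^esub> g})" using f by blast
      qed
    qed
    finally show "fibre (s \<oplus>\<^bsub>S\<^esub> t) = fibre s \<oplus>\<^bsub>?T\<^esub> fibre t" by simp
  next
    show "fibre \<one>\<^bsub>S\<^esub> = \<one>\<^bsub>?T\<^esub>"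
      by (simp add: tensor_algebra_def Let_def P_one coset d_closed extension_one[unfolded P_one])
  next
    show "bij_betw fibre (carrier S) (carrier ?T)"
      unfolding bij_betw_def carrier
    proof (intro conjI inj_onI refl)
      fix s t assume "s \<in> carrier S" "fibre s = fibre t"
      then show "s = t" using fibre_ne[of s] fibreD(2) by metis
    qed
  qed (simp add: carrier)
  moreover have "fibre (r \<odot>\<^bsub>S\<^esub> s) = r \<odot>\<^bsub>?T\<^esub> fibre s" if r: "r \<in> carrier F" and s: "s \<in> carrier S" for r s
  proof -
    have "r \<odot>\<^bsub>?T\<^esub> fibre s = (\<Union>f\<in>fibre s. K +>\<^bsub>P\<^esub> (r \<odot>\<^bsub>P\<^esub> f))"
      by (simp add: tensor_algebra_def Let_def)
    also have "\<dots> = (\<Union>f\<in>fibre s. fibre (r \<odot>\<^bsub>S\<^esub> s))"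
      by (intro SUP_cong refl) (simp add: fibreD coset r extension_smult)
    also have "\<dots> = fibre (r \<odot>\<^bsub>S\<^esub> s)" using fibre_ne[OF s] by blast
    finally show ?thesis by simp
  qed
  ultimately show ?thesis unfolding algebra_isomorphic_def by blast
qed

end

section \<open>Congruence modulo the tensor relations\<close>

context tensor_map
begin

lemma extension_finsum:
  assumes "finite J" "f \<in> J \<rightarrow> carrier P"
  shows "extension (\<Oplus>\<^bsub>P\<^esub>j\<in>J. f j) = (\<Oplus>\<^bsub>S\<^esub>j\<in>J. extension (f j))"
  using assms
proof (induction J)
  case empty
  have "extension \<zero>\<^bsub>P\<^esub> = \<zero>\<^bsub>S\<^esub>"
    using extension_smult[of "\<zero>" "\<zero>\<^bsub>P\<^esub>"] by (simp add: extension_closed)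
  then show ?case by simp
next
  case (insert j J)
  then have "f j \<in> carrier P" "f \<in> J \<rightarrow> carrier P" by auto
  moreover from this have "(\<lambda>j. extension (f j)) \<in> J \<rightarrow> carrier S" by (auto intro: extension_closed)
  ultimately show ?case using insert by (simp add: extension_add extension_closed)
qed

text \<open>The intersection lies in the carrier because its family is inhabited, by the kernel of
  \<open>extension\<close>. The other closure properties pass from the members to the
  intersection.\<close>

lemma tensor_kernel_submodule: "submodule K F P"
proof (rule P.submoduleI)
  note H = P.submoduleE subgroup.one_closed[OF submodule.axioms(1)]
  show "K \<subseteq> carrier P" using K_subset by auto
  show "\<zero>\<^bsub>P\<^esub> \<in> K" unfolding tensor_kernel_def using H(7) by fastforce
  show "\<ominus>\<^bsub>P\<^esub> f \<in> K" if "f \<in> K" for f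
    using that unfolding tensor_kernel_def by (auto intro: H(3))
  show "f \<oplus>\<^bsub>P\<^esub> g \<in> K" if "f \<in> K" "g \<in> K" for f g
    using that unfolding tensor_kernel_def by (auto intro: H(5))
  show "r \<odot>\<^bsub>P\<^esub> f \<in> K" if "r \<in> carrier F" "f \<in> K" for r f
    using that unfolding tensor_kernel_def by (auto intro: H(4))
qed

lemma tensor_relations_K: "tensor_relations F A B \<subseteq> K"
  unfolding tensor_kernel_def by blast

text \<open>This is equality in the tensor product, kept on representatives so that calculations
  stay in the free module.\<close>

definition congr (infix \<open>\<approx>\<close> 50) where
  "f \<approx> g \<longleftrightarrow> f \<in> carrier P \<and> g \<in> carrier P \<and> f \<ominus>\<^bsub>P\<^esub> g \<in> K"

lemma congr_closed: "f \<approx> g \<Longrightarrow> f \<in> carrier P" "f \<approx> g \<Longrightarrow> g \<in> carrier P"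
  by (auto simp: congr_def)

lemma K_zero: "\<zero>\<^bsub>P\<^esub> \<in> K"
  using subgroup.one_closed[OF submodule.axioms(1)[OF tensor_kernel_submodule]] by simp

lemma congr_refl: "f \<in> carrier P \<Longrightarrow> f \<approx> f"
  by (simp add: congr_def P.M.minus_eq P.M.r_neg K_zero)

lemma congr_sym: "f \<approx> g \<Longrightarrow> g \<approx> f"
proof -
  assume fg: "f \<approx> g"
  then have "\<ominus>\<^bsub>P\<^esub> (f \<ominus>\<^bsub>P\<^esub> g) \<in> K"
    using P.submoduleE(3)[OF tensor_kernel_submodule] by (auto simp: congr_def)
  moreover have "\<ominus>\<^bsub>P\<^esub> (f \<ominus>\<^bsub>P\<^esub> g) = g \<ominus>\<^bsub>P\<^esub> f"
    using congr_closed[OF fg] by (simp add: P.M.minus_eq P.M.minus_add P.M.a_comm)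
  ultimately show ?thesis using fg by (simp add: congr_def)
qed

lemma congr_add: "f \<approx> g \<Longrightarrow> f' \<approx> g' \<Longrightarrow> f \<oplus>\<^bsub>P\<^esub> f' \<approx> g \<oplus>\<^bsub>P\<^esub> g'"
proof -
  assume fg: "f \<approx> g" "f' \<approx> g'"
  note [simp] = congr_closed[OF fg(1)] congr_closed[OF fg(2)]
  have "(f \<ominus>\<^bsub>P\<^esub> g) \<oplus>\<^bsub>P\<^esub> (f' \<ominus>\<^bsub>P\<^esub> g') \<in> K"
    using fg P.submoduleE(5)[OF tensor_kernel_submodule] by (auto simp: congr_def)
  moreover have "(f \<ominus>\<^bsub>P\<^esub> g) \<oplus>\<^bsub>P\<^esub> (f' \<ominus>\<^bsub>P\<^esub> g') = (f \<oplus>\<^bsub>P\<^esub> f') \<ominus>\<^bsub>P\<^esub> (g \<oplus>\<^bsub>P\<^esub> g')"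
    by (simp add: P.M.minus_eq P.M.minus_add P.M.a_ac)
  ultimately show ?thesis by (simp add: congr_def)
qed

lemma congr_smult: "r \<in> carrier F \<Longrightarrow> f \<approx> g \<Longrightarrow> r \<odot>\<^bsub>P\<^esub> f \<approx> r \<odot>\<^bsub>P\<^esub> g"
proof -
  assume r: "r \<in> carrier F" and fg: "f \<approx> g"
  note [simp] = congr_closed[OF fg]
  have "r \<odot>\<^bsub>P\<^esub> (f \<ominus>\<^bsub>P\<^esub> g) \<in> K"
    using r fg P.submoduleE(4)[OF tensor_kernel_submodule] by (auto simp: congr_def)
  moreover have "r \<odot>\<^bsub>P\<^esub> (f \<ominus>\<^bsub>P\<^esub> g) = r \<odot>\<^bsub>P\<^esub> f \<ominus>\<^bsub>P\<^esub> r \<odot>\<^bsub>P\<^esub> g"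
    using r by (simp add: P.M.minus_eq P.smult_r_distr P.smult_r_minus)
  ultimately show ?thesis using r by (simp add: congr_def)
qed

lemma congr_trans [trans]: "f \<approx> g \<Longrightarrow> g \<approx> h \<Longrightarrow> f \<approx> h"
proof -
  assume fg: "f \<approx> g" and gh: "g \<approx> h"
  note [simp] = congr_closed[OF fg] congr_closed[OF gh]
  have "(f \<ominus>\<^bsub>P\<^esub> g) \<oplus>\<^bsub>P\<^esub> (g \<ominus>\<^bsub>P\<^esub> h) \<in> K"
    using fg gh P.submoduleE(5)[OF tensor_kernel_submodule] by (auto simp: congr_def)
  moreover have "(f \<ominus>\<^bsub>P\<^esub> g) \<oplus>\<^bsub>P\<^esub> (g \<ominus>\<^bsub>P\<^esub> h) = f \<oplus>\<^bsub>P\<^esub> ((\<ominus>\<^bsub>P\<^esub> g \<oplus>\<^bsub>P\<^esub> g) \<oplus>\<^bsub>P\<^esub> \<ominus>\<^bsub>P\<^esub> h)"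
    by (simp add: P.M.minus_eq P.M.a_assoc del: P.M.l_neg)
  moreover have "\<dots> = f \<ominus>\<^bsub>P\<^esub> h"
    by (simp add: P.M.minus_eq P.M.l_neg)
  ultimately show ?thesis by (simp add: congr_def)
qed

lemma congr_finsum:
  assumes "finite J" "\<And>j. j \<in> J \<Longrightarrow> f j \<approx> g j"
  shows "(\<Oplus>\<^bsub>P\<^esub>j\<in>J. f j) \<approx> (\<Oplus>\<^bsub>P\<^esub>j\<in>J. g j)"
  using assms
proof (induction J)
  case (insert j J)
  then have "f \<in> J \<rightarrow> carrier P" "f j \<in> carrier P" "g \<in> J \<rightarrow> carrier P" "g j \<in> carrier P"
    by (auto dest: congr_closed)
  then show ?case using insert by (simp add: congr_add)
qed (simp add: congr_refl)

lemma congr_add_left: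
  assumes "a \<in> carrier A" "a' \<in> carrier A" "b \<in> carrier B"
  shows "d (a \<oplus>\<^bsub>A\<^esub> a', b) \<approx> d (a, b) \<oplus>\<^bsub>P\<^esub> d (a', b)"
proof -
  have "d (a \<oplus>\<^bsub>A\<^esub> a', b) \<ominus>\<^bsub>P\<^esub> (d (a, b) \<oplus>\<^bsub>P\<^esub> d (a', b)) \<in> tensor_relations F A B"
    using assms unfolding tensor_relations_def Let_def by blast
  then show ?thesis
    using assms tensor_relations_K by (auto simp: congr_def d_closed)
qed

lemma congr_add_right:
  assumes "a \<in> carrier A" "b \<in> carrier B" "b' \<in> carrier B"
  shows "d (a, b \<oplus>\<^bsub>B\<^esub> b') \<approx> d (a, b) \<oplus>\<^bsub>P\<^esub> d (a, b')"
proof -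
  have "d (a, b \<oplus>\<^bsub>B\<^esub> b') \<ominus>\<^bsub>P\<^esub> (d (a, b) \<oplus>\<^bsub>P\<^esub> d (a, b')) \<in> tensor_relations F A B"
    using assms unfolding tensor_relations_def Let_def by blast
  then show ?thesis
    using assms tensor_relations_K by (auto simp: congr_def d_closed)
qed

lemma congr_smult_left:
  assumes "r \<in> carrier F" "a \<in> carrier A" "b \<in> carrier B"
  shows "d (r \<odot>\<^bsub>A\<^esub> a, b) \<approx> r \<odot>\<^bsub>P\<^esub> d (a, b)"
proof -
  have "d (r \<odot>\<^bsub>A\<^esub> a, b) \<ominus>\<^bsub>P\<^esub> r \<odot>\<^bsub>P\<^esub> d (a, b) \<in> tensor_relations F A B"
    using assms unfolding tensor_relations_def Let_def by blast
  then show ?thesis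
    using assms tensor_relations_K by (auto simp: congr_def d_closed)
qed

lemma congr_smult_right:
  assumes "r \<in> carrier F" "a \<in> carrier A" "b \<in> carrier B"
  shows "d (a, r \<odot>\<^bsub>B\<^esub> b) \<approx> r \<odot>\<^bsub>P\<^esub> d (a, b)"
proof -
  have "d (a, r \<odot>\<^bsub>B\<^esub> b) \<ominus>\<^bsub>P\<^esub> r \<odot>\<^bsub>P\<^esub> d (a, b) \<in> tensor_relations F A B"
    using assms unfolding tensor_relations_def Let_def by blast
  then show ?thesis
    using assms tensor_relations_K by (auto simp: congr_def d_closed)
qed

lemma finsum_P_val:
  assumes "finite J" "f \<in> J \<rightarrow> carrier P" "p \<in> X"
  shows "(\<Oplus>\<^bsub>P\<^esub>j\<in>J. f j) p = (\<Oplus>j\<in>J. f j p)"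
proof (rule pointwise_finsum[where I = X])
  show "carrier P \<subseteq> X \<rightarrow>\<^sub>E carrier F" by (simp add: P_carrier subset_iff)
qed (use assms in \<open>auto simp: P_add P_zero intro: P.M.abelian_group_axioms R.abelian_group_axioms\<close>)

lemma expansion:
  assumes f: "f \<in> carrier P"
  shows "f = (\<Oplus>\<^bsub>P\<^esub>p\<in>supp f. f p \<odot>\<^bsub>P\<^esub> d p)"
proof (rule P_ext)
  have closed: "(\<lambda>p. f p \<odot>\<^bsub>P\<^esub> d p) \<in> supp f \<rightarrow> carrier P"
    using f d_closed by auto
  then show "(\<Oplus>\<^bsub>P\<^esub>p\<in>supp f. f p \<odot>\<^bsub>P\<^esub> d p) \<in> carrier P" by (rule P.M.finsum_closed)
  fix q assume q: "q \<in> X"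
  have "(\<Oplus>\<^bsub>P\<^esub>p\<in>supp f. f p \<odot>\<^bsub>P\<^esub> d p) q = (\<Oplus>p\<in>supp f. (f p \<odot>\<^bsub>P\<^esub> d p) q)"
    by (rule finsum_P_val[OF finite_supp[OF f] closed q])
  also have "\<dots> = f q"
  proof (cases "q \<in> supp f")
    case True
    have "(\<Oplus>p\<in>supp f. (f p \<odot>\<^bsub>P\<^esub> d p) q) = (f q \<odot>\<^bsub>P\<^esub> d q) q"
      by (rule R.finsum_single) (use True q f finite_supp d_closed in \<open>auto simp: P_smult free_single_def\<close>)
    then show ?thesis using True f q by (simp add: P_smult free_single_def del: mem_Sigma_iff)
  next
    case False
    have "(f p \<odot>\<^bsub>P\<^esub> d p) q = \<zero>" if "p \<in> supp f" for p
      using that False f q by (auto simp: P_smult free_single_def)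
    then have "(\<Oplus>p\<in>supp f. (f p \<odot>\<^bsub>P\<^esub> d p) q) = \<zero>"
      by (rule R.add.finprod_one_eqI)
    then show ?thesis using supp_zero[OF q False] by simp
  qed
  finally show "f q = (\<Oplus>\<^bsub>P\<^esub>p\<in>supp f. f p \<odot>\<^bsub>P\<^esub> d p) q" by simp
qed (rule f)

text \<open>Injectivity of the induced map is the hard half, since \<open>tensor_kernel\<close> is
  given by generators only. A section that is linear modulo \<open>K\<close> and compatible with
  \<open>\<phi>\<close> settles it: every f is congruent to \<open>\<sigma> (extension f)\<close>,
  so a vanishing extension puts f into \<open>K\<close>.\<close>

lemma section_imp_isomorphic:
  assumes \<sigma>_closed: "\<And>s. s \<in> carrier S \<Longrightarrow> \<sigma> s \<in> carrier P"
    and right_inv: "\<And>s. s \<in> carrier S \<Longrightarrow> extension (\<sigma> s) = s"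
    and \<sigma>_add: "\<And>s t. s \<in> carrier S \<Longrightarrow> t \<in> carrier S \<Longrightarrow> \<sigma> (s \<oplus>\<^bsub>S\<^esub> t) \<approx> \<sigma> s \<oplus>\<^bsub>P\<^esub> \<sigma> t"
    and \<sigma>_smult: "\<And>r s. r \<in> carrier F \<Longrightarrow> s \<in> carrier S \<Longrightarrow> \<sigma> (r \<odot>\<^bsub>S\<^esub> s) \<approx> r \<odot>\<^bsub>P\<^esub> \<sigma> s"
    and \<sigma>_\<phi>: "\<And>a b. a \<in> carrier A \<Longrightarrow> b \<in> carrier B \<Longrightarrow> d (a, b) \<approx> \<sigma> (\<phi> (a, b))"
  shows "algebra_isomorphic F S (tensor_algebra F A B)"
proof (rule tensor_isomorphic)
  have \<sigma>_zero: "\<sigma> \<zero>\<^bsub>S\<^esub> \<approx> \<zero>\<^bsub>P\<^esub>"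
    using \<sigma>_smult[of "\<zero>" "\<zero>\<^bsub>S\<^esub>"] by (simp add: \<sigma>_closed)
  \<comment> \<open>Stated for arbitrary finite sets of basis pairs, so that the induction can add
    one pair at a time; the expansion of f over its support is the instance wanted.\<close>
  have sum: "(\<Oplus>\<^bsub>P\<^esub>p\<in>U. f p \<odot>\<^bsub>P\<^esub> d p) \<approx> \<sigma> (extension (\<Oplus>\<^bsub>P\<^esub>p\<in>U. f p \<odot>\<^bsub>P\<^esub> d p))"
    if "finite U" "U \<subseteq> X" "f \<in> U \<rightarrow> carrier F" for U f
    using that
  proof (induction U)
    case empty
    have "extension \<zero>\<^bsub>P\<^esub> = \<zero>\<^bsub>S\<^esub>" using extension_finsum[of "{}"] by simp
    then show ?case using \<sigma>_zero by (simp add: congr_sym)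
  next
    case (insert p U)
    let ?s = "\<Oplus>\<^bsub>P\<^esub>q\<in>U. f q \<odot>\<^bsub>P\<^esub> d q"
    obtain a b where ab: "p = (a, b)" "a \<in> carrier A" "b \<in> carrier B" using insert.prems by auto
    have fp [simp]: "f p \<in> carrier F" using insert by auto
    have s: "?s \<in> carrier P" using insert d_closed by (intro P.M.finsum_closed) auto
    have eq: "(\<Oplus>\<^bsub>P\<^esub>q\<in>insert p U. f q \<odot>\<^bsub>P\<^esub> d q) = f p \<odot>\<^bsub>P\<^esub> d p \<oplus>\<^bsub>P\<^esub> ?s"
      using insert d_closed by (intro P.M.finsum_insert) auto
    have "f p \<odot>\<^bsub>P\<^esub> d p \<oplus>\<^bsub>P\<^esub> ?s \<approx> f p \<odot>\<^bsub>P\<^esub> \<sigma> (\<phi> p) \<oplus>\<^bsub>P\<^esub> \<sigma> (extension ?s)"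
      using insert ab by (intro congr_add congr_smult) (auto intro: \<sigma>_\<phi>)
    also have "f p \<odot>\<^bsub>P\<^esub> \<sigma> (\<phi> p) \<oplus>\<^bsub>P\<^esub> \<sigma> (extension ?s) \<approx> \<sigma> (f p \<odot>\<^bsub>S\<^esub> \<phi> p) \<oplus>\<^bsub>P\<^esub> \<sigma> (extension ?s)"
      using ab s fp by (intro congr_add congr_sym[OF \<sigma>_smult] congr_refl \<sigma>_closed extension_closed)
        (auto simp: \<phi>_closed)
    also have "\<sigma> (f p \<odot>\<^bsub>S\<^esub> \<phi> p) \<oplus>\<^bsub>P\<^esub> \<sigma> (extension ?s) \<approx> \<sigma> (f p \<odot>\<^bsub>S\<^esub> \<phi> p \<oplus>\<^bsub>S\<^esub> extension ?s)"
      using ab s fp by (intro congr_sym[OF \<sigma>_add] extension_closed) (auto simp: \<phi>_closed)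
    also have "f p \<odot>\<^bsub>S\<^esub> \<phi> p \<oplus>\<^bsub>S\<^esub> extension ?s = extension (f p \<odot>\<^bsub>P\<^esub> d p \<oplus>\<^bsub>P\<^esub> ?s)"
      using ab s fp by (simp add: extension_add extension_smult extension_single d_closed)
    finally show ?case by (simp only: eq)
  qed
  fix f assume f: "f \<in> carrier P" and zero: "extension f = \<zero>\<^bsub>S\<^esub>"
  have "f \<approx> \<sigma> (extension f)"
    using sum[of "supp f" f] expansion[OF f] f finite_supp supp_subset by auto
  also have "\<sigma> (extension f) \<approx> \<zero>\<^bsub>P\<^esub>" unfolding zero by (rule \<sigma>_zero)
  finally have "f \<ominus>\<^bsub>P\<^esub> \<zero>\<^bsub>P\<^esub> \<in> K" by (simp add: congr_def)
  moreover have "f \<ominus>\<^bsub>P\<^esub> \<zero>\<^bsub>P\<^esub> = f"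
    using f P.M.a_assoc[of f "\<zero>\<^bsub>P\<^esub>" "\<ominus>\<^bsub>P\<^esub> \<zero>\<^bsub>P\<^esub>"] by (simp add: P.M.minus_eq P.M.r_neg)
  ultimately show "f \<in> K" by simp
qed (use \<sigma>_closed right_inv in blast)

end

section \<open>Twisted matrices over an algebra as a tensor product\<close>

context skew_matrix_ring
begin

abbreviation N where "N \<equiv> skew_matrix_algebra F n c"

text \<open>The matrix that corresponds to the pure tensor of a and x: the entries of x are scalars,
  and they act on a.\<close>

definition scale_matrix where
  "scale_matrix = (\<lambda>(a, x). \<lambda>p\<in>{1..n} \<times> {1..n}. x p \<odot>\<^bsub>A\<^esub> a)"

definition unit where "unit p = skew_matrix_unit F n (fst p) (snd p)"

lemma N_carrier: "carrier N = {1..n} \<times> {1..n} \<rightarrow>\<^sub>E carrier F"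
  by (simp add: skew_matrix_algebra_def)

lemma N_val [simp, intro]: "x \<in> carrier N \<Longrightarrow> i \<in> {1..n} \<Longrightarrow> j \<in> {1..n} \<Longrightarrow> x (i, j) \<in> carrier F"
  by (auto simp: N_carrier)

lemma N_ext:
  "x \<in> carrier N \<Longrightarrow> y \<in> carrier N \<Longrightarrow>
    (\<And>i j. i \<in> {1..n} \<Longrightarrow> j \<in> {1..n} \<Longrightarrow> x (i, j) = y (i, j)) \<Longrightarrow> x = y"
  unfolding N_carrier by (rule PiE_ext) auto

lemma N_entry:
  assumes "i \<in> {1..n}" "j \<in> {1..n}"
  shows "(x \<otimes>\<^bsub>N\<^esub> y) (i, j) = (\<Oplus>k\<in>{1..n}. c i k j \<otimes> (x (i, k) \<otimes> y (k, j)))"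
    and "(x \<oplus>\<^bsub>N\<^esub> y) (i, j) = x (i, j) \<oplus> y (i, j)"
    and "(r \<odot>\<^bsub>N\<^esub> x) (i, j) = r \<otimes> x (i, j)"
    and "\<zero>\<^bsub>N\<^esub> (i, j) = \<zero>"
    and "\<one>\<^bsub>N\<^esub> (i, j) = (if i = j then \<one> else \<zero>)"
  using assms by (simp_all add: skew_matrix_algebra_def)

lemma N_closed:
  "\<one>\<^bsub>N\<^esub> \<in> carrier N" "\<zero>\<^bsub>N\<^esub> \<in> carrier N"
  "x \<in> carrier N \<Longrightarrow> y \<in> carrier N \<Longrightarrow> x \<otimes>\<^bsub>N\<^esub> y \<in> carrier N"
  "x \<in> carrier N \<Longrightarrow> y \<in> carrier N \<Longrightarrow> x \<oplus>\<^bsub>N\<^esub> y \<in> carrier N"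
  "r \<in> carrier F \<Longrightarrow> x \<in> carrier N \<Longrightarrow> r \<odot>\<^bsub>N\<^esub> x \<in> carrier N"
proof -
  note [simp del] = atLeastAtMost_iff One_nat_def
  show "\<one>\<^bsub>N\<^esub> \<in> carrier N" "\<zero>\<^bsub>N\<^esub> \<in> carrier N"
    "x \<in> carrier N \<Longrightarrow> y \<in> carrier N \<Longrightarrow> x \<oplus>\<^bsub>N\<^esub> y \<in> carrier N"
    "r \<in> carrier F \<Longrightarrow> x \<in> carrier N \<Longrightarrow> r \<odot>\<^bsub>N\<^esub> x \<in> carrier N"
    by (auto simp: skew_matrix_algebra_def)
  assume "x \<in> carrier N" "y \<in> carrier N"
  then have "(x \<otimes>\<^bsub>N\<^esub> y) (i, j) \<in> carrier F" if "i \<in> {1..n}" "j \<in> {1..n}" for i j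
    using that unfolding N_entry(1)[OF that] by (intro R.finsum_closed) auto
  then show "x \<otimes>\<^bsub>N\<^esub> y \<in> carrier N"
    unfolding N_carrier by (intro PiE_I) (auto simp: skew_matrix_algebra_def)
qed

lemma unit_closed: "unit p \<in> carrier N"
  by (auto simp: unit_def N_carrier skew_matrix_unit_def)

lemma unit_entry: "i \<in> {1..n} \<Longrightarrow> j \<in> {1..n} \<Longrightarrow> unit p (i, j) = (if p = (i, j) then \<one> else \<zero>)"
  by (cases p) (simp add: unit_def skew_matrix_unit_def)

lemma scale_matrix_entry:
  "i \<in> {1..n} \<Longrightarrow> j \<in> {1..n} \<Longrightarrow> scale_matrix (a, x) (i, j) = x (i, j) \<odot>\<^bsub>A\<^esub> a"
  by (simp add: scale_matrix_def)

lemma scale_matrix_closed: "a \<in> carrier A \<Longrightarrow> x \<in> carrier N \<Longrightarrow> scale_matrix (a, x) \<in> carrier S"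
  by (auto simp: scale_matrix_def S_carrier N_carrier intro!: smult_closed)

text \<open>The entries of x and x' and the coefficients are all scalars, so in each summand they
  can be pulled out of the product of a and a'.\<close>

lemma scale_matrix_mult:
  assumes a: "a \<in> carrier A" and a': "a' \<in> carrier A" and x: "x \<in> carrier N" and x': "x' \<in> carrier N"
  shows "scale_matrix (a \<otimes>\<^bsub>A\<^esub> a', x \<otimes>\<^bsub>N\<^esub> x') = scale_matrix (a, x) \<otimes>\<^bsub>S\<^esub> scale_matrix (a', x')"
proof (rule S_ext)
  note [simp del] = atLeastAtMost_iff One_nat_def
  have summand: "(c i j l \<otimes> (x (i, j) \<otimes> x' (j, l))) \<odot>\<^bsub>A\<^esub> (a \<otimes>\<^bsub>A\<^esub> a') =
      c i j l \<odot>\<^bsub>A\<^esub> (scale_matrix (a, x) (i, j) \<otimes>\<^bsub>A\<^esub> scale_matrix (a', x') (j, l))"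
    if "i \<in> {1..n}" "j \<in> {1..n}" "l \<in> {1..n}" for i j l
    using that a a' x x'
    by (simp add: scale_matrix_entry R.m_comm[of "x (i, j)"] smult_assoc1 smult_mult_left smult_mult_right)
  fix i l assume il: "i \<in> {1..n}" "l \<in> {1..n}"
  have "scale_matrix (a \<otimes>\<^bsub>A\<^esub> a', x \<otimes>\<^bsub>N\<^esub> x') (i, l) =
      (\<Oplus>j\<in>{1..n}. c i j l \<otimes> (x (i, j) \<otimes> x' (j, l))) \<odot>\<^bsub>A\<^esub> (a \<otimes>\<^bsub>A\<^esub> a')"
    using il by (simp add: scale_matrix_entry N_entry)
  also have "\<dots> = (\<Oplus>\<^bsub>A\<^esub>j\<in>{1..n}. (c i j l \<otimes> (x (i, j) \<otimes> x' (j, l))) \<odot>\<^bsub>A\<^esub> (a \<otimes>\<^bsub>A\<^esub> a'))"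
    by (rule finsum_smult_rdistr) (use il a a' x x' in auto)
  also have "\<dots> = (\<Oplus>\<^bsub>A\<^esub>j\<in>{1..n}. c i j l \<odot>\<^bsub>A\<^esub> (scale_matrix (a, x) (i, j) \<otimes>\<^bsub>A\<^esub> scale_matrix (a', x') (j, l)))"
    by (rule M.add.finprod_cong'[OF refl])
      (use il a a' x x' scale_matrix_closed in \<open>auto simp: summand intro!: S_mult_term\<close>)
  finally show "scale_matrix (a \<otimes>\<^bsub>A\<^esub> a', x \<otimes>\<^bsub>N\<^esub> x') (i, l) =
      (scale_matrix (a, x) \<otimes>\<^bsub>S\<^esub> scale_matrix (a', x')) (i, l)"
    using il by (simp add: S_mult_entry)
qed (use a a' x x' in \<open>auto intro!: S_mult_closed scale_matrix_closed N_closed\<close>)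

lemma scale_matrix_add_left:
  assumes "a \<in> carrier A" "a' \<in> carrier A" "x \<in> carrier N"
  shows "scale_matrix (a \<oplus>\<^bsub>A\<^esub> a', x) = scale_matrix (a, x) \<oplus>\<^bsub>S\<^esub> scale_matrix (a', x)"
  by (rule S_ext) (use assms in \<open>auto intro!: S_add_closed scale_matrix_closed
    simp: scale_matrix_entry S_add_entry smult_r_distr simp del: atLeastAtMost_iff One_nat_def\<close>)

lemma scale_matrix_add_right:
  assumes "a \<in> carrier A" "x \<in> carrier N" "x' \<in> carrier N"
  shows "scale_matrix (a, x \<oplus>\<^bsub>N\<^esub> x') = scale_matrix (a, x) \<oplus>\<^bsub>S\<^esub> scale_matrix (a, x')"
  by (rule S_ext) (use assms in \<open>auto intro!: S_add_closed scale_matrix_closed N_closed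
    simp: scale_matrix_entry S_add_entry N_entry smult_l_distr simp del: atLeastAtMost_iff One_nat_def\<close>)

lemma scale_matrix_smult_left:
  assumes "r \<in> carrier F" "a \<in> carrier A" "x \<in> carrier N"
  shows "scale_matrix (r \<odot>\<^bsub>A\<^esub> a, x) = r \<odot>\<^bsub>S\<^esub> scale_matrix (a, x)"
proof (rule S_ext)
  fix i j assume ij: "i \<in> {1..n}" "j \<in> {1..n}"
  have "x (i, j) \<odot>\<^bsub>A\<^esub> (r \<odot>\<^bsub>A\<^esub> a) = r \<odot>\<^bsub>A\<^esub> (x (i, j) \<odot>\<^bsub>A\<^esub> a)"
    using N_val[OF assms(3) ij] assms by (simp add: R.m_comm[of r] flip: smult_assoc1)
  then show "scale_matrix (r \<odot>\<^bsub>A\<^esub> a, x) (i, j) = (r \<odot>\<^bsub>S\<^esub> scale_matrix (a, x)) (i, j)"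
    using ij by (simp add: scale_matrix_entry S_smult_entry)
qed (use assms in \<open>auto intro!: S_smult_closed scale_matrix_closed\<close>)

lemma scale_matrix_smult_right:
  assumes "r \<in> carrier F" "a \<in> carrier A" "x \<in> carrier N"
  shows "scale_matrix (a, r \<odot>\<^bsub>N\<^esub> x) = r \<odot>\<^bsub>S\<^esub> scale_matrix (a, x)"
  by (rule S_ext) (use assms in \<open>auto intro!: S_smult_closed scale_matrix_closed N_closed
    simp: scale_matrix_entry S_smult_entry N_entry smult_assoc1 simp del: atLeastAtMost_iff One_nat_def\<close>)

lemma scale_matrix_one: "scale_matrix (\<one>\<^bsub>A\<^esub>, \<one>\<^bsub>N\<^esub>) = \<one>\<^bsub>S\<^esub>"
  by (rule S_ext) (auto intro!: S_one_closed scale_matrix_closed N_closed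
    simp: scale_matrix_entry S_one_entry N_entry simp del: atLeastAtMost_iff One_nat_def)

lemma scale_matrix_tensor_map: "tensor_map F S A N scale_matrix"
  by (intro tensor_map.intro S_algebra tensor_map_axioms.intro N_closed scale_matrix_closed
      scale_matrix_one scale_matrix_mult scale_matrix_add_left scale_matrix_add_right
      scale_matrix_smult_left scale_matrix_smult_right) auto

text \<open>The section sends s to the sum of the pure tensors of s_ij with e_ij. What needs work is
  that every pure tensor of a and x is congruent to the section of its matrix; the relations are
  applied there one matrix entry at a time.\<close>

theorem skew_matrices_tensor: "algebra_isomorphic F S (tensor_algebra F A N)"
proof -
  interpret T: tensor_map F S A N scale_matrix by (rule scale_matrix_tensor_map)
  let ?J = "{1..n} \<times> {1..n}"
  note [simp del] = atLeastAtMost_iff One_nat_def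
  define \<sigma> where "\<sigma> s = (\<Oplus>\<^bsub>T.P\<^esub>p\<in>?J. T.d (s p, unit p))" for s
  have J: "finite ?J" by simp
  have val: "s p \<in> carrier A" if "s \<in> carrier S" "p \<in> ?J" for s p using that by auto
  have Nval: "x p \<in> carrier F" if "x \<in> carrier N" "p \<in> ?J" for x p using that by auto
  show ?thesis
  proof (rule T.section_imp_isomorphic)
    fix s assume s: "s \<in> carrier S"
    show "\<sigma> s \<in> carrier T.P"
      unfolding \<sigma>_def by (rule T.P.M.finsum_closed) (auto simp: T.d_closed)
    have closed: "scale_matrix (s p, unit p) \<in> carrier S" if "p \<in> ?J" for p
      using val[OF s that] by (intro scale_matrix_closed unit_closed)
    have "T.extension (\<sigma> s) = (\<Oplus>\<^bsub>S\<^esub>p\<in>?J. T.extension (T.d (s p, unit p)))"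
      unfolding \<sigma>_def by (rule T.extension_finsum) (auto simp: T.d_closed)
    also have "\<dots> = (\<Oplus>\<^bsub>S\<^esub>p\<in>?J. scale_matrix (s p, unit p))"
    proof (rule T.M.add.finprod_cong'[OF refl])
      fix p assume "p \<in> ?J"
      then show "T.extension (T.d (s p, unit p)) = scale_matrix (s p, unit p)"
        using val[OF s] unit_closed by (intro T.extension_single) auto
    qed (use closed in blast)
    also have "\<dots> = s"
    proof (rule S_ext[OF _ s])
      show "(\<Oplus>\<^bsub>S\<^esub>p\<in>?J. scale_matrix (s p, unit p)) \<in> carrier S"
        by (rule T.M.finsum_closed) (use closed in blast)
      fix i j assume ij: "i \<in> {1..n}" "j \<in> {1..n}"
      have "(\<Oplus>\<^bsub>S\<^esub>p\<in>?J. scale_matrix (s p, unit p)) (i, j) = (\<Oplus>\<^bsub>A\<^esub>p\<in>?J. scale_matrix (s p, unit p) (i, j))"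
        by (rule pointwise_finsum[OF T.M.abelian_group_axioms M.abelian_group_axioms _ S_add S_zero J])
          (use closed ij in \<open>auto simp: S_carrier\<close>)
      also have "\<dots> = scale_matrix (s (i, j), unit (i, j)) (i, j)"
        by (rule M.finsum_single[OF J])
          (use s ij in \<open>auto simp: scale_matrix_entry unit_entry split: if_splits\<close>)
      also have "\<dots> = s (i, j)"
        using s ij by (simp add: scale_matrix_entry unit_entry)
      finally show "(\<Oplus>\<^bsub>S\<^esub>p\<in>?J. scale_matrix (s p, unit p)) (i, j) = s (i, j)" .
    qed
    finally show "T.extension (\<sigma> s) = s" .
    fix t assume t: "t \<in> carrier S"
    have eq: "\<sigma> (s \<oplus>\<^bsub>S\<^esub> t) = (\<Oplus>\<^bsub>T.P\<^esub>p\<in>?J. T.d (s p \<oplus>\<^bsub>A\<^esub> t p, unit p))"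
      unfolding \<sigma>_def by (rule T.P.M.add.finprod_cong'[OF refl]) (simp_all add: Pi_iff T.d_closed S_add del: mem_Sigma_iff)
    have "T.congr (\<Oplus>\<^bsub>T.P\<^esub>p\<in>?J. T.d (s p \<oplus>\<^bsub>A\<^esub> t p, unit p))
        (\<Oplus>\<^bsub>T.P\<^esub>p\<in>?J. T.d (s p, unit p) \<oplus>\<^bsub>T.P\<^esub> T.d (t p, unit p))"
      by (rule T.congr_finsum[OF J]) (rule T.congr_add_left[OF val[OF s] val[OF t] unit_closed])
    moreover have "(\<Oplus>\<^bsub>T.P\<^esub>p\<in>?J. T.d (s p, unit p) \<oplus>\<^bsub>T.P\<^esub> T.d (t p, unit p)) = \<sigma> s \<oplus>\<^bsub>T.P\<^esub> \<sigma> t"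
      unfolding \<sigma>_def by (rule T.P.M.finsum_addf) (simp_all add: Pi_iff T.d_closed)
    ultimately show "T.congr (\<sigma> (s \<oplus>\<^bsub>S\<^esub> t)) (\<sigma> s \<oplus>\<^bsub>T.P\<^esub> \<sigma> t)" by (simp only: eq)
  next
    fix r s assume r: "r \<in> carrier F" and s: "s \<in> carrier S"
    have eq: "\<sigma> (r \<odot>\<^bsub>S\<^esub> s) = (\<Oplus>\<^bsub>T.P\<^esub>p\<in>?J. T.d (r \<odot>\<^bsub>A\<^esub> s p, unit p))"
      unfolding \<sigma>_def by (rule T.P.M.add.finprod_cong'[OF refl]) (simp_all add: Pi_iff T.d_closed S_smult del: mem_Sigma_iff)
    have "T.congr (\<Oplus>\<^bsub>T.P\<^esub>p\<in>?J. T.d (r \<odot>\<^bsub>A\<^esub> s p, unit p)) (\<Oplus>\<^bsub>T.P\<^esub>p\<in>?J. r \<odot>\<^bsub>T.P\<^esub> T.d (s p, unit p))"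
      by (rule T.congr_finsum[OF J]) (rule T.congr_smult_left[OF r val[OF s] unit_closed])
    moreover have "(\<Oplus>\<^bsub>T.P\<^esub>p\<in>?J. r \<odot>\<^bsub>T.P\<^esub> T.d (s p, unit p)) = r \<odot>\<^bsub>T.P\<^esub> \<sigma> s"
      unfolding \<sigma>_def by (rule T.P.finsum_smult_ldistr[symmetric]) (use r in \<open>simp_all add: Pi_iff T.d_closed\<close>)
    ultimately show "T.congr (\<sigma> (r \<odot>\<^bsub>S\<^esub> s)) (r \<odot>\<^bsub>T.P\<^esub> \<sigma> s)" by (simp only: eq)
  next
    fix a x assume a: "a \<in> carrier A" and x: "x \<in> carrier N"
    \<comment> \<open>Truncating x to a set of positions lets the induction run over that set: the
      empty truncation is zero, the full one is x.\<close>
    define cut where "cut J = (\<lambda>p\<in>?J. if p \<in> J then x p else \<zero>)" for J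
    have cut_closed: "cut J \<in> carrier N" for J
      using x by (auto simp: cut_def N_carrier)
    have cut_entry: "cut J (i, j) = (if (i, j) \<in> J then x (i, j) else \<zero>)"
      if "i \<in> {1..n}" "j \<in> {1..n}" for J i j
      using that by (simp add: cut_def)
    have "T.congr (T.d (a, cut J)) (\<Oplus>\<^bsub>T.P\<^esub>p\<in>J. T.d (x p \<odot>\<^bsub>A\<^esub> a, unit p))"
      if "finite J" "J \<subseteq> ?J" for J
      using that
    proof (induction J)
      case empty
      \<comment> \<open>The zero matrix is written as a multiple by the scalar zero, since the
        scalar relation then shows that its tensor with a vanishes.\<close>
      have "cut {} = \<zero> \<odot>\<^bsub>N\<^esub> cut {}"
        by (rule N_ext) (simp_all add: N_closed cut_closed N_entry cut_entry)
      then have "T.congr (T.d (a, cut {})) (\<zero> \<odot>\<^bsub>T.P\<^esub> T.d (a, cut {}))"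
        using T.congr_smult_right[of "\<zero>" a "cut {}"] a cut_closed by simp
      then show ?case by (simp add: T.d_closed)
    next
      case (insert p J)
      then have p: "p \<in> ?J" and xp: "x p \<in> carrier F" using Nval[OF x] by auto
      have "cut (insert p J) = (x p \<odot>\<^bsub>N\<^esub> unit p) \<oplus>\<^bsub>N\<^esub> cut J"
        by (rule N_ext) (use insert p xp x in \<open>auto simp: N_closed cut_closed unit_closed N_entry cut_entry
          unit_entry split: if_splits\<close>)
      then have 1: "T.congr (T.d (a, cut (insert p J))) (T.d (a, x p \<odot>\<^bsub>N\<^esub> unit p) \<oplus>\<^bsub>T.P\<^esub> T.d (a, cut J))"
        using a xp cut_closed unit_closed N_closed by (simp add: T.congr_add_right)
      \<comment> \<open>The scalar x_p moves across the tensor sign, from the second factor to the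
        first, through the two scalar relations.\<close>
      have "T.congr (T.d (a, x p \<odot>\<^bsub>N\<^esub> unit p)) (T.d (x p \<odot>\<^bsub>A\<^esub> a, unit p))"
        using T.congr_trans[OF T.congr_smult_right T.congr_sym[OF T.congr_smult_left]] a xp unit_closed by blast
      then have 2: "T.congr (T.d (a, x p \<odot>\<^bsub>N\<^esub> unit p) \<oplus>\<^bsub>T.P\<^esub> T.d (a, cut J))
          (T.d (x p \<odot>\<^bsub>A\<^esub> a, unit p) \<oplus>\<^bsub>T.P\<^esub> (\<Oplus>\<^bsub>T.P\<^esub>p\<in>J. T.d (x p \<odot>\<^bsub>A\<^esub> a, unit p)))"
        using insert by (intro T.congr_add) auto
      have 3: "T.d (x p \<odot>\<^bsub>A\<^esub> a, unit p) \<oplus>\<^bsub>T.P\<^esub> (\<Oplus>\<^bsub>T.P\<^esub>p\<in>J. T.d (x p \<odot>\<^bsub>A\<^esub> a, unit p)) =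
          (\<Oplus>\<^bsub>T.P\<^esub>p\<in>insert p J. T.d (x p \<odot>\<^bsub>A\<^esub> a, unit p))"
        using insert by (intro T.P.M.finsum_insert[symmetric]) (auto simp: T.d_closed)
      show ?case using T.congr_trans[OF 1 2] by (simp only: 3)
    qed
    from this[OF J] have "T.congr (T.d (a, cut ?J)) (\<Oplus>\<^bsub>T.P\<^esub>p\<in>?J. T.d (x p \<odot>\<^bsub>A\<^esub> a, unit p))" by simp
    moreover have "cut ?J = x"
      by (rule N_ext) (use x in \<open>auto simp: cut_closed cut_entry\<close>)
    moreover have "(\<Oplus>\<^bsub>T.P\<^esub>p\<in>?J. T.d (x p \<odot>\<^bsub>A\<^esub> a, unit p)) = \<sigma> (scale_matrix (a, x))"
      unfolding \<sigma>_def by (rule T.P.M.add.finprod_cong'[OF refl]) (simp_all add: Pi_iff T.d_closed scale_matrix_def del: mem_Sigma_iff)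
    ultimately show "T.congr (T.d (a, x)) (\<sigma> (scale_matrix (a, x)))" by simp
  qed
qed

end

section \<open>Brauer equivalence\<close>

lemma ring_iso_inverse:
  assumes h: "h \<in> ring_iso A B"
    and mult: "\<And>x y. x \<in> carrier A \<Longrightarrow> y \<in> carrier A \<Longrightarrow> x \<otimes>\<^bsub>A\<^esub> y \<in> carrier A"
    and add: "\<And>x y. x \<in> carrier A \<Longrightarrow> y \<in> carrier A \<Longrightarrow> x \<oplus>\<^bsub>A\<^esub> y \<in> carrier A"
    and one: "\<one>\<^bsub>A\<^esub> \<in> carrier A"
  shows "inv_into (carrier A) h \<in> ring_iso B A"
proof -
  note E = ring_iso_memE[OF h]
  define g where "g = inv_into (carrier A) h"
  have bij: "bij_betw g (carrier B) (carrier A)" unfolding g_def by (rule bij_betw_inv_into[OF E(5)])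
  have g: "g y \<in> carrier A" "h (g y) = y" if "y \<in> carrier B" for y
    using that bij E(5) unfolding g_def by (auto simp: bij_betw_def f_inv_into_f inv_into_into)
  have gh: "g (h x) = x" if "x \<in> carrier A" for x
    using that E(5) unfolding g_def by (simp add: bij_betw_def inv_into_f_f)
  have "g \<in> ring_iso B A"
  proof (rule ring_iso_memI)
    fix x y assume xy: "x \<in> carrier B" "y \<in> carrier B"
    show "g (x \<otimes>\<^bsub>B\<^esub> y) = g x \<otimes>\<^bsub>A\<^esub> g y" "g (x \<oplus>\<^bsub>B\<^esub> y) = g x \<oplus>\<^bsub>A\<^esub> g y"
      using gh[of "g x \<otimes>\<^bsub>A\<^esub> g y"] gh[of "g x \<oplus>\<^bsub>A\<^esub> g y"] xy g mult add E(2,3) by simp_all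
  next
    show "g \<one>\<^bsub>B\<^esub> = \<one>\<^bsub>A\<^esub>" using gh[OF one] E(4) by simp
  qed (use g bij in auto)
  then show ?thesis by (simp add: g_def)
qed

text \<open>The algebra laws are placed on the side of \<open>A\<close> because the lemma is applied
  with a \<open>tensor_algebra\<close> as \<open>B\<close>, whose operations are understood only
  through the isomorphism itself.\<close>

lemma algebra_isomorphic_sym:
  assumes iso: "algebra_isomorphic F A B" and "unital_algebra F A"
  shows "algebra_isomorphic F B A"
proof -
  interpret unital_algebra F A by fact
  obtain h where h: "h \<in> ring_iso A B"
    and lin: "\<And>r x. r \<in> carrier F \<Longrightarrow> x \<in> carrier A \<Longrightarrow> h (r \<odot>\<^bsub>A\<^esub> x) = r \<odot>\<^bsub>B\<^esub> h x"
    using iso unfolding algebra_isomorphic_def by blast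
  note bij = ring_iso_memE(5)[OF h]
  let ?g = "inv_into (carrier A) h"
  have "?g \<in> ring_iso B A" by (rule ring_iso_inverse[OF h]) auto
  moreover have "?g (r \<odot>\<^bsub>B\<^esub> y) = r \<odot>\<^bsub>A\<^esub> ?g y" if r: "r \<in> carrier F" and y: "y \<in> carrier B" for r y
  proof -
    obtain x where x: "x \<in> carrier A" "y = h x" using y bij by (auto simp: bij_betw_def)
    then show ?thesis
      using r bij by (simp add: bij_betw_def inv_into_f_f flip: lin)
  qed
  ultimately show ?thesis unfolding algebra_isomorphic_def by blast
qed

lemma algebra_isomorphic_trans:
  assumes "algebra_isomorphic F A B" and "algebra_isomorphic F B C"
  shows "algebra_isomorphic F A C"
proof -
  obtain h k where h: "h \<in> ring_iso A B" "\<forall>r\<in>carrier F. \<forall>x\<in>carrier A. h (r \<odot>\<^bsub>A\<^esub> x) = r \<odot>\<^bsub>B\<^esub> h x"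
    and k: "k \<in> ring_iso B C" "\<forall>r\<in>carrier F. \<forall>x\<in>carrier B. k (r \<odot>\<^bsub>B\<^esub> x) = r \<odot>\<^bsub>C\<^esub> k x"
    using assms unfolding algebra_isomorphic_def by blast
  have "k \<circ> h \<in> ring_iso A C" by (rule ring_iso_set_trans[OF h(1) k(1)])
  moreover have "\<forall>r\<in>carrier F. \<forall>x\<in>carrier A. (k \<circ> h) (r \<odot>\<^bsub>A\<^esub> x) = r \<odot>\<^bsub>C\<^esub> (k \<circ> h) x"
    using h k ring_iso_memE(1)[OF h(1)] by simp
  ultimately show ?thesis unfolding algebra_isomorphic_def by blast
qed

lemma corner_radical_iso:
  assumes h: "h \<in> ring_iso R R'" and "ring R" "ring R'" and e: "e \<in> carrier R" and x: "x \<in> carrier R"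
  shows "h x \<in> corner_radical R' (h e) \<longleftrightarrow> x \<in> corner_radical R e"
proof -
  interpret R: ring R by fact
  interpret R': ring R' by fact
  note E = ring_iso_memE[OF h]
  have img: "carrier R' = h ` carrier R" using E(5) by (simp add: bij_betw_def)
  have "h \<zero>\<^bsub>R\<^esub> = \<zero>\<^bsub>R'\<^esub>"
    using ring_hom_zero[of h R R'] h assms(2,3) by (simp add: ring_iso_def)
  then have zero: "h z = \<zero>\<^bsub>R'\<^esub> \<longleftrightarrow> z = \<zero>\<^bsub>R\<^esub>" if "z \<in> carrier R" for z
    using that E(5) R.zero_closed by (metis bij_betw_def inj_onD)
  show ?thesis
    unfolding corner_radical_def img using e x by (simp add: zero flip: E(2))
qed

text \<open>Moves a corner of one nucleus into the other nucleus, so that the corners coming from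
  both central simple algebras lie in one ring and their radicals can be compared.\<close>

lemma simple_corner_iso:
  assumes "simple_corner R A \<iota>" and g: "g \<in> ring_iso R R'" and "ring R'"
  shows "simple_corner R' A (g \<circ> \<iota>)"
proof -
  interpret simple_corner R A \<iota> by fact
  interpret R': ring R' by fact
  note E = ring_iso_memE[OF g]
  show ?thesis
  proof (intro simple_corner.intro simple_corner_axioms.intro R'.ring_axioms A.ring_axioms simple nontrivial)
    show "inj_on (g \<circ> \<iota>) (carrier A)"
    proof (rule comp_inj_on[OF emb_inj])
      show "inj_on g (\<iota> ` carrier A)"
        by (rule inj_on_subset[of g "carrier R"]) (use E(5) in \<open>auto simp: bij_betw_def\<close>)
    qed
  next
    fix y assume "y \<in> carrier R'"
    then obtain x where x: "x \<in> carrier R" "y = g x" using E(5) by (auto simp: bij_betw_def)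
    have "(g \<circ> \<iota>) \<one>\<^bsub>A\<^esub> \<otimes>\<^bsub>R'\<^esub> y \<otimes>\<^bsub>R'\<^esub> (g \<circ> \<iota>) \<one>\<^bsub>A\<^esub> = g (idem \<otimes>\<^bsub>R\<^esub> x \<otimes>\<^bsub>R\<^esub> idem)"
      using x by (simp add: E(2))
    then show "(g \<circ> \<iota>) \<one>\<^bsub>A\<^esub> \<otimes>\<^bsub>R'\<^esub> y \<otimes>\<^bsub>R'\<^esub> (g \<circ> \<iota>) \<one>\<^bsub>A\<^esub> \<in> (g \<circ> \<iota>) ` carrier A"
      using emb_corner[OF x(1)] by (auto simp: image_comp[symmetric])
  qed (simp_all add: emb_add emb_mult E)
qed

section \<open>The nucleus of twisted matrices over a central simple algebra\<close>

locale skew_matrix_csa = central_simple_algebra F A + skew_matrix_ring F A n c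
  for F (structure) and A (structure) and n c
begin

definition nucleus_ring where "nucleus_ring = S\<lparr>carrier := nucleus S\<rparr>"

sublocale S: unital_algebra F S by (rule S_algebra)

lemma nucleus_ring_algebra: "assoc_algebra F nucleus_ring"
  unfolding nucleus_ring_def by (rule S.nucleus_algebra)

sublocale nuc: assoc_algebra F nucleus_ring by (rule nucleus_ring_algebra)

lemma nucleus_ring_simps:
  "carrier nucleus_ring = nucleus S" "mult nucleus_ring = mult S" "one nucleus_ring = one S"
  "zero nucleus_ring = zero S" "add nucleus_ring = add S" "smult nucleus_ring = smult S"
  by (simp_all add: nucleus_ring_def)

lemma A_one_nonzero: "\<one>\<^bsub>A\<^esub> \<noteq> \<zero>\<^bsub>A\<^esub>"
proof
  assume *: "\<one>\<^bsub>A\<^esub> = \<zero>\<^bsub>A\<^esub>"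
  have "x = \<zero>\<^bsub>A\<^esub>" if "x \<in> carrier A" for x
    using that l_one[of x] l_null[of x] by (simp add: *)
  then have "carrier A = {\<zero>\<^bsub>A\<^esub>}" by auto
  then show False using nontrivial by blast
qed

text \<open>Cutting by e_ii on the left and by e_jj on the right involves only coefficients of the
  forms \<open>c i i l\<close> and \<open>c k j j\<close>. These are one, so the entry is left
  unchanged.\<close>

lemma peirce_component:
  assumes "x \<in> carrier S" "i \<in> {1..n}" "j \<in> {1..n}"
  shows "E i i \<one>\<^bsub>A\<^esub> \<otimes>\<^bsub>S\<^esub> x \<otimes>\<^bsub>S\<^esub> E j j \<one>\<^bsub>A\<^esub> = E i j (x (i, j))"
proof (rule S_ext)
  note [simp del] = atLeastAtMost_iff One_nat_def
  fix k l assume "k \<in> {1..n}" "l \<in> {1..n}"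
  then show "(E i i \<one>\<^bsub>A\<^esub> \<otimes>\<^bsub>S\<^esub> x \<otimes>\<^bsub>S\<^esub> E j j \<one>\<^bsub>A\<^esub>) (k, l) = E i j (x (i, j)) (k, l)"
    using assms by (simp add: mult_E_entry E_mult_entry E_entry)
qed (use assms in auto)

text \<open>The embedding is multiplicative because c_qqq = 1, and the corner consists of the Peirce
  components at position (q, q), whose single entry ranges over \<open>A\<close>.\<close>

lemma corner:
  assumes q: "q \<in> {1..n}"
  shows "simple_corner nucleus_ring A (E q q)"
proof (intro simple_corner.intro simple_corner_axioms.intro)
  note [simp del] = atLeastAtMost_iff One_nat_def
  show "ring nucleus_ring" "ring A" ..
  show "inj_on (E q q) (carrier A)" using q by (intro inj_onI) (simp add: E_eq_iff)
  show "E q q a \<in> carrier nucleus_ring" if "a \<in> carrier A" for a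
    using that q by (simp add: nucleus_ring_simps E_nucleus)
  show "E q q (a \<oplus>\<^bsub>A\<^esub> b) = E q q a \<oplus>\<^bsub>nucleus_ring\<^esub> E q q b" if "a \<in> carrier A" "b \<in> carrier A" for a b
    using that by (simp add: nucleus_ring_simps E_add)
  show "E q q (a \<otimes>\<^bsub>A\<^esub> b) = E q q a \<otimes>\<^bsub>nucleus_ring\<^esub> E q q b" if "a \<in> carrier A" "b \<in> carrier A" for a b
    using that q by (simp add: nucleus_ring_simps E_mult_E)
  show "E q q \<one>\<^bsub>A\<^esub> \<otimes>\<^bsub>nucleus_ring\<^esub> x \<otimes>\<^bsub>nucleus_ring\<^esub> E q q \<one>\<^bsub>A\<^esub> \<in> E q q ` carrier A"
    if "x \<in> carrier nucleus_ring" for x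
    using that q by (simp add: nucleus_ring_simps peirce_component nucleus_carrier)
  show "I = {\<zero>\<^bsub>A\<^esub>} \<or> I = carrier A" if "ideal I A" for I by (rule simple[OF that])
qed (rule A_one_nonzero)

text \<open>The coefficients \<open>a\<close> with \<open>a e\<^sub>i\<^sub>j\<close> in the nucleus form an ideal of the simple ring \<open>A\<close>.\<close>

lemma nucleus_entry:
  assumes x: "x \<in> nucleus S" and ij: "i \<in> {1..n}" "j \<in> {1..n}" and ne: "x (i, j) \<noteq> \<zero>\<^bsub>A\<^esub>"
    and a: "a \<in> carrier A"
  shows "E i j a \<in> nucleus S"
proof -
  note [simp del] = atLeastAtMost_iff One_nat_def
  have "ring A" ..
  have "ideal {a \<in> carrier A. E i j a \<in> nucleus S} A"
  proof (rule ring.two_sided_idealI[OF \<open>ring A\<close>])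
    fix a b assume "a \<in> {a \<in> carrier A. E i j a \<in> nucleus S}" and b: "b \<in> carrier A"
    then have a: "a \<in> carrier A" "E i j a \<in> nucleus S" by auto
    have "E i i b \<otimes>\<^bsub>S\<^esub> E i j a \<in> nucleus S" "E i j a \<otimes>\<^bsub>S\<^esub> E j j b \<in> nucleus S"
      using a b ij E_nucleus by (auto intro: S.nucleus_mult)
    then show "b \<otimes>\<^bsub>A\<^esub> a \<in> {a \<in> carrier A. E i j a \<in> nucleus S}"
      "a \<otimes>\<^bsub>A\<^esub> b \<in> {a \<in> carrier A. E i j a \<in> nucleus S}"
      using a b ij by (simp_all add: E_mult_E)
  qed (auto simp: E_zero E_add S.nucleus_zero S.nucleus_add)
  moreover have "x (i, j) \<in> {a \<in> carrier A. E i j a \<in> nucleus S}"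
  proof -
    have "E i i \<one>\<^bsub>A\<^esub> \<otimes>\<^bsub>S\<^esub> x \<otimes>\<^bsub>S\<^esub> E j j \<one>\<^bsub>A\<^esub> \<in> nucleus S"
      using x ij by (intro S.nucleus_mult E_nucleus) auto
    then show ?thesis using x ij by (simp add: peirce_component nucleus_carrier)
  qed
  ultimately show ?thesis using simple ne a by blast
qed

text \<open>A nonzero element e_qq y e_ii z e_qq equals c_qiq y_qi z_iq e_qq, so none of the three
  factors vanishes. The scalar is invertible because F is a field, and \<open>nucleus_entry\<close>
  brings every a e_qi and a e_iq into the nucleus. With u = e_iq and v = e_qi / c_qiq the product v
  u is e_qq. The product u v is e_ii multiplied by c_iqi / c_qiq, so the two coefficients still have
  to agree.\<close>

lemma link:
  assumes q: "q \<in> {1..n}" and i: "i \<in> {1..n}"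
    and nonradical: "E i i \<one>\<^bsub>A\<^esub> \<notin> corner_radical nucleus_ring (E q q \<one>\<^bsub>A\<^esub>)"
  shows "\<exists>u\<in>carrier nucleus_ring. \<exists>v\<in>carrier nucleus_ring.
    v \<otimes>\<^bsub>nucleus_ring\<^esub> u = E q q \<one>\<^bsub>A\<^esub> \<and> u \<otimes>\<^bsub>nucleus_ring\<^esub> v = E i i \<one>\<^bsub>A\<^esub>"
proof -
  note [simp del] = atLeastAtMost_iff One_nat_def
  have nuc [simp]: "E q q \<one>\<^bsub>A\<^esub> \<in> nucleus S" "E i i \<one>\<^bsub>A\<^esub> \<in> nucleus S" using q i by (auto intro: E_nucleus)
  obtain y z where y: "y \<in> nucleus S" and z: "z \<in> nucleus S"
    and ne: "E q q \<one>\<^bsub>A\<^esub> \<otimes>\<^bsub>S\<^esub> (y \<otimes>\<^bsub>S\<^esub> E i i \<one>\<^bsub>A\<^esub> \<otimes>\<^bsub>S\<^esub> z) \<otimes>\<^bsub>S\<^esub> E q q \<one>\<^bsub>A\<^esub> \<noteq> \<zero>\<^bsub>S\<^esub>"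
    using nonradical unfolding corner_radical_def by (auto simp: nucleus_ring_simps)
  have yz [simp]: "y \<in> carrier S" "z \<in> carrier S" using y z by (auto intro: nucleus_carrier)
  \<comment> \<open>Doubling the idempotent in the middle splits the element into two Peirce
    components, whose product is governed by a single coefficient.\<close>
  have "E i i \<one>\<^bsub>A\<^esub> \<otimes>\<^bsub>S\<^esub> E i i \<one>\<^bsub>A\<^esub> = E i i \<one>\<^bsub>A\<^esub>" using i by (simp add: E_mult_E)
  then have "E q q \<one>\<^bsub>A\<^esub> \<otimes>\<^bsub>S\<^esub> (y \<otimes>\<^bsub>S\<^esub> E i i \<one>\<^bsub>A\<^esub> \<otimes>\<^bsub>S\<^esub> z) \<otimes>\<^bsub>S\<^esub> E q q \<one>\<^bsub>A\<^esub> =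
      E q q \<one>\<^bsub>A\<^esub> \<otimes>\<^bsub>S\<^esub> (y \<otimes>\<^bsub>S\<^esub> (E i i \<one>\<^bsub>A\<^esub> \<otimes>\<^bsub>S\<^esub> E i i \<one>\<^bsub>A\<^esub>) \<otimes>\<^bsub>S\<^esub> z) \<otimes>\<^bsub>S\<^esub> E q q \<one>\<^bsub>A\<^esub>"
    by simp
  also have "\<dots> = (E q q \<one>\<^bsub>A\<^esub> \<otimes>\<^bsub>S\<^esub> y \<otimes>\<^bsub>S\<^esub> E i i \<one>\<^bsub>A\<^esub>) \<otimes>\<^bsub>S\<^esub> (E i i \<one>\<^bsub>A\<^esub> \<otimes>\<^bsub>S\<^esub> z \<otimes>\<^bsub>S\<^esub> E q q \<one>\<^bsub>A\<^esub>)"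
  proof -
    have "ring nucleus_ring" ..
    then have assoc: "a \<otimes>\<^bsub>S\<^esub> b \<otimes>\<^bsub>S\<^esub> d = a \<otimes>\<^bsub>S\<^esub> (b \<otimes>\<^bsub>S\<^esub> d)"
      if "a \<in> nucleus S" "b \<in> nucleus S" "d \<in> nucleus S" for a b d
      using monoid.m_assoc[OF ringE(2), of nucleus_ring a b d] that by (simp add: nucleus_ring_simps)
    show ?thesis using y z by (simp add: assoc S.nucleus_mult)
  qed
  also have "\<dots> = E q i (y (q, i)) \<otimes>\<^bsub>S\<^esub> E i q (z (i, q))"
    using q i by (simp add: peirce_component)
  also have "\<dots> = E q q (c q i q \<odot>\<^bsub>A\<^esub> (y (q, i) \<otimes>\<^bsub>A\<^esub> z (i, q)))"
    using q i by (simp add: E_mult_E)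
  finally have nz: "c q i q \<odot>\<^bsub>A\<^esub> (y (q, i) \<otimes>\<^bsub>A\<^esub> z (i, q)) \<noteq> \<zero>\<^bsub>A\<^esub>"
    using ne by (auto simp: E_zero)
  have y_ne: "y (q, i) \<noteq> \<zero>\<^bsub>A\<^esub>" and z_ne: "z (i, q) \<noteq> \<zero>\<^bsub>A\<^esub>" and c_ne: "c q i q \<noteq> \<zero>"
    using nz q i by auto
  define t where "t = inv c q i q"
  have t: "t \<in> carrier F" "t \<otimes> c q i q = \<one>" "c q i q \<otimes> t = \<one>"
    using c_ne q i field_Units by (auto simp: t_def)
  define s where "s = t \<odot>\<^bsub>A\<^esub> \<one>\<^bsub>A\<^esub>"
  have s [simp]: "s \<in> carrier A" using t by (simp add: s_def)
  have v: "E q i a \<in> nucleus S" and u: "E i q a \<in> nucleus S" if "a \<in> carrier A" for a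
    using that nucleus_entry[OF y q i y_ne] nucleus_entry[OF z i q z_ne] by auto
  \<comment> \<open>Associativity constrains the coefficients here: e_qi lies in the nucleus, and
    the two bracketings give c_qiq e_qi and c_iqi e_qi.\<close>
  have "E q i \<one>\<^bsub>A\<^esub> \<otimes>\<^bsub>S\<^esub> E i q \<one>\<^bsub>A\<^esub> \<otimes>\<^bsub>S\<^esub> E q i \<one>\<^bsub>A\<^esub> = E q i \<one>\<^bsub>A\<^esub> \<otimes>\<^bsub>S\<^esub> (E i q \<one>\<^bsub>A\<^esub> \<otimes>\<^bsub>S\<^esub> E q i \<one>\<^bsub>A\<^esub>)"
    by (rule nucleusD(1)) (auto intro: v)
  then have "E q i (c q i q \<odot>\<^bsub>A\<^esub> \<one>\<^bsub>A\<^esub>) = E q i (c i q i \<odot>\<^bsub>A\<^esub> \<one>\<^bsub>A\<^esub>)"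
    using q i by (simp add: E_mult_E)
  then have c_eq: "c q i q \<odot>\<^bsub>A\<^esub> \<one>\<^bsub>A\<^esub> = c i q i \<odot>\<^bsub>A\<^esub> \<one>\<^bsub>A\<^esub>"
    using q i by (simp add: E_eq_iff)
  have vu: "E q i s \<otimes>\<^bsub>S\<^esub> E i q \<one>\<^bsub>A\<^esub> = E q q \<one>\<^bsub>A\<^esub>"
    using q i t by (simp add: E_mult_E) (simp add: s_def flip: smult_assoc1)
  have "c i q i \<odot>\<^bsub>A\<^esub> s = t \<odot>\<^bsub>A\<^esub> (c i q i \<odot>\<^bsub>A\<^esub> \<one>\<^bsub>A\<^esub>)"
    using q i t by (simp add: s_def m_comm[of t] flip: smult_assoc1)
  also have "\<dots> = \<one>\<^bsub>A\<^esub>"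
    using q i t by (simp flip: c_eq smult_assoc1)
  finally have uv: "E i q \<one>\<^bsub>A\<^esub> \<otimes>\<^bsub>S\<^esub> E q i s = E i i \<one>\<^bsub>A\<^esub>"
    using q i by (simp add: E_mult_E)
  show ?thesis
    unfolding nucleus_ring_simps using vu uv u[OF one_closed] v[OF s] by blast
qed

text \<open>A finite sum depends on the carrier of its record, so the sum is evaluated entrywise in
  the nucleus itself. At position (k, l) only the summand with index k can contribute.\<close>

lemma sum_idempotents: "(\<Oplus>\<^bsub>nucleus_ring\<^esub>i\<in>{1..n}. E i i \<one>\<^bsub>A\<^esub>) = \<one>\<^bsub>nucleus_ring\<^esub>"
proof -
  note [simp del] = atLeastAtMost_iff One_nat_def
  have E: "(\<lambda>i. E i i \<one>\<^bsub>A\<^esub>) \<in> {1..n} \<rightarrow> carrier nucleus_ring"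
    by (auto simp: nucleus_ring_simps E_nucleus)
  have closed: "(\<Oplus>\<^bsub>nucleus_ring\<^esub>i\<in>{1..n}. E i i \<one>\<^bsub>A\<^esub>) \<in> carrier nucleus_ring"
    by (rule nuc.M.finsum_closed[OF E])
  show ?thesis
  proof (rule S_ext)
    show "(\<Oplus>\<^bsub>nucleus_ring\<^esub>i\<in>{1..n}. E i i \<one>\<^bsub>A\<^esub>) \<in> carrier S" "\<one>\<^bsub>nucleus_ring\<^esub> \<in> carrier S"
      using closed by (auto simp: nucleus_ring_simps intro: nucleus_carrier)
    fix k l assume kl: "k \<in> {1..n}" "l \<in> {1..n}"
    have "(\<Oplus>\<^bsub>nucleus_ring\<^esub>i\<in>{1..n}. E i i \<one>\<^bsub>A\<^esub>) (k, l) = (\<Oplus>\<^bsub>A\<^esub>i\<in>{1..n}. E i i \<one>\<^bsub>A\<^esub> (k, l))"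
    proof (rule pointwise_finsum[OF nuc.M.abelian_group_axioms M.abelian_group_axioms _ _ _ _ E])
      show "carrier nucleus_ring \<subseteq> {1..n} \<times> {1..n} \<rightarrow>\<^sub>E carrier A"
        using nucleus_subset[of S] by (simp add: nucleus_ring_simps S_carrier)
    qed (use kl in \<open>simp_all add: nucleus_ring_simps S_add S_zero\<close>)
    also have "\<dots> = E k k \<one>\<^bsub>A\<^esub> (k, l)"
      by (rule M.finsum_single) (use kl in \<open>auto simp: E_entry\<close>)
    also have "\<dots> = \<one>\<^bsub>nucleus_ring\<^esub> (k, l)"
      using kl by (auto simp: E_entry nucleus_ring_simps S_one_entry)
    finally show "(\<Oplus>\<^bsub>nucleus_ring\<^esub>i\<in>{1..n}. E i i \<one>\<^bsub>A\<^esub>) (k, l) = \<one>\<^bsub>nucleus_ring\<^esub> (k, l)" .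
  qed
qed

text \<open>Stated for every q, since the index on the \<open>B\<close> side is found only after the
  radical from the \<open>A\<close> side has been carried over.\<close>

lemma matrix_quotient:
  assumes q: "q \<in> {1..n}"
  shows "\<exists>m\<ge>1. \<exists>\<pi>. algebra_epi F nucleus_ring (skew_matrices A m (\<lambda>_ _ _. \<one>)) \<pi> \<and>
    (\<forall>x\<in>carrier nucleus_ring. \<forall>y\<in>carrier nucleus_ring. \<pi> x = \<pi> y \<longleftrightarrow>
      x \<ominus>\<^bsub>nucleus_ring\<^esub> y \<in> corner_radical nucleus_ring (E q q \<one>\<^bsub>A\<^esub>))"
proof (rule corner_matrix_quotient[where e = "\<lambda>i. E i i \<one>\<^bsub>A\<^esub>" and I = "{1..n}"])
  note [simp del] = atLeastAtMost_iff One_nat_def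
  show "assoc_algebra F A" by (rule assoc_algebra_axioms)
  show "(\<lambda>i. E i i \<one>\<^bsub>A\<^esub>) \<in> {1..n} \<rightarrow> carrier nucleus_ring"
    by (auto simp: nucleus_ring_simps E_nucleus)
  show "\<exists>u\<in>carrier nucleus_ring. \<exists>v\<in>carrier nucleus_ring.
      v \<otimes>\<^bsub>nucleus_ring\<^esub> u = E q q \<one>\<^bsub>A\<^esub> \<and> u \<otimes>\<^bsub>nucleus_ring\<^esub> v = E i i \<one>\<^bsub>A\<^esub>"
    if "i \<in> {1..n}" "E i i \<one>\<^bsub>A\<^esub> \<notin> corner_radical nucleus_ring (E q q \<one>\<^bsub>A\<^esub>)" for i
    using q that by (rule link)
qed (use q in \<open>auto simp: nucleus_ring_algebra corner sum_idempotents nucleus_ring_simps E_smult E_mult_E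
    simp del: atLeastAtMost_iff One_nat_def\<close>)

end

theorem proposition14p4:
  fixes F :: "('f, 'k) ring_scheme"
    and A :: "('f, 'a, 'm) module_scheme" and B :: "('f, 'b, 'l) module_scheme"
    and n n' :: nat and c c' :: "nat \<Rightarrow> nat \<Rightarrow> nat \<Rightarrow> 'f"
  assumes "field F"
    and "central_simple_algebra F A" and "central_simple_algebra F B"
    and "n \<ge> 1" and "n' \<ge> 1"
    and "reduced_skew_set F n c" and "reduced_skew_set F n' c'"
    and "algebra_isomorphic F (tensor_algebra F A (skew_matrix_algebra F n c))
           (tensor_algebra F B (skew_matrix_algebra F n' c'))"
  shows "brauer_equivalent F A B"
proof -
  interpret A: central_simple_algebra F A by fact
  interpret B: central_simple_algebra F B by fact
  interpret SA: skew_matrix_csa F A n c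
    by (intro skew_matrix_csa.intro skew_matrix_ring.intro skew_matrix_ring_axioms.intro
        A.central_simple_algebra_axioms A.assoc_algebra_axioms) fact
  interpret SB: skew_matrix_csa F B n' c'
    by (intro skew_matrix_csa.intro skew_matrix_ring.intro skew_matrix_ring_axioms.intro
        B.central_simple_algebra_axioms B.assoc_algebra_axioms) fact
  let ?R = "SA.nucleus_ring" and ?R' = "SB.nucleus_ring"
  have rings: "ring ?R" "ring ?R'"
    using SA.nucleus_ring_algebra SB.nucleus_ring_algebra by (simp_all add: assoc_algebra_def)

  \<comment> \<open>Both tensor products are exchanged for twisted matrices, where the nucleus and
    its corners can be described by entries.\<close>
  have "algebra_isomorphic F SA.S SB.S"
    using algebra_isomorphic_trans[OF algebra_isomorphic_trans[OF SA.skew_matrices_tensor assms(8)]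
        algebra_isomorphic_sym[OF SB.skew_matrices_tensor SB.S_algebra]] .
  then obtain h where h: "h \<in> ring_iso SA.S SB.S"
    and h_smult: "\<And>r x. r \<in> carrier F \<Longrightarrow> x \<in> carrier SA.S \<Longrightarrow> h (r \<odot>\<^bsub>SA.S\<^esub> x) = r \<odot>\<^bsub>SB.S\<^esub> h x"
    unfolding algebra_isomorphic_def by blast
  define g where "g = inv_into (carrier SA.S) h"
  have g: "g \<in> ring_iso SB.S SA.S"
    unfolding g_def by (rule ring_iso_inverse[OF h]) auto
  note hE = ring_iso_memE[OF h] and gE = ring_iso_memE[OF g]
  have gh: "g (h x) = x" if "x \<in> carrier SA.S" for x
    using that hE(5) by (simp add: g_def bij_betw_def inv_into_f_f)
  have hg: "h (g y) = y" if "y \<in> carrier SB.S" for y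
    using that hE(5) by (simp add: g_def bij_betw_def f_inv_into_f)
  have g_smult: "g (r \<odot>\<^bsub>SB.S\<^esub> y) = r \<odot>\<^bsub>SA.S\<^esub> g y" if "r \<in> carrier F" "y \<in> carrier SB.S" for r y
    using that gh[of "r \<odot>\<^bsub>SA.S\<^esub> g y"] h_smult[of r "g y"] by (simp add: gE(1) hg)
  have h_nuc: "h x \<in> nucleus SB.S" if "x \<in> nucleus SA.S" for x
    by (rule nucleus_iso[OF h that]) auto
  have g_nuc: "g y \<in> nucleus SA.S" if "y \<in> nucleus SB.S" for y
    by (rule nucleus_iso[OF g that]) auto
  \<comment> \<open>Both directions are needed as maps of nuclei: \<open>h\<close> carries the
    corner and its radical to the \<open>B\<close> side, while \<open>g\<close> pulls the
    \<open>B\<close> side back to where \<open>\<pi>\<close> is defined.\<close>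
  have gR: "g \<in> ring_iso ?R' ?R"
  proof (rule ring_iso_memI)
    show "bij_betw g (carrier ?R') (carrier ?R)"
      by (rule bij_betwI[where g = h])
         (auto simp: SA.nucleus_ring_simps SB.nucleus_ring_simps h_nuc g_nuc gh hg nucleus_carrier)
  qed (auto simp: SA.nucleus_ring_simps SB.nucleus_ring_simps g_nuc gE nucleus_carrier)
  have hR: "h \<in> ring_iso ?R ?R'"
  proof (rule ring_iso_memI)
    show "bij_betw h (carrier ?R) (carrier ?R')"
      by (rule bij_betwI[where g = g])
         (auto simp: SA.nucleus_ring_simps SB.nucleus_ring_simps h_nuc g_nuc gh hg nucleus_carrier)
  qed (auto simp: SA.nucleus_ring_simps SB.nucleus_ring_simps h_nuc hE nucleus_carrier)

  \<comment> \<open>Any diagonal position serves on the \<open>A\<close> side;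
    \<open>n \<ge> 1\<close> provides this one.\<close>
  have q: "1 \<in> {1..n}" using \<open>n \<ge> 1\<close> by simp
  let ?e = "SA.E 1 1 \<one>\<^bsub>A\<^esub>"
  obtain m \<pi> where m: "m \<ge> 1"
    and \<pi>: "algebra_epi F ?R (skew_matrices A m (\<lambda>_ _ _. \<one>\<^bsub>F\<^esub>)) \<pi>"
    and \<pi>_ker: "\<And>x y. x \<in> carrier ?R \<Longrightarrow> y \<in> carrier ?R \<Longrightarrow>
      \<pi> x = \<pi> y \<longleftrightarrow> x \<ominus>\<^bsub>?R\<^esub> y \<in> corner_radical ?R ?e"
    using SA.matrix_quotient[OF q] by blast
  interpret cA: simple_corner ?R' A "h \<circ> SA.E 1 1"
    by (rule simple_corner_iso[OF SA.corner[OF q] hR rings(2)])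
  have "\<exists>j\<in>{1..n'}. SB.E j j \<one>\<^bsub>B\<^esub> \<notin> corner_radical ?R' (h ?e)"
  proof (rule ccontr)
    assume "\<not> ?thesis"
    then have "(\<lambda>j. SB.E j j \<one>\<^bsub>B\<^esub>) \<in> {1..n'} \<rightarrow> corner_radical ?R' (h ?e)" by auto
    then have "(\<Oplus>\<^bsub>?R'\<^esub>j\<in>{1..n'}. SB.E j j \<one>\<^bsub>B\<^esub>) \<in> corner_radical ?R' (h ?e)"
      using ideal.ideal_finsum[OF cA.radical_ideal, of "{1..n'}"] by simp
    then show False using cA.one_notin_radical by (simp add: SB.sum_idempotents del: One_nat_def)
  qed
  then obtain j where j: "j \<in> {1..n'}" and linked: "SB.E j j \<one>\<^bsub>B\<^esub> \<notin> corner_radical ?R' (h ?e)"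
    by blast
  obtain m' \<rho> where m': "m' \<ge> 1"
    and \<rho>: "algebra_epi F ?R' (skew_matrices B m' (\<lambda>_ _ _. \<one>\<^bsub>F\<^esub>)) \<rho>"
    and \<rho>_ker: "\<And>x y. x \<in> carrier ?R' \<Longrightarrow> y \<in> carrier ?R' \<Longrightarrow>
      \<rho> x = \<rho> y \<longleftrightarrow> x \<ominus>\<^bsub>?R'\<^esub> y \<in> corner_radical ?R' (SB.E j j \<one>\<^bsub>B\<^esub>)"
    using SB.matrix_quotient[OF j] by blast
  have radicals: "corner_radical ?R' (h ?e) = corner_radical ?R' (SB.E j j \<one>\<^bsub>B\<^esub>)"
    using corner_radical_eq[OF cA.simple_corner_axioms SB.corner[OF j]] linked by simp

  \<comment> \<open>Together with \<open>\<rho>\<close> this gives two surjections from the same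
    nucleus. Their kernels agree because \<open>radicals\<close> identifies the transported radical
    with the one at position j.\<close>
  have "algebra_epi F ?R' (skew_matrices A m (\<lambda>_ _ _. \<one>\<^bsub>F\<^esub>)) (\<pi> \<circ> g)"
    unfolding algebra_epi_def
  proof (intro conjI ballI)
    show "\<pi> \<circ> g \<in> ring_hom ?R' (skew_matrices A m (\<lambda>_ _ _. \<one>\<^bsub>F\<^esub>))"
      by (rule ring_hom_trans[of g ?R' ?R]) (use gR \<pi> in \<open>simp_all add: ring_iso_def algebra_epi_def\<close>)
    have "g ` carrier ?R' = carrier ?R" using ring_iso_memE(5)[OF gR] by (simp add: bij_betw_def)
    then show "(\<pi> \<circ> g) ` carrier ?R' = carrier (skew_matrices A m (\<lambda>_ _ _. \<one>\<^bsub>F\<^esub>))"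
      using \<pi> by (simp add: algebra_epi_def flip: image_image)
    fix r y assume "r \<in> carrier F" "y \<in> carrier ?R'"
    then show "(\<pi> \<circ> g) (r \<odot>\<^bsub>?R'\<^esub> y) = r \<odot>\<^bsub>skew_matrices A m (\<lambda>_ _ _. \<one>\<^bsub>F\<^esub>)\<^esub> (\<pi> \<circ> g) y"
      using \<pi> by (simp add: algebra_epi_def SA.nucleus_ring_simps SB.nucleus_ring_simps g_smult g_nuc nucleus_carrier)
  qed
  moreover have "(\<pi> \<circ> g) x = (\<pi> \<circ> g) y \<longleftrightarrow> \<rho> x = \<rho> y" if xy: "x \<in> carrier ?R'" "y \<in> carrier ?R'" for x y
  proof -
    have gxy: "g x \<in> carrier ?R" "g y \<in> carrier ?R" using xy by (simp_all add: ring_iso_memE(1)[OF gR])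
    interpret R: ring ?R by (rule rings)
    interpret R': ring ?R' by (rule rings)
    have "h (g x \<ominus>\<^bsub>?R\<^esub> g y) = h (g x) \<ominus>\<^bsub>?R'\<^esub> h (g y)"
    proof -
      interpret ring_hom_ring ?R ?R' h
        by (rule ring_hom_ringI2) (use rings hR in \<open>simp_all add: ring_iso_def\<close>)
      show ?thesis using gxy by (simp add: a_minus_def)
    qed
    also have "\<dots> = x \<ominus>\<^bsub>?R'\<^esub> y"
      using xy by (simp add: hg SB.nucleus_ring_simps nucleus_carrier)
    finally have "x \<ominus>\<^bsub>?R'\<^esub> y \<in> corner_radical ?R' (h ?e) \<longleftrightarrow> g x \<ominus>\<^bsub>?R\<^esub> g y \<in> corner_radical ?R ?e"
      using corner_radical_iso[OF hR rings, of ?e "g x \<ominus>\<^bsub>?R\<^esub> g y"] gxy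
        simple_corner.closed[OF SA.corner[OF q], of "\<one>\<^bsub>A\<^esub>"] by simp
    then show ?thesis
      using \<pi>_ker[OF gxy] \<rho>_ker[OF xy] by (simp add: radicals del: One_nat_def)
  qed
  ultimately have mid: "algebra_isomorphic F (skew_matrices A m (\<lambda>_ _ _. \<one>\<^bsub>F\<^esub>)) (skew_matrices B m' (\<lambda>_ _ _. \<one>\<^bsub>F\<^esub>))"
    using algebra_epi_same_kernel[OF _ \<rho> SB.nucleus_ring_algebra] by blast

  have "cring F" using \<open>field F\<close> by (simp add: field_def domain_def)
  then interpret QA: skew_matrix_ring F A m "\<lambda>_ _ _. \<one>\<^bsub>F\<^esub>"
    by (intro skew_matrix_ring.intro skew_matrix_ring_axioms.intro A.assoc_algebra_axioms unit_skew_set)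
  interpret QB: skew_matrix_ring F B m' "\<lambda>_ _ _. \<one>\<^bsub>F\<^esub>"
    using \<open>cring F\<close>
    by (intro skew_matrix_ring.intro skew_matrix_ring_axioms.intro B.assoc_algebra_axioms unit_skew_set)
  have "algebra_isomorphic F (tensor_algebra F A (matrix_algebra F m)) (tensor_algebra F B (matrix_algebra F m'))"
    unfolding matrix_algebra_def
    by (rule algebra_isomorphic_trans[OF algebra_isomorphic_sym[OF QA.skew_matrices_tensor QA.S_algebra]
        algebra_isomorphic_trans[OF mid QB.skew_matrices_tensor]])
  \<comment> \<open>In \<open>brauer_equivalent\<close> the size on the \<open>A\<close> side is the
    second of the two bound numbers, so \<open>m\<close> and \<open>m'\<close> exchange their
    names.\<close>
  then show ?thesis using m m' unfolding brauer_equivalent_def by blast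
qed

end
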